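(* Let $\overline{N}:=N+2\gamma$ and assume $N\geq 5+2\gamma$. Then for any $u\in C_{0}^{\infty}(\mathbb{R}^{N})$, $$\int_{\mathbb{R}^{N}}|\Delta_{k}u|^{2}\,d\mu_{k}\ \geq\ \frac{\overline{N}^{2}}{4}\int_{\mathbb{R}^{N}}\frac{|\nabla_{k}u|^{2}}{|x|^{2}}\,d\mu_{k},$$ and the constant $\frac{\overline{N}^{2}}{4}$ is sharp, i.e. it cannot be replaced by any larger constant for which the inequality holds for all such $u$.
   Context: Dunkl setting. $R\subset\mathbb{R}^{N}\setminus\{0\}$ is a root system: a finite set with $R\cap\mathbb{R}\alpha=\{-\alpha,\alpha\}$ and $\sigma_{\alpha}(R)=R$ for all $\alpha\in R$, where $\sigma_{\alpha}x=x-2\frac{\langle\alpha,x\rangle}{\langle\alpha,\alpha\rangle}\alpha$; it is normalized so that $|\alpha|^{2}=2$ for all $\alpha\in R$. $G$ is the finite group generated by the reflections $\sigma_{\alpha}$, $\alpha\in R$. $R_{+}$ is a fixed positive subsystem, so $R=R_{+}\cup(-R_{+})$ (disjoint union). $k:R\to[0,\infty)$, $\alpha\mapsto k_{\alpha}$, is a $G$-invariant function, and $\gamma:=\sum_{\alpha\in R_{+}}k_{\alpha}$. The Dunkl operators are $$T_{i}u(x)=\partial_{i}u(x)+\sum_{\alpha\in R_{+}}k_{\alpha}\alpha_{i}\frac{u(x)-u(\sigma_{\alpha}x)}{\langle\alpha,x\rangle},\qquad i=1,\dots,N,$$ $\nabla_{k}=(T_{1},\dots,T_{N})$ and $\Delta_{k}=\sum_{i=1}^{N}T_{i}^{2}$.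 The weighted measure is $d\mu_{k}=\omega_{k}(x)\,dx$ with $\omega_{k}(x)=\prod_{\alpha\in R_{+}}|\langle\alpha,x\rangle|^{2k_{\alpha}}$. Functions $u$ are real-valued. *)

theory Defs
  imports "HOL-Analysis.Analysis" "HOL-Algebra.Bij" "HOL-Algebra.Generated_Groups"
begin

definition reflection :: "real^'n \<Rightarrow> real^'n \<Rightarrow> real^'n" where
  "reflection \<alpha> x = x - (2 * (\<alpha> \<bullet> x) / (\<alpha> \<bullet> \<alpha>)) *\<^sub>R \<alpha>"

definition normalized_root_system :: "(real^'n) set \<Rightarrow> bool" where
  "normalized_root_system R \<longleftrightarrow>
     finite R \<and> 0 \<notin> R \<and>
     (\<forall>\<alpha>\<in>R. R \<inter> range (\<lambda>t. t *\<^sub>R \<alpha>) = {- \<alpha>, \<alpha>}) \<and>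
     (\<forall>\<alpha>\<in>R. reflection \<alpha> ` R = R) \<and>
     (\<forall>\<alpha>\<in>R. (norm \<alpha>)\<^sup>2 = 2)"

definition reflection_group :: "(real^'n) set \<Rightarrow> (real^'n \<Rightarrow> real^'n) set" where
  "reflection_group R = generate (BijGroup UNIV) (reflection ` R)"

text \<open>
  Only the disjoint decomposition is required. Choices of \<^term>\<open>Rp\<close> cut out by a hyperplane
  through the origin are included as a special case.
\<close>

definition positive_subsystem :: "(real^'n) set \<Rightarrow> (real^'n) set \<Rightarrow> bool" where
  "positive_subsystem Rp R \<longleftrightarrow> R = Rp \<union> uminus ` Rp \<and> Rp \<inter> uminus ` Rp = {}"

definition multiplicity_function :: "(real^'n) set \<Rightarrow> (real^'n \<Rightarrow> real) \<Rightarrow> bool" where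
  "multiplicity_function R k \<longleftrightarrow>
     (\<forall>\<alpha>\<in>R. 0 \<le> k \<alpha>) \<and> (\<forall>g\<in>reflection_group R. \<forall>\<alpha>\<in>R. k (g \<alpha>) = k \<alpha>)"

definition partial_derivative :: "'n \<Rightarrow> (real^'n \<Rightarrow> real) \<Rightarrow> real^'n \<Rightarrow> real" where
  "partial_derivative i u x = frechet_derivative u (at x) (axis i 1)"

text \<open>
  A function is smooth iff all its iterated partial derivatives, of every order, are (totally)
  differentiable everywhere; the empty list is the function itself.
\<close>

definition smooth :: "(real^'n \<Rightarrow> real) \<Rightarrow> bool" where
  "smooth u \<longleftrightarrow> (\<forall>is. \<forall>x. foldr partial_derivative is u differentiable (at x))"

definition test_functions :: "(real^'n \<Rightarrow> real) set" where
  "test_functions = {u. smooth u \<and> compact (closure {x. u x \<noteq> 0})}"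

text \<open>
  The quotient $(u(x) - u(\sigma_\alpha x)) / \langle \alpha, x \rangle$ of the Dunkl operator.
  On the null set $\langle \alpha, x \rangle = 0$, where the formula reads $0/0$, it is given
  its limiting value for smooth $u$. As $|\alpha|^2 = 2$, we have
  $\sigma_\alpha x = x - \langle \alpha, x \rangle \alpha$, so the limit is the derivative
  of $u$ at $x$ in direction $\alpha$.
\<close>

definition reflection_quotient :: "real^'n \<Rightarrow> (real^'n \<Rightarrow> real) \<Rightarrow> real^'n \<Rightarrow> real" where
  "reflection_quotient \<alpha> u x =
     (if \<alpha> \<bullet> x = 0 then frechet_derivative u (at x) \<alpha>
      else (u x - u (reflection \<alpha> x)) / (\<alpha> \<bullet> x))"

definition dunkl_operator ::
  "(real^'n) set \<Rightarrow> (real^'n \<Rightarrow> real) \<Rightarrow> 'n \<Rightarrow> (real^'n \<Rightarrow> real) \<Rightarrow> real^'n \<Rightarrow> real" where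
  "dunkl_operator Rp k i u x =
     partial_derivative i u x + (\<Sum>\<alpha>\<in>Rp. k \<alpha> * \<alpha> $ i * reflection_quotient \<alpha> u x)"

definition dunkl_gradient ::
  "(real^'n) set \<Rightarrow> (real^'n \<Rightarrow> real) \<Rightarrow> (real^'n \<Rightarrow> real) \<Rightarrow> real^'n \<Rightarrow> real^'n" where
  "dunkl_gradient Rp k u x = (\<chi> i. dunkl_operator Rp k i u x)"

definition dunkl_laplacian ::
  "(real^'n) set \<Rightarrow> (real^'n \<Rightarrow> real) \<Rightarrow> (real^'n \<Rightarrow> real) \<Rightarrow> real^'n \<Rightarrow> real" where
  "dunkl_laplacian Rp k u x =
     (\<Sum>i\<in>UNIV. dunkl_operator Rp k i (dunkl_operator Rp k i u) x)"

text \<open>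
  \<^term>\<open>0 powr 0 = (0::real)\<close> in HOL, so for \<^term>\<open>k \<alpha> = 0\<close> the factor below is 0 instead
  of 1 on the hyperplane orthogonal to \<^term>\<open>\<alpha>\<close>; this is a null set for Lebesgue measure.
\<close>

definition dunkl_weight :: "(real^'n) set \<Rightarrow> (real^'n \<Rightarrow> real) \<Rightarrow> real^'n \<Rightarrow> real" where
  "dunkl_weight Rp k x = (\<Prod>\<alpha>\<in>Rp. \<bar>\<alpha> \<bullet> x\<bar> powr (2 * k \<alpha>))"

definition dunkl_measure :: "(real^'n) set \<Rightarrow> (real^'n \<Rightarrow> real) \<Rightarrow> (real^'n) measure" where
  "dunkl_measure Rp k = density lborel (\<lambda>x. ennreal (dunkl_weight Rp k x))"

end

theory Submission
  imports Defs
begin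

text \<open>
  Write $M = \overline N$, let $E$ be the Euler operator, $A u = \sum_\alpha k_\alpha (u - u \circ \sigma_\alpha)$ and
  let $-L$ be $|x|^2$ times the angular part of $\Delta_k$, so $L = E (E + M - 2) - |x|^2 \Delta_k$. It is symmetric
  with respect to every radial weight. If $u = |x|^2 v$, then in $L^2(\mu_k)$, where $F = E + M/2$ is
  skew-symmetric, the difference of the two sides of the inequality equals
  \[ \|F^2 v\|^2 + (M/2 - 2)^2 \|F v\|^2 + 2 \langle F v, L F v \rangle
     + \langle v, (L^2 + \tfrac{M (M - 8)}{4} L - \tfrac{M^2}{2} A) v \rangle. \]
  By the Fischer decomposition, polynomials are sums of eigenfunctions of $L$ with eigenvalues
  $c_a = a (a + M - 2)$, and $A$ vanishes on the eigenspace of $c_0 = 0$ and is at most $2 \gamma$ on the others.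
  So the last term is nonnegative on polynomials as soon as $c_1 (c_1 + M (M - 8) / 4) \geq M^2 \gamma$ with
  $c_1 = M - 1$; this is where $N \geq 5 + 2 \gamma$, that is $M \geq 5 + 4 \gamma$, enters. Polynomials are
  dense in the graph norm of $L$ on balls. For sharpness, cut off the functions
  $v = (|x|^2 + \delta)^{-M/4}$, for which $F v$ and $F^2 v$ stay bounded while $\|v\| \to \infty$.
\<close>

section \<open>Smooth functions\<close>

text \<open>The substitution u = |x|^2 v removes the singular weight and turns both sides into
  quadratic forms in \<open>\<F>\<close>, \<open>\<L>\<close> and \<open>\<A>\<close>, where
  \<open>\<F>\<close> commutes with \<open>\<L>\<close>. The two coefficients of ||v||^2, (M (M - 4)
  / 4)^2 and (M^2 / 4) (M / 2 - 2)^2, agree. This is the origin of the constant, and it dictates the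
  near-minimizers: radial v with F v close to 0, that is v close to |x|^(- M / 2). The obstacle is
  \<open>\<A>\<close>, which appears in the gradient because Dunkl operators violate the Leibniz
  rule. Its coefficient - M^2 / 2 is negative and has to be absorbed by the spectrum of
  \<open>\<L>\<close>; for M < 8 the coefficient of \<open>\<L>\<close> is negative too, and the
  square of \<open>\<L>\<close> must pay for both. At the lowest nonzero eigenvalue this succeeds
  for M = 5 + 4 \<gamma> with room 1, since (M - 1) (M - 1 + M (M - 8) / 4) = M^2 (M - 5) / 4 + 1.
  As the weight is in general not smooth on the reflecting hyperplanes, integration by parts goes
  through the smooth weights \<open>\<W> \<epsilon>\<close>.\<close>

lemma partial_derivative_eq:
  "(u has_derivative u') (at x) \<Longrightarrow> partial_derivative i u x = u' (axis i 1)"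
  by (metis frechet_derivative_at partial_derivative_def)

lemma frechet_derivative_eq_sum:
  fixes u :: "real^'n \<Rightarrow> real"
  assumes "u differentiable (at x)"
  shows "frechet_derivative u (at x) h = (\<Sum>i\<in>UNIV. h $ i * partial_derivative i u x)"
proof -
  have "linear (frechet_derivative u (at x))"
    using assms by (rule linear_frechet_derivative)
  moreover have "h = (\<Sum>i\<in>UNIV. (h $ i) *\<^sub>R axis i 1)"
    using basis_expansion[of h] by (simp add: scalar_mult_eq_scaleR)
  ultimately have "frechet_derivative u (at x) h
      = (\<Sum>i\<in>UNIV. frechet_derivative u (at x) ((h $ i) *\<^sub>R axis i 1))"
    by (metis linear_sum)
  then show ?thesis
    using \<open>linear _\<close> by (simp add: linear_cmul partial_derivative_def)
qed

text \<open>The definition of \<open>smooth\<close> speaks of all words of partial derivatives at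
  once. Counting orders from the innermost derivative outwards makes closure under products and
  compositions an induction on the order, with the function generalized.\<close>

primrec times_differentiable :: "nat \<Rightarrow> (real^'n \<Rightarrow> real) \<Rightarrow> bool" where
  "times_differentiable 0 u \<longleftrightarrow> True"
| "times_differentiable (Suc n) u \<longleftrightarrow>
     (\<forall>x. u differentiable (at x)) \<and> (\<forall>i. times_differentiable n (partial_derivative i u))"

lemma smooth_differentiable: "smooth u \<Longrightarrow> u differentiable (at x)"
  unfolding smooth_def by (metis foldr.simps(1) id_apply)

lemma smooth_partial_derivative:
  assumes "smooth u" shows "smooth (partial_derivative i u)"
  unfolding smooth_def
proof (intro allI)
  fix "is" x
  have "foldr partial_derivative (is @ [i]) u differentiable at x"
    using assms unfolding smooth_def by blast
  then show "foldr partial_derivative is (partial_derivative i u) differentiable at x" by simp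
qed

lemma smooth_iff: "smooth u \<longleftrightarrow> (\<forall>n. times_differentiable n u)"
proof
  assume "smooth u"
  then have "times_differentiable n u" for n
    by (induction n arbitrary: u) (auto simp: smooth_differentiable smooth_partial_derivative)
  then show "\<forall>n. times_differentiable n u" by blast
next
  have "times_differentiable (Suc (length is)) u \<Longrightarrow> foldr partial_derivative is u differentiable (at x)"
    for "is" x and u :: "real^'n \<Rightarrow> real"
    \<comment> \<open>\<open>foldr\<close> applies the last index first, so the list is taken apart
      from its end.\<close>
    by (induction "is" arbitrary: u rule: rev_induct) auto
  then show "\<forall>n. times_differentiable n u \<Longrightarrow> smooth u"
    unfolding smooth_def by blast
qed

lemma times_differentiable_Suc_imp: "times_differentiable (Suc n) u \<Longrightarrow> times_differentiable n u"
  by (induction n arbitrary: u) auto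

lemma has_derivative_partial:
  fixes u :: "real^'n \<Rightarrow> real"
  assumes "u differentiable (at x)"
  shows "(u has_derivative (\<lambda>h. \<Sum>i\<in>UNIV. h $ i * partial_derivative i u x)) (at x)"
proof -
  have "(u has_derivative frechet_derivative u (at x)) (at x)"
    using assms frechet_derivative_works by blast
  moreover have "frechet_derivative u (at x) = (\<lambda>h. \<Sum>i\<in>UNIV. h $ i * partial_derivative i u x)"
    using frechet_derivative_eq_sum[OF assms] by blast
  ultimately show ?thesis by simp
qed

lemma differentiable_partial_derivative_simps:
  fixes u v :: "real^'n \<Rightarrow> real"
  assumes "u differentiable (at x)" "v differentiable (at x)"
  shows partial_derivative_add:
      "partial_derivative i (\<lambda>x. u x + v x) x = partial_derivative i u x + partial_derivative i v x"
    and partial_derivative_diff: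
      "partial_derivative i (\<lambda>x. u x - v x) x = partial_derivative i u x - partial_derivative i v x"
    and partial_derivative_mult:
      "partial_derivative i (\<lambda>x. u x * v x) x = partial_derivative i u x * v x + u x * partial_derivative i v x"
proof -
  obtain u' v' where uv: "(u has_derivative u') (at x)" "(v has_derivative v') (at x)"
    using assms unfolding differentiable_def by blast
  note [simp] = partial_derivative_eq[OF uv(1)] partial_derivative_eq[OF uv(2)]
  show "partial_derivative i (\<lambda>x. u x + v x) x = partial_derivative i u x + partial_derivative i v x"
    using partial_derivative_eq[OF has_derivative_add[OF uv]] by simp
  show "partial_derivative i (\<lambda>x. u x - v x) x = partial_derivative i u x - partial_derivative i v x"
    using partial_derivative_eq[OF has_derivative_diff[OF uv]] by simp
  show "partial_derivative i (\<lambda>x. u x * v x) x = partial_derivative i u x * v x + u x * partial_derivative i v x"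
    using partial_derivative_eq[OF has_derivative_mult[OF uv]] by simp
qed

lemma partial_derivative_const [simp]: "partial_derivative i (\<lambda>x. c) = (\<lambda>x. 0)"
  by (rule ext) (rule partial_derivative_eq[OF has_derivative_const])

lemma partial_derivative_linear:
  "linear f \<Longrightarrow> partial_derivative i f x = f (axis i 1)"
  by (rule partial_derivative_eq) (simp add: linear_imp_has_derivative)

lemma partial_derivative_sum:
  fixes f :: "'a \<Rightarrow> real^'n \<Rightarrow> real"
  assumes "finite S" "\<And>a. a \<in> S \<Longrightarrow> f a differentiable (at x)"
  shows "partial_derivative i (\<lambda>x. \<Sum>a\<in>S. f a x) x = (\<Sum>a\<in>S. partial_derivative i (f a) x)"
  using assms
proof (induction S rule: finite_induct)
  case (insert a S)
  have "(\<lambda>x. \<Sum>a\<in>S. f a x) differentiable (at x)"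
    using insert by (intro differentiable_sum) auto
  with insert show ?case
    by (simp add: partial_derivative_add)
qed simp

lemma partial_derivative_compose_linear:
  fixes u :: "real^'n \<Rightarrow> real" and f :: "real^'n \<Rightarrow> real^'n"
  assumes "linear f" "u differentiable (at (f x))"
  shows "partial_derivative i (\<lambda>x. u (f x)) x = (\<Sum>j\<in>UNIV. f (axis i 1) $ j * partial_derivative j u (f x))"
proof -
  have "(f has_derivative f) (at x)" using assms(1) by (rule linear_imp_has_derivative)
  from partial_derivative_eq[OF has_derivative_compose[OF this has_derivative_partial[OF assms(2)]]]
  show ?thesis .
qed

lemma times_differentiable_add:
  "times_differentiable n u \<Longrightarrow> times_differentiable n v \<Longrightarrow> times_differentiable n (\<lambda>x. u x + v x)"
proof (induction n arbitrary: u v)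
  case (Suc n)
  then have "partial_derivative i (\<lambda>x. u x + v x) = (\<lambda>x. partial_derivative i u x + partial_derivative i v x)" for i
    by (auto simp: partial_derivative_add)
  with Suc show ?case by simp
qed simp

lemma times_differentiable_mult:
  "times_differentiable n u \<Longrightarrow> times_differentiable n v \<Longrightarrow> times_differentiable n (\<lambda>x. u x * v x)"
proof (induction n arbitrary: u v)
  case (Suc n)
  then have "partial_derivative i (\<lambda>x. u x * v x)
      = (\<lambda>x. partial_derivative i u x * v x + u x * partial_derivative i v x)" for i
    by (auto simp: partial_derivative_mult)
  moreover have "times_differentiable n u" "times_differentiable n v"
    using Suc.prems times_differentiable_Suc_imp by blast+
  ultimately show ?case using Suc by (simp add: times_differentiable_add)
qed simp

lemma times_differentiable_const: "times_differentiable n (\<lambda>x. c)"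
  by (induction n arbitrary: c) auto

lemma times_differentiable_diff:
  "times_differentiable n u \<Longrightarrow> times_differentiable n v \<Longrightarrow> times_differentiable n (\<lambda>x. u x - v x)"
  using times_differentiable_add[OF _ times_differentiable_mult[OF times_differentiable_const[of n "-1"]], of u v]
  by simp

lemma smooth_const [intro, simp]: "smooth (\<lambda>x. c)"
  by (simp add: smooth_iff times_differentiable_const)

lemma smooth_add [intro]: "smooth u \<Longrightarrow> smooth v \<Longrightarrow> smooth (\<lambda>x. u x + v x)"
  by (simp add: smooth_iff times_differentiable_add)

lemma smooth_mult [intro]: "smooth u \<Longrightarrow> smooth v \<Longrightarrow> smooth (\<lambda>x. u x * v x)"
  by (simp add: smooth_iff times_differentiable_mult)

lemma smooth_cmult: "smooth u \<Longrightarrow> smooth (\<lambda>x. c * u x)"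
  by (rule smooth_mult) auto

lemma smooth_minus [intro]: "smooth u \<Longrightarrow> smooth (\<lambda>x. - u x)"
  using smooth_cmult[of u "-1"] by simp

lemma smooth_diff [intro]: "smooth u \<Longrightarrow> smooth v \<Longrightarrow> smooth (\<lambda>x. u x - v x)"
  using smooth_add[OF _ smooth_minus, of u v] by simp

lemma smooth_sum [intro]: "(\<And>a. a \<in> S \<Longrightarrow> smooth (f a)) \<Longrightarrow> smooth (\<lambda>x. \<Sum>a\<in>S. f a x)"
  by (induction S rule: infinite_finite_induct) auto

lemma smooth_prod [intro]: "(\<And>a. a \<in> S \<Longrightarrow> smooth (f a)) \<Longrightarrow> smooth (\<lambda>x. \<Prod>a\<in>S. f a x)"
  by (induction S rule: infinite_finite_induct) auto

lemma smooth_power [intro]: "smooth u \<Longrightarrow> smooth (\<lambda>x. u x ^ n)"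
  by (induction n) auto

lemma smooth_linear:
  fixes f :: "real^'n \<Rightarrow> real"
  assumes "linear f" shows "smooth f"
  unfolding smooth_iff
proof
  fix n
  have "partial_derivative i f = (\<lambda>x. f (axis i 1))" for i
    using partial_derivative_linear[OF assms] by blast
  moreover have "f differentiable (at x)" for x
    using assms linear_imp_differentiable by blast
  ultimately show "times_differentiable n f"
    by (cases n) (auto simp: times_differentiable_const)
qed

lemma smooth_nth [intro, simp]: "smooth (\<lambda>x::real^'n. x $ i)"
  by (rule smooth_linear) (simp add: linear_iff)

lemma smooth_inner [intro, simp]: "smooth (\<lambda>x::real^'n. a \<bullet> x)"
  by (rule smooth_linear) (simp add: linear_iff inner_right_distrib)

lemma smooth_inner_self [intro, simp]: "smooth (\<lambda>x::real^'n. x \<bullet> x)"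
  by (simp add: inner_vec_def smooth_sum smooth_mult)

lemma smooth_continuous_on [intro]: "smooth u \<Longrightarrow> continuous_on S u"
  by (simp add: continuous_at_imp_continuous_on differentiable_imp_continuous_within smooth_differentiable)

lemma smooth_borel_measurable [measurable_dest, intro]: "smooth u \<Longrightarrow> u \<in> borel_measurable borel"
  by (intro borel_measurable_continuous_onI smooth_continuous_on)

lemma smooth_compose_linear:
  fixes u :: "real^'n \<Rightarrow> real" and f :: "real^'n \<Rightarrow> real^'n"
  assumes "linear f" "smooth u"
  shows "smooth (\<lambda>x. u (f x))"
proof -
  have "smooth u \<Longrightarrow> times_differentiable n (\<lambda>x. u (f x))" for n and u :: "real^'n \<Rightarrow> real"
  proof (induction n arbitrary: u)
    case (Suc n)
    have sum: "times_differentiable n (\<lambda>x. \<Sum>j\<in>S. c j * w j x)"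
      if "finite S" "\<And>j. times_differentiable n (w j)" for S :: "'n set" and c w
      using that by induction
        (auto simp: times_differentiable_const times_differentiable_add times_differentiable_mult)
    have "partial_derivative i (\<lambda>x. u (f x)) = (\<lambda>x. \<Sum>j\<in>UNIV. f (axis i 1) $ j * partial_derivative j u (f x))" for i
      using partial_derivative_compose_linear[OF assms(1)] Suc.prems smooth_differentiable by blast
    moreover have "(\<lambda>x. u (f x)) differentiable (at x)" for x
      using has_derivative_compose[OF linear_imp_has_derivative[OF assms(1)]
          has_derivative_partial[OF smooth_differentiable[OF Suc.prems]]]
      unfolding differentiable_def by blast
    ultimately show ?case
      using Suc by (simp add: sum smooth_partial_derivative)
  qed simp
  with assms show ?thesis by (simp add: smooth_iff)
qed

lemma partial_derivative_compose_real:
  fixes u :: "real^'n \<Rightarrow> real"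
  assumes "u differentiable (at x)" "(g has_real_derivative g') (at (u x))"
  shows "partial_derivative i (\<lambda>x. g (u x)) x = g' * partial_derivative i u x"
    and "(\<lambda>x. g (u x)) differentiable (at x)"
proof -
  have *: "((\<lambda>x. g (u x)) has_derivative (\<lambda>h. g' * (\<Sum>i\<in>UNIV. h $ i * partial_derivative i u x))) (at x)"
    using has_derivative_compose[OF has_derivative_partial[OF assms(1)] assms(2)[unfolded has_field_derivative_def]] .
  show "(\<lambda>x. g (u x)) differentiable (at x)" using * unfolding differentiable_def by blast
  show "partial_derivative i (\<lambda>x. g (u x)) x = g' * partial_derivative i u x"
    using partial_derivative_eq[OF *, of i] partial_derivative_eq[OF has_derivative_partial[OF assms(1)], of i]
    by simp
qed

text \<open>The derivatives of the outer function are supplied as a whole sequence \<open>G\<close>,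
  and only along the range of \<open>u\<close>. This covers powers of \<open>t + \<epsilon>\<close>,
  which are controlled only for nonnegative \<open>t\<close>.\<close>

lemma smooth_compose_real:
  fixes u :: "real^'n \<Rightarrow> real" and G :: "nat \<Rightarrow> real \<Rightarrow> real"
  assumes "smooth u" and G: "\<And>n t. t \<in> range u \<Longrightarrow> (G n has_real_derivative G (Suc n) t) (at t)"
  shows "smooth (\<lambda>x. G 0 (u x))"
proof -
  have "times_differentiable n (\<lambda>x. G m (u x))" for n m
  proof (induction n arbitrary: m)
    case (Suc n)
    note * = partial_derivative_compose_real[OF smooth_differentiable[OF assms(1)] G]
    have "partial_derivative i (\<lambda>x. G m (u x)) = (\<lambda>x. G (Suc m) (u x) * partial_derivative i u x)" for i
      using *(1) by blast
    moreover have "times_differentiable n (partial_derivative i u)" for i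
      using assms(1) smooth_iff smooth_partial_derivative by blast
    ultimately show ?case using *(2) Suc.IH
      by (simp add: times_differentiable_mult)
  qed simp
  then show ?thesis by (simp add: smooth_iff)
qed

lemma partial_derivative_inner [simp]: "partial_derivative i (\<lambda>x. a \<bullet> x) x = a $ i"
  using partial_derivative_linear[of "\<lambda>x. a \<bullet> x" i x] by (simp add: linear_iff inner_right_distrib inner_axis)

lemma partial_derivative_nth [simp]: "partial_derivative i (\<lambda>x. x $ j) x = (if i = j then 1 else 0)"
  using partial_derivative_linear[of "\<lambda>x. x $ j" i x] by (simp add: linear_iff axis_def)

lemma partial_derivative_inner_self [simp]: "partial_derivative i (\<lambda>x::real^'n. x \<bullet> x) x = 2 * x $ i"
proof -
  have "((\<lambda>x::real^'n. x \<bullet> x) has_derivative (\<lambda>h. x \<bullet> h + h \<bullet> x)) (at x)"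
    by (intro derivative_eq_intros) auto
  from partial_derivative_eq[OF this] show ?thesis
    by (simp add: inner_axis inner_axis' )
qed

section \<open>Symmetry of mixed second partial derivatives\<close>

lemma has_real_derivative_line:
  fixes u :: "real^'n \<Rightarrow> real"
  assumes "smooth u"
  shows "((\<lambda>s. u (p + s *\<^sub>R v)) has_real_derivative
           (\<Sum>j\<in>UNIV. v $ j * partial_derivative j u (p + s *\<^sub>R v))) (at s within S)"
proof -
  have "((\<lambda>s. p + s *\<^sub>R v) has_derivative (\<lambda>h. h *\<^sub>R v)) (at s within S)"
    by (auto intro!: derivative_eq_intros)
  from has_derivative_compose[OF this has_derivative_partial[OF smooth_differentiable[OF assms]]]
  show ?thesis
    by (rule has_derivative_imp_has_field_derivative) (simp add: sum_distrib_left mult_ac)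
qed

text \<open>Two applications of the mean value theorem: in direction \<open>i\<close> to the
  difference in direction \<open>j\<close>, then in direction \<open>j\<close>. The second
  difference on the left does not change when \<open>i\<close> and \<open>j\<close> are exchanged,
  which makes it the bridge between the two mixed derivatives.\<close>

lemma second_difference_mean_value:
  fixes u :: "real^'n \<Rightarrow> real"
  assumes u: "smooth u" and "0 < h"
  shows "\<exists>y. dist y x \<le> 2 * h \<and>
    u (x + h *\<^sub>R axis i 1 + h *\<^sub>R axis j 1) - u (x + h *\<^sub>R axis i 1) - u (x + h *\<^sub>R axis j 1) + u x
     = h * (h * partial_derivative j (partial_derivative i u) y)"
proof -
  define g where "g s = u (x + h *\<^sub>R axis j 1 + s *\<^sub>R axis i 1) - u (x + s *\<^sub>R axis i 1)" for s
  have axis: "(\<Sum>j\<in>UNIV. axis i 1 $ j * w j) = w i" for i :: 'n and w :: "'n \<Rightarrow> real"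
    by (simp add: axis_def if_distrib if_distribR cong: if_cong)
  have g': "(g has_real_derivative (partial_derivative i u (x + h *\<^sub>R axis j 1 + s *\<^sub>R axis i 1)
              - partial_derivative i u (x + s *\<^sub>R axis i 1))) (at s)" for s
    unfolding g_def
    using DERIV_diff[OF has_real_derivative_line[OF u, of "x + h *\<^sub>R axis j 1" "axis i 1" s UNIV]
        has_real_derivative_line[OF u, of x "axis i 1" s UNIV]] by (simp add: axis)
  obtain \<xi> where \<xi>: "0 < \<xi>" "\<xi> < h" and g\<xi>: "g h - g 0 = (h - 0) * (partial_derivative i u (x + h *\<^sub>R axis j 1 + \<xi> *\<^sub>R axis i 1)
              - partial_derivative i u (x + \<xi> *\<^sub>R axis i 1))"
    using MVT2[OF \<open>0 < h\<close> g'] by blast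
  have k': "((\<lambda>s. partial_derivative i u (x + \<xi> *\<^sub>R axis i 1 + s *\<^sub>R axis j 1)) has_real_derivative
       partial_derivative j (partial_derivative i u) (x + \<xi> *\<^sub>R axis i 1 + s *\<^sub>R axis j 1)) (at s)" for s
    using has_real_derivative_line[OF smooth_partial_derivative[OF u], of i "x + \<xi> *\<^sub>R axis i 1" "axis j 1" s UNIV]
    by (simp add: axis)
  obtain \<eta> where \<eta>: "0 < \<eta>" "\<eta> < h" and k\<eta>: "partial_derivative i u (x + \<xi> *\<^sub>R axis i 1 + h *\<^sub>R axis j 1)
       - partial_derivative i u (x + \<xi> *\<^sub>R axis i 1 + 0 *\<^sub>R axis j 1)
      = (h - 0) * partial_derivative j (partial_derivative i u) (x + \<xi> *\<^sub>R axis i 1 + \<eta> *\<^sub>R axis j 1)"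
    using MVT2[OF \<open>0 < h\<close> k'] by blast
  have "dist (x + \<xi> *\<^sub>R axis i 1 + \<eta> *\<^sub>R axis j 1) x \<le> norm (\<xi> *\<^sub>R axis i (1::real)) + norm (\<eta> *\<^sub>R axis j (1::real))"
    by (metis (no_types, lifting) add.assoc add_diff_cancel_left' dist_norm norm_triangle_ineq)
  then have "dist (x + \<xi> *\<^sub>R axis i 1 + \<eta> *\<^sub>R axis j 1) x \<le> 2 * h"
    using \<xi> \<eta> by simp
  then show ?thesis
    using g\<xi> k\<eta> unfolding g_def
    by (intro exI[of _ "x + \<xi> *\<^sub>R axis i 1 + \<eta> *\<^sub>R axis j 1"]) (simp add: algebra_simps)
qed

lemma partial_derivative_commute:
  fixes u :: "real^'n \<Rightarrow> real"
  assumes u: "smooth u"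
  shows "partial_derivative i (partial_derivative j u) x = partial_derivative j (partial_derivative i u) x"
proof (rule ccontr)
  define f where "f = partial_derivative i (partial_derivative j u)"
  define g where "g = partial_derivative j (partial_derivative i u)"
  assume "\<not> ?thesis"
  then have e: "0 < \<bar>f x - g x\<bar> / 2" by (simp add: f_def g_def)
  have "continuous (at x) f" "continuous (at x) g"
    unfolding f_def g_def
    by (intro differentiable_imp_continuous_within smooth_differentiable smooth_partial_derivative u)+
  then obtain d d' where d: "d > 0" "d' > 0"
    and f: "\<And>y. dist y x < d \<Longrightarrow> dist (f y) (f x) < \<bar>f x - g x\<bar> / 2"
    and g: "\<And>y. dist y x < d' \<Longrightarrow> dist (g y) (g x) < \<bar>f x - g x\<bar> / 2"
    using e unfolding continuous_at_eps_delta by metis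
  define h where "h = min d d' / 4"
  have h: "0 < h" "2 * h < d" "2 * h < d'" using d by (auto simp: h_def)
  \<comment> \<open>Both mixed derivatives represent the same symmetric second difference, so they
    share a value within distance \<open>2 * h\<close> of \<open>x\<close>. Continuity then puts
    their values at \<open>x\<close> closer together than their supposed distance.\<close>
  obtain y z where "dist y x \<le> 2 * h" "dist z x \<le> 2 * h" "g y = f z"
    using second_difference_mean_value[OF u h(1), of x i j] second_difference_mean_value[OF u h(1), of x j i] h(1)
    unfolding f_def g_def by (auto simp: algebra_simps)
  then have "dist (f z) (f x) < \<bar>f x - g x\<bar> / 2" "dist (f z) (g x) < \<bar>f x - g x\<bar> / 2"
    using f[of z] g[of y] h by auto
  then show False by (simp add: dist_real_def abs_real_def split: if_splits)
qed

text \<open>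
  The difference quotient of a reflection is an average of derivatives along the segment from
  \<open>x\<close> to its mirror image; such averages, with polynomial densities, are closed under
  partial derivatives.
\<close>

definition segment_average :: "real^'n \<Rightarrow> nat \<Rightarrow> (real^'n \<Rightarrow> real) \<Rightarrow> real^'n \<Rightarrow> real" where
  "segment_average \<alpha> m v x = integral {0..1} (\<lambda>t. t ^ m * v (x - (t * (\<alpha> \<bullet> x)) *\<^sub>R \<alpha>))"

text \<open>Differentiation under the integral sign. In direction \<open>h\<close> the inner point
  moves by \<open>h - (t * (\<alpha> \<bullet> h)) *\<^sub>R \<alpha>\<close>, and the extra
  \<open>t\<close> raises the power in the density; this is why the averages come as a family in
  \<open>m\<close>.\<close>

lemma segment_average_has_derivative:
  fixes v :: "real^'n \<Rightarrow> real"
  assumes v: "smooth v"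
  shows "(segment_average \<alpha> m v has_derivative
     (\<lambda>h. \<Sum>j\<in>UNIV. h $ j * segment_average \<alpha> m (partial_derivative j v) x
         - (\<alpha> \<bullet> h) * (\<alpha> $ j * segment_average \<alpha> (Suc m) (partial_derivative j v) x))) (at x)"
proof -
  define \<Phi> where "\<Phi> t x = x - (t * (\<alpha> \<bullet> x)) *\<^sub>R \<alpha>" for t and x :: "real^'n"
  \<comment> \<open>The derivative of the integrand in \<open>x\<close>, packaged as a bounded
    linear map as \<open>leibniz_rule\<close> requires.\<close>
  define fx where "fx x t = (\<Sum>j\<in>UNIV. (t ^ m * partial_derivative j v (\<Phi> t x)) *\<^sub>R
      (blinfun_inner_right (axis j 1) - (t * \<alpha> $ j) *\<^sub>R blinfun_inner_right \<alpha>))" for t x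
  have cont: "continuous_on UNIV (\<lambda>(x, t). w (\<Phi> t x))" if "smooth w" for w
    unfolding split_beta \<Phi>_def
    by (intro continuous_on_compose2[OF smooth_continuous_on[OF that]] continuous_intros) auto
  have cont1: "continuous_on {0..1} (\<lambda>t. t ^ k * w (\<Phi> t x))" if "smooth w" for w k x
    unfolding \<Phi>_def
    by (intro continuous_intros continuous_on_compose2[OF smooth_continuous_on[OF that]]) auto
  have "((\<lambda>x. integral (cbox 0 1) (\<lambda>t. t ^ m * v (\<Phi> t x))) has_derivative
      blinfun_apply (integral (cbox 0 1) (fx x))) (at x within UNIV)"
  proof (rule leibniz_rule)
    show "((\<lambda>x. t ^ m * v (\<Phi> t x)) has_derivative blinfun_apply (fx x t)) (at x within UNIV)" for x t
    proof -
      have "(\<Phi> t has_derivative (\<lambda>h. h - (t * (\<alpha> \<bullet> h)) *\<^sub>R \<alpha>)) (at x)"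
        unfolding \<Phi>_def by (auto intro!: derivative_eq_intros)
      from has_derivative_compose[OF this has_derivative_partial[OF smooth_differentiable[OF v]]]
      have "((\<lambda>x. t ^ m * v (\<Phi> t x)) has_derivative (\<lambda>h. t ^ m * (\<Sum>j\<in>UNIV. (h - (t * (\<alpha> \<bullet> h)) *\<^sub>R \<alpha>) $ j *
          partial_derivative j v (\<Phi> t x)))) (at x)"
        by (rule has_derivative_mult_right)
      moreover have "(\<lambda>h. t ^ m * (\<Sum>j\<in>UNIV. (h - (t * (\<alpha> \<bullet> h)) *\<^sub>R \<alpha>) $ j *
          partial_derivative j v (\<Phi> t x))) = blinfun_apply (fx x t)"
        unfolding fx_def blinfun.sum_left blinfun.scaleR_left blinfun.diff_left sum_distrib_left
        by (intro ext sum.cong) (auto simp: inner_axis' algebra_simps)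
      ultimately show ?thesis by simp
    qed
    show "(\<lambda>t. t ^ m * v (\<Phi> t x)) integrable_on cbox 0 1" for x
      using integrable_continuous_real[OF cont1[OF v, of m x]] by simp
    show "continuous_on (UNIV \<times> cbox 0 1) (\<lambda>(x, t). fx x t)"
      unfolding fx_def split_beta
      by (intro continuous_intros continuous_on_subset[OF cont[unfolded split_beta]]
          smooth_partial_derivative v) auto
  qed auto
  moreover have "blinfun_apply (integral (cbox 0 1) (fx x)) =
     (\<lambda>h. \<Sum>j\<in>UNIV. h $ j * segment_average \<alpha> m (partial_derivative j v) x
         - (\<alpha> \<bullet> h) * (\<alpha> $ j * segment_average \<alpha> (Suc m) (partial_derivative j v) x))"
  proof
    fix h
    have int: "(\<lambda>t. t ^ k * partial_derivative j v (\<Phi> t x)) integrable_on {0..1}" for k j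
      by (intro integrable_continuous_real cont1 smooth_partial_derivative v)
    have "continuous_on {0..1} (fx x)"
      unfolding fx_def
      by (intro continuous_intros cont1[of _ m] smooth_partial_derivative v)
    then have "fx x integrable_on {0..1}" by (rule integrable_continuous_real)
    then have "blinfun_apply (integral (cbox 0 1) (fx x)) h = integral {0..1} (\<lambda>t. blinfun_apply (fx x t) h)"
      by (simp add: blinfun_apply_integral)
    also have "\<dots> = integral {0..1} (\<lambda>t. \<Sum>j\<in>UNIV. h $ j * (t ^ m * partial_derivative j v (\<Phi> t x))
        - (\<alpha> \<bullet> h) * (\<alpha> $ j * (t ^ Suc m * partial_derivative j v (\<Phi> t x))))"
      by (auto simp: fx_def blinfun.sum_left blinfun.scaleR_left blinfun.diff_left inner_axis' algebra_simps
          intro!: integral_cong sum.cong)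
    also have "\<dots> = (\<Sum>j\<in>UNIV. h $ j * integral {0..1} (\<lambda>t. t ^ m * partial_derivative j v (\<Phi> t x))
        - (\<alpha> \<bullet> h) * (\<alpha> $ j * integral {0..1} (\<lambda>t. t ^ Suc m * partial_derivative j v (\<Phi> t x))))"
      by (intro integral_unique has_integral_sum has_integral_diff has_integral_mult_right integrable_integral int) auto
    finally show "blinfun_apply (integral (cbox 0 1) (fx x)) h = (\<Sum>j\<in>UNIV. h $ j * segment_average \<alpha> m (partial_derivative j v) x
         - (\<alpha> \<bullet> h) * (\<alpha> $ j * segment_average \<alpha> (Suc m) (partial_derivative j v) x))"
      by (simp add: segment_average_def \<Phi>_def)
  qed
  moreover have "(\<lambda>x. integral (cbox 0 1) (\<lambda>t. t ^ m * v (\<Phi> t x))) = segment_average \<alpha> m v"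
    by (auto simp: segment_average_def \<Phi>_def)
  ultimately show ?thesis by simp
qed

lemma smooth_segment_average:
  assumes "smooth v"
  shows "smooth (segment_average \<alpha> m v)"
proof -
  have "smooth v \<Longrightarrow> times_differentiable n (segment_average \<alpha> m v)" for n m v
  proof (induction n arbitrary: m v)
    case (Suc n)
    have "partial_derivative i (segment_average \<alpha> m v) = (\<lambda>x. \<Sum>j\<in>UNIV.
         axis i 1 $ j * segment_average \<alpha> m (partial_derivative j v) x
         - (\<alpha> \<bullet> axis i 1) * (\<alpha> $ j * segment_average \<alpha> (Suc m) (partial_derivative j v) x))" for i
      using partial_derivative_eq[OF segment_average_has_derivative[OF Suc.prems]] by auto
    moreover have sum: "times_differentiable n (\<lambda>x. \<Sum>j\<in>S. w j x)"
      if "finite S" "\<And>j. times_differentiable n (w j)" for S :: "'a set" and w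
      using that by induction (auto simp: times_differentiable_const times_differentiable_add)
    moreover have "segment_average \<alpha> m v differentiable (at x)" for x
      using segment_average_has_derivative[OF Suc.prems] unfolding differentiable_def by blast
    ultimately show ?case
      by (auto intro!: sum times_differentiable_diff times_differentiable_mult times_differentiable_const
          Suc.IH smooth_partial_derivative Suc.prems)
  qed simp
  with assms show ?thesis by (simp add: smooth_iff)
qed

lemma reflection_normalized:
  "(norm \<alpha>)\<^sup>2 = 2 \<Longrightarrow> reflection \<alpha> x = x - (\<alpha> \<bullet> x) *\<^sub>R \<alpha>"
  by (simp add: reflection_def dot_square_norm)

text \<open>The fundamental theorem of calculus along the segment from \<open>x\<close> to its
  mirror image gives a factor \<open>\<alpha> \<bullet> x\<close>, which cancels. On the hyperplane
  the segment shrinks to a point and the average becomes the directional derivative prescribed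
  there. Smoothness of the quotient across the hyperplane follows from this representation.\<close>

lemma reflection_quotient_eq_segment_average:
  fixes u :: "real^'n \<Rightarrow> real"
  assumes u: "smooth u" and \<alpha>: "(norm \<alpha>)\<^sup>2 = 2"
  shows "reflection_quotient \<alpha> u x = (\<Sum>j\<in>UNIV. \<alpha> $ j * segment_average \<alpha> 0 (partial_derivative j u) x)"
proof -
  define \<psi> where "\<psi> j t = partial_derivative j u (x - (t * (\<alpha> \<bullet> x)) *\<^sub>R \<alpha>)" for j t
  have cont: "continuous_on {0..1} (\<psi> j)" for j
    unfolding \<psi>_def
    by (intro continuous_intros continuous_on_compose2[OF smooth_continuous_on[OF smooth_partial_derivative[OF u]]]) auto
  have "((\<lambda>t. u (x + t *\<^sub>R (- (\<alpha> \<bullet> x) *\<^sub>R \<alpha>))) has_vector_derivative - (\<alpha> \<bullet> x) * (\<Sum>j\<in>UNIV. \<alpha> $ j * \<psi> j t)) (at t within {0..1})" for t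
    using has_real_derivative_line[OF u, of x "- (\<alpha> \<bullet> x) *\<^sub>R \<alpha>" t "{0..1}"]
    by (simp add: \<psi>_def sum_distrib_left mult_ac has_real_derivative_iff_has_vector_derivative sum_negf)
  from fundamental_theorem_of_calculus[OF _ this]
  have "((\<lambda>t. - (\<alpha> \<bullet> x) * (\<Sum>j\<in>UNIV. \<alpha> $ j * \<psi> j t)) has_integral (u (reflection \<alpha> x) - u x)) {0..1}"
    by (simp add: reflection_normalized[OF \<alpha>])
  moreover have "((\<lambda>t. - (\<alpha> \<bullet> x) * (\<Sum>j\<in>UNIV. \<alpha> $ j * \<psi> j t)) has_integral
      - (\<alpha> \<bullet> x) * (\<Sum>j\<in>UNIV. \<alpha> $ j * integral {0..1} (\<psi> j))) {0..1}"
    by (intro has_integral_mult_right has_integral_sum integrable_integral integrable_continuous_real cont) auto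
  ultimately have "u (reflection \<alpha> x) - u x = - (\<alpha> \<bullet> x) * (\<Sum>j\<in>UNIV. \<alpha> $ j * integral {0..1} (\<psi> j))"
    by (rule has_integral_unique)
  moreover have "integral {0..1} (\<psi> j) = segment_average \<alpha> 0 (partial_derivative j u) x" for j
    by (simp add: segment_average_def \<psi>_def[abs_def])
  moreover have "frechet_derivative u (at x) \<alpha> = (\<Sum>j\<in>UNIV. \<alpha> $ j * partial_derivative j u x)"
    by (rule frechet_derivative_eq_sum[OF smooth_differentiable[OF u]])
  ultimately show ?thesis
    by (auto simp: reflection_quotient_def segment_average_def field_simps)
qed

lemma smooth_reflection_quotient:
  "smooth u \<Longrightarrow> (norm \<alpha>)\<^sup>2 = 2 \<Longrightarrow> smooth (reflection_quotient \<alpha> u)"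
  by (subst reflection_quotient_eq_segment_average[THEN ext])
    (auto intro!: smooth_sum smooth_cmult smooth_segment_average smooth_partial_derivative)

lemma smooth_dunkl_operator:
  assumes "smooth u" "\<And>\<alpha>. \<alpha> \<in> Rp \<Longrightarrow> (norm \<alpha>)\<^sup>2 = 2"
  shows "smooth (dunkl_operator Rp k i u)"
  using assms unfolding dunkl_operator_def[abs_def]
  by (intro smooth_add smooth_sum smooth_cmult smooth_reflection_quotient smooth_partial_derivative) auto

section \<open>The Euler operator\<close>

definition euler :: "(real^'n \<Rightarrow> real) \<Rightarrow> real^'n \<Rightarrow> real" where
  "euler u x = (\<Sum>i\<in>UNIV. x $ i * partial_derivative i u x)"

lemma smooth_euler: "smooth u \<Longrightarrow> smooth (euler u)"
  unfolding euler_def[abs_def] by (intro smooth_sum smooth_mult smooth_partial_derivative) auto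

lemma partial_derivative_euler:
  assumes "smooth u"
  shows "partial_derivative i (euler u) x = partial_derivative i u x + euler (partial_derivative i u) x"
proof -
  have d: "(\<lambda>x. x $ j) differentiable (at x)" "partial_derivative j u differentiable (at x)" for j :: 'a and x
    using assms by (auto intro!: smooth_differentiable smooth_partial_derivative)
  have "partial_derivative i (euler u) x = (\<Sum>j\<in>UNIV. partial_derivative i (\<lambda>x. x $ j * partial_derivative j u x) x)"
    unfolding euler_def[abs_def] by (rule partial_derivative_sum) (auto intro!: differentiable_mult d)
  also have "\<dots> = (\<Sum>j\<in>UNIV. (if i = j then 1 else 0) * partial_derivative j u x
      + x $ j * partial_derivative i (partial_derivative j u) x)"
    by (simp add: partial_derivative_mult d)
  also have "\<dots> = (\<Sum>j\<in>UNIV. if i = j then partial_derivative j u x else 0)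
      + (\<Sum>j\<in>UNIV. x $ j * partial_derivative j (partial_derivative i u) x)"
    by (subst sum.distrib[symmetric], rule sum.cong) (auto simp: partial_derivative_commute[OF assms, of i])
  finally show ?thesis by (simp add: euler_def)
qed

section \<open>Dunkl operators\<close>

lemma euler_add: "smooth u \<Longrightarrow> smooth v \<Longrightarrow> euler (\<lambda>x. u x + v x) x = euler u x + euler v x"
  by (simp add: euler_def partial_derivative_add smooth_differentiable sum.distrib algebra_simps)

lemma euler_diff: "smooth u \<Longrightarrow> smooth v \<Longrightarrow> euler (\<lambda>x. u x - v x) x = euler u x - euler v x"
  by (simp add: euler_def partial_derivative_diff smooth_differentiable sum_subtractf algebra_simps)

lemma euler_mult:
  "smooth u \<Longrightarrow> smooth v \<Longrightarrow> euler (\<lambda>x. u x * v x) x = euler u x * v x + u x * euler v x"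
  by (simp add: euler_def partial_derivative_mult smooth_differentiable sum.distrib sum_distrib_left
      sum_distrib_right algebra_simps)

lemma euler_const [simp]: "euler (\<lambda>x. c) x = 0"
  by (simp add: euler_def)

lemma euler_cmult: "smooth u \<Longrightarrow> euler (\<lambda>x. c * u x) x = c * euler u x"
  by (simp add: euler_mult)

lemma euler_inner [simp]: "euler (\<lambda>x. a \<bullet> x) x = a \<bullet> x"
  by (simp add: euler_def) (simp add: inner_vec_def mult.commute)

lemma euler_inner_self [simp]: "euler (\<lambda>x. x \<bullet> x) x = 2 * (x \<bullet> x)"
  by (simp add: euler_def) (simp add: inner_vec_def sum_distrib_left mult_ac)

lemma linear_reflection: "linear (reflection \<alpha>)"
  unfolding reflection_def linear_iff
  by (simp add: inner_right_distrib algebra_simps add_divide_distrib scaleR_add_left)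

lemma euler_compose_linear:
  fixes u :: "real^'n \<Rightarrow> real" and f :: "real^'n \<Rightarrow> real^'n"
  assumes "linear f" "smooth u"
  shows "euler (\<lambda>x. u (f x)) x = euler u (f x)"
proof -
  have "f x = f (\<Sum>i\<in>UNIV. (x $ i) *\<^sub>R axis i 1)"
    using basis_expansion[of x] by (simp add: scalar_mult_eq_scaleR)
  also have "\<dots> = (\<Sum>i\<in>UNIV. (x $ i) *\<^sub>R f (axis i 1))"
    by (simp add: linear_sum[OF assms(1)] linear_cmul[OF assms(1)])
  finally have "f x = (\<Sum>i\<in>UNIV. (x $ i) *\<^sub>R f (axis i 1))" .
  then have "f x $ j = (\<Sum>i\<in>UNIV. x $ i * f (axis i 1) $ j)" for j
    by simp
  then have "euler u (f x) = (\<Sum>j\<in>UNIV. \<Sum>i\<in>UNIV. x $ i * f (axis i 1) $ j * partial_derivative j u (f x))"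
    by (simp add: euler_def sum_distrib_right)
  also have "\<dots> = euler (\<lambda>x. u (f x)) x"
    by (subst sum.swap) (simp add: euler_def partial_derivative_compose_linear[OF assms(1)]
        smooth_differentiable[OF assms(2)] sum_distrib_left mult_ac)
  finally show ?thesis by simp
qed

text \<open>On the hyperplane the product carries no pointwise information about \<open>f\<close>,
  but its partial derivative in a direction with \<open>\<alpha> $ i\<close> nonzero equals
  \<open>\<alpha> $ i * f x\<close> there.\<close>

lemma smooth_eq_zero_if_inner_mult_eq_zero:
  fixes f :: "real^'n \<Rightarrow> real"
  assumes f: "smooth f" and "\<alpha> \<noteq> 0" and eq: "\<And>x. (\<alpha> \<bullet> x) * f x = 0"
  shows "f x = 0"
proof (rule ccontr)
  assume "f x \<noteq> 0"
  obtain i where i: "\<alpha> $ i \<noteq> 0" using \<open>\<alpha> \<noteq> 0\<close> by (metis vec_eq_iff zero_index)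
  have "partial_derivative i (\<lambda>x. (\<alpha> \<bullet> x) * f x) x = \<alpha> $ i * f x + (\<alpha> \<bullet> x) * partial_derivative i f x"
    by (simp add: partial_derivative_mult smooth_differentiable f)
  moreover have "(\<lambda>x. (\<alpha> \<bullet> x) * f x) = (\<lambda>x. 0)" using eq by blast
  moreover have "\<alpha> \<bullet> x = 0" using eq[of x] \<open>f x \<noteq> 0\<close> by simp
  ultimately show False using i \<open>f x \<noteq> 0\<close> by simp
qed

section \<open>Calculus of the reflection quotient\<close>

context
  fixes \<alpha> :: "real^'n" assumes \<alpha>: "(norm \<alpha>)\<^sup>2 = 2"
begin

lemma reflection_quotient_mult_inner: "(\<alpha> \<bullet> x) * reflection_quotient \<alpha> u x = u x - u (reflection \<alpha> x)"
  by (simp add: reflection_quotient_def reflection_normalized[OF \<alpha>])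

text \<open>Division by \<open>\<alpha> \<bullet> x\<close> has at most one smooth result. The
  product rule and the commutation with the Euler operator below thus reduce to identities checked
  after multiplication by \<open>\<alpha> \<bullet> x\<close>, and they hold on the hyperplane as
  well.\<close>

lemma reflection_quotient_unique:
  assumes "smooth u" "smooth q" "\<And>x. (\<alpha> \<bullet> x) * q x = u x - u (reflection \<alpha> x)"
  shows "reflection_quotient \<alpha> u x = q x"
proof -
  have "reflection_quotient \<alpha> u x - q x = 0"
    by (rule smooth_eq_zero_if_inner_mult_eq_zero[where \<alpha> = \<alpha>])
      (use \<alpha> assms in \<open>auto simp: right_diff_distrib reflection_quotient_mult_inner intro!: smooth_diff smooth_reflection_quotient\<close>)
  then show ?thesis by simp
qed

lemma reflection_reflection [simp]: "reflection \<alpha> (reflection \<alpha> x) = x"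
  using \<alpha> by (simp add: reflection_normalized[OF \<alpha>] inner_diff_right algebra_simps dot_square_norm)

lemma inner_reflection_self [simp]: "\<alpha> \<bullet> reflection \<alpha> x = - (\<alpha> \<bullet> x)"
  using \<alpha> by (simp add: reflection_normalized[OF \<alpha>] inner_diff_right dot_square_norm)

lemma inner_reflection_reflection [simp]: "reflection \<alpha> x \<bullet> reflection \<alpha> y = x \<bullet> y"
  using \<alpha> by (simp add: reflection_normalized[OF \<alpha>] inner_diff_right inner_diff_left dot_square_norm inner_commute)

lemma norm_reflection [simp]: "norm (reflection \<alpha> x) = norm x"
  by (simp add: norm_eq_sqrt_inner)

lemma smooth_compose_reflection: "smooth u \<Longrightarrow> smooth (\<lambda>x. u (reflection \<alpha> x))"
  by (rule smooth_compose_linear[OF linear_reflection])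

lemma reflection_quotient_add:
  assumes "smooth u" "smooth v"
  shows "reflection_quotient \<alpha> (\<lambda>x. u x + v x) x = reflection_quotient \<alpha> u x + reflection_quotient \<alpha> v x"
  by (rule reflection_quotient_unique)
    (auto simp: assms \<alpha> smooth_reflection_quotient reflection_quotient_mult_inner distrib_left
      intro!: smooth_add)

lemma reflection_quotient_mult:
  assumes "smooth u" "smooth v"
  shows "reflection_quotient \<alpha> (\<lambda>x. u x * v x) x
    = u x * reflection_quotient \<alpha> v x + reflection_quotient \<alpha> u x * v (reflection \<alpha> x)"
proof (rule reflection_quotient_unique)
  show "(\<alpha> \<bullet> x) * (u x * reflection_quotient \<alpha> v x + reflection_quotient \<alpha> u x * v (reflection \<alpha> x))
      = u x * v x - u (reflection \<alpha> x) * v (reflection \<alpha> x)" for x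
  proof -
    have "(\<alpha> \<bullet> x) * (u x * reflection_quotient \<alpha> v x + reflection_quotient \<alpha> u x * v (reflection \<alpha> x))
       = u x * ((\<alpha> \<bullet> x) * reflection_quotient \<alpha> v x) + ((\<alpha> \<bullet> x) * reflection_quotient \<alpha> u x) * v (reflection \<alpha> x)"
      by (simp only: distrib_left mult_ac)
    then show ?thesis unfolding reflection_quotient_mult_inner by (simp add: algebra_simps)
  qed
qed (auto intro!: smooth_add smooth_mult smooth_reflection_quotient smooth_compose_reflection assms \<alpha>)

lemma reflection_quotient_invariant:
  assumes "smooth u" "\<And>x. u (reflection \<alpha> x) = u x"
  shows "reflection_quotient \<alpha> u x = 0"
  by (rule reflection_quotient_unique) (use assms in auto)

lemma reflection_quotient_nth: "reflection_quotient \<alpha> (\<lambda>x. x $ i) x = \<alpha> $ i"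
  by (rule reflection_quotient_unique) (auto simp: reflection_normalized[OF \<alpha>])

lemma reflection_quotient_euler:
  assumes "smooth u"
  shows "reflection_quotient \<alpha> (euler u) x = euler (reflection_quotient \<alpha> u) x + reflection_quotient \<alpha> u x"
proof (rule reflection_quotient_unique)
  fix x
  have "euler (\<lambda>x. (\<alpha> \<bullet> x) * reflection_quotient \<alpha> u x) x = (\<alpha> \<bullet> x) * reflection_quotient \<alpha> u x +
      (\<alpha> \<bullet> x) * euler (reflection_quotient \<alpha> u) x"
    using assms \<alpha> by (simp add: euler_mult smooth_reflection_quotient)
  moreover have "(\<lambda>x. (\<alpha> \<bullet> x) * reflection_quotient \<alpha> u x) = (\<lambda>x. u x - u (reflection \<alpha> x))"
    using reflection_quotient_mult_inner by blast
  moreover have "euler (\<lambda>x. u x - u (reflection \<alpha> x)) x = euler u x - euler u (reflection \<alpha> x)"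
    using assms by (simp add: euler_diff smooth_compose_reflection euler_compose_linear[OF linear_reflection])
  ultimately show "(\<alpha> \<bullet> x) * (euler (reflection_quotient \<alpha> u) x + reflection_quotient \<alpha> u x)
      = euler u x - euler u (reflection \<alpha> x)"
    by (simp add: distrib_left)
qed (auto intro!: smooth_add smooth_euler smooth_reflection_quotient assms \<alpha>)

end

text \<open>\<^term>\<open>\<phi>'\<close> is the radial derivative of the radial function \<^term>\<open>\<phi>\<close> divided by the radius.\<close>

definition radial_pair :: "(real^'n \<Rightarrow> real) \<Rightarrow> (real^'n \<Rightarrow> real) \<Rightarrow> bool" where
  "radial_pair \<phi> \<phi>' \<longleftrightarrow> smooth \<phi> \<and> smooth \<phi>' \<and>
     (\<forall>x y. norm x = norm y \<longrightarrow> \<phi> x = \<phi> y \<and> \<phi>' x = \<phi>' y) \<and>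
     (\<forall>i x. partial_derivative i \<phi> x = x $ i * \<phi>' x)"

lemma radial_pairD:
  assumes "radial_pair \<phi> \<phi>'"
  shows "smooth \<phi>" "smooth \<phi>'" "norm x = norm y \<Longrightarrow> \<phi> x = \<phi> y" "norm x = norm y \<Longrightarrow> \<phi>' x = \<phi>' y"
    "partial_derivative i \<phi> x = x $ i * \<phi>' x"
  using assms unfolding radial_pair_def by blast+

lemma euler_radial: "radial_pair \<phi> \<phi>' \<Longrightarrow> euler \<phi> x = (x \<bullet> x) * \<phi>' x"
  unfolding euler_def by (simp add: radial_pairD(5) inner_vec_def sum_distrib_right mult.assoc)

lemma radial_pair_const: "radial_pair (\<lambda>x. c) (\<lambda>x. 0)"
  by (simp add: radial_pair_def)

lemma radial_pair_inner_self: "radial_pair (\<lambda>x. x \<bullet> x) (\<lambda>x. 2)"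
  by (auto simp: radial_pair_def norm_eq_sqrt_inner)

lemma radial_pair_mult:
  "radial_pair \<phi> \<phi>' \<Longrightarrow> radial_pair \<psi> \<psi>' \<Longrightarrow> radial_pair (\<lambda>x. \<phi> x * \<psi> x) (\<lambda>x. \<phi>' x * \<psi> x + \<phi> x * \<psi>' x)"
  unfolding radial_pair_def[of "\<lambda>x. \<phi> x * \<psi> x"]
  by (intro conjI allI impI)
    (auto simp: partial_derivative_mult smooth_differentiable radial_pairD(1,2,5) distrib_left mult_ac
      intro!: smooth_add smooth_mult arg_cong2[where f = "(*)"] arg_cong2[where f = "(+)"] dest: radial_pairD(3,4))

locale dunkl =
  fixes R Rp :: "(real^'n) set" and k :: "real^'n \<Rightarrow> real"
  assumes root_system: "normalized_root_system R"
    and positive: "positive_subsystem Rp R"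
    and multiplicity: "multiplicity_function R k"
begin

definition total_multiplicity :: real ("\<gamma>") where "\<gamma> = (\<Sum>\<alpha>\<in>Rp. k \<alpha>)"

text \<open>The weight is homogeneous of degree \<open>2 * \<gamma>\<close>, so this is the exponent
  with which the weighted measure scales under dilations.\<close>

definition hom_dim :: real ("\<N>") where "\<N> = real CARD('n) + 2 * \<gamma>"

abbreviation T where "T \<equiv> dunkl_operator Rp k"

abbreviation Lap ("\<Delta>") where "\<Delta> \<equiv> dunkl_laplacian Rp k"

definition reflection_defect :: "(real^'n \<Rightarrow> real) \<Rightarrow> real^'n \<Rightarrow> real" ("\<A>") where
  "\<A> u x = (\<Sum>\<alpha>\<in>Rp. k \<alpha> * (u x - u (reflection \<alpha> x)))"

text \<open>\<open>- (x \<bullet> x)\<close> times the angular part of \<^term>\<open>\<Delta>\<close>.\<close>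

definition angular :: "(real^'n \<Rightarrow> real) \<Rightarrow> real^'n \<Rightarrow> real" ("\<L>") where
  "\<L> u x = euler (euler u) x + (\<N> - 2) * euler u x - (x \<bullet> x) * \<Delta> u x"

lemma finite_Rp [simp, intro]: "finite Rp"
  using root_system positive unfolding normalized_root_system_def positive_subsystem_def
  by (metis finite_Un)

lemma Rp_subset: "\<alpha> \<in> Rp \<Longrightarrow> \<alpha> \<in> R"
  using positive unfolding positive_subsystem_def by blast

lemma norm_root [simp]: "\<alpha> \<in> Rp \<Longrightarrow> (norm \<alpha>)\<^sup>2 = 2"
  using root_system Rp_subset unfolding normalized_root_system_def by blast

lemma k_nonneg [simp]: "\<alpha> \<in> Rp \<Longrightarrow> 0 \<le> k \<alpha>"
  using multiplicity Rp_subset unfolding multiplicity_function_def by blast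

lemma total_multiplicity_nonneg: "0 \<le> \<gamma>"
  unfolding total_multiplicity_def by (intro sum_nonneg) auto

lemma smooth_T [intro]: "smooth u \<Longrightarrow> smooth (T i u)"
  by (rule smooth_dunkl_operator) auto

lemma smooth_reflected: "smooth u \<Longrightarrow> \<alpha> \<in> Rp \<Longrightarrow> smooth (\<lambda>x. u (reflection \<alpha> x))"
  by (rule smooth_compose_linear[OF linear_reflection])

lemma smooth_defect [intro]: "smooth u \<Longrightarrow> smooth (\<A> u)"
  unfolding reflection_defect_def[abs_def]
  by (intro smooth_sum smooth_cmult smooth_diff smooth_reflected) auto

lemma smooth_Lap [intro]: "smooth u \<Longrightarrow> smooth (\<Delta> u)"
  unfolding dunkl_laplacian_def[abs_def] by (intro smooth_sum smooth_T) auto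

lemma smooth_angular [intro]: "smooth u \<Longrightarrow> smooth (\<L> u)"
  unfolding angular_def[abs_def]
  by (intro smooth_add smooth_diff smooth_mult smooth_euler smooth_Lap) auto

lemma T_add:
  assumes "smooth u" "smooth v" shows "T i (\<lambda>x. u x + v x) x = T i u x + T i v x"
  using assms unfolding dunkl_operator_def
  by (simp add: partial_derivative_add smooth_differentiable reflection_quotient_add distrib_left sum.distrib
      cong: sum.cong)

lemma T_const [simp]: "T i (\<lambda>x. c) x = 0"
  unfolding dunkl_operator_def by (simp add: reflection_quotient_invariant cong: sum.cong)

text \<open>A radial function is invariant under every reflection, so its reflection quotients
  vanish and the ordinary Leibniz rule survives.\<close>

lemma T_radial_mult:
  assumes \<phi>: "radial_pair \<phi> \<phi>'" and u: "smooth u"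
  shows "T i (\<lambda>x. \<phi> x * u x) x = \<phi> x * T i u x + x $ i * (\<phi>' x * u x)"
proof -
  have "reflection_quotient \<alpha> (\<lambda>x. \<phi> x * u x) x = \<phi> x * reflection_quotient \<alpha> u x" if "\<alpha> \<in> Rp" for \<alpha>
  proof -
    have "reflection_quotient \<alpha> \<phi> x = 0"
      using \<phi> that by (intro reflection_quotient_invariant) (auto intro: radial_pairD)
    then show ?thesis
      using u \<phi> that by (simp add: reflection_quotient_mult radial_pairD(1))
  qed
  then show ?thesis
    using u \<phi> unfolding dunkl_operator_def
    by (simp add: partial_derivative_mult smooth_differentiable radial_pairD(1,5) distrib_left sum_distrib_left
        mult_ac cong: sum.cong)
qed

lemma T_cmult: "smooth u \<Longrightarrow> T i (\<lambda>x. c * u x) x = c * T i u x"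
  using T_radial_mult[OF radial_pair_const] by simp

lemma T_nth_mult:
  assumes u: "smooth u"
  shows "T i (\<lambda>x. x $ j * u x) x = x $ j * T i u x + (if i = j then u x else 0)
    + (\<Sum>\<alpha>\<in>Rp. k \<alpha> * \<alpha> $ i * \<alpha> $ j * u (reflection \<alpha> x))"
proof -
  have "reflection_quotient \<alpha> (\<lambda>x. x $ j * u x) x = x $ j * reflection_quotient \<alpha> u x + \<alpha> $ j * u (reflection \<alpha> x)"
    if "\<alpha> \<in> Rp" for \<alpha>
    using u that by (simp add: reflection_quotient_mult reflection_quotient_nth)
  then show ?thesis
    using u unfolding dunkl_operator_def
    by (simp add: partial_derivative_mult smooth_differentiable distrib_left sum_distrib_left sum.distrib mult_ac
        cong: sum.cong)
qed

text \<open>The failure of the Leibniz rule is isolated in the last sum. Each of its terms changes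
  sign under its own reflection, so it disappears under the invariant integral in
  \<open>integral_T_mult\<close>.\<close>

lemma T_mult:
  assumes u: "smooth u" and v: "smooth v"
  shows "T i (\<lambda>x. u x * v x) x = u x * T i v x + T i u x * v x
    - (\<Sum>\<alpha>\<in>Rp. k \<alpha> * \<alpha> $ i * (reflection_quotient \<alpha> u x * (v x - v (reflection \<alpha> x))))"
proof -
  have "(\<Sum>\<alpha>\<in>Rp. k \<alpha> * \<alpha> $ i * reflection_quotient \<alpha> (\<lambda>x. u x * v x) x) =
    (\<Sum>\<alpha>\<in>Rp. u x * (k \<alpha> * \<alpha> $ i * reflection_quotient \<alpha> v x) + (k \<alpha> * \<alpha> $ i * reflection_quotient \<alpha> u x) * v x
      - k \<alpha> * \<alpha> $ i * (reflection_quotient \<alpha> u x * (v x - v (reflection \<alpha> x))))"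
    using assms by (intro sum.cong) (auto simp: reflection_quotient_mult algebra_simps)
  then show ?thesis
    using assms unfolding dunkl_operator_def
    by (simp add: partial_derivative_mult smooth_differentiable sum.distrib sum_subtractf distrib_left distrib_right
        sum_distrib_left[symmetric] sum_distrib_right[symmetric])
qed

lemma sum_nth_mult_T: "(\<Sum>i\<in>UNIV. x $ i * T i u x) = euler u x + \<A> u x"
proof -
  have "(\<Sum>i\<in>UNIV. x $ i * (\<Sum>\<alpha>\<in>Rp. k \<alpha> * \<alpha> $ i * reflection_quotient \<alpha> u x))
      = (\<Sum>\<alpha>\<in>Rp. \<Sum>i\<in>UNIV. x $ i * (k \<alpha> * \<alpha> $ i * reflection_quotient \<alpha> u x))"
    by (subst sum.swap) (simp add: sum_distrib_left)
  also have "\<dots> = (\<Sum>\<alpha>\<in>Rp. k \<alpha> * ((\<alpha> \<bullet> x) * reflection_quotient \<alpha> u x))"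
    by (simp add: inner_vec_def sum_distrib_left sum_distrib_right mult_ac)
  also have "\<dots> = \<A> u x"
    by (simp add: reflection_defect_def reflection_quotient_mult_inner cong: sum.cong)
  finally show ?thesis
    unfolding dunkl_operator_def euler_def by (simp add: distrib_left sum.distrib)
qed

text \<open>The squared lengths \<open>\<alpha> \<bullet> \<alpha> = 2\<close> shift the dimension
  by \<open>2 * \<gamma>\<close> to \<open>\<N>\<close>. Compared with
  \<open>sum_nth_mult_T\<close>, the operator \<open>\<A>\<close> has the opposite sign, and this
  makes it drop out of \<open>Lap_radial_mult\<close>.\<close>

lemma sum_T_nth_mult:
  assumes "smooth u"
  shows "(\<Sum>i\<in>UNIV. T i (\<lambda>x. x $ i * u x) x) = euler u x - \<A> u x + \<N> * u x"
proof -
  have "(\<Sum>i\<in>UNIV. \<alpha> $ i * \<alpha> $ i) = 2" if "\<alpha> \<in> Rp" for \<alpha>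
    using norm_root[OF that] by (simp add: inner_vec_def power2_norm_eq_inner)
  then have "(\<Sum>\<alpha>\<in>Rp. k \<alpha> * u (reflection \<alpha> x) * (\<Sum>i\<in>UNIV. \<alpha> $ i * \<alpha> $ i)) = (\<Sum>\<alpha>\<in>Rp. k \<alpha> * u (reflection \<alpha> x) * 2)"
    by (intro sum.cong) auto
  then have "(\<Sum>i\<in>UNIV. \<Sum>\<alpha>\<in>Rp. k \<alpha> * \<alpha> $ i * \<alpha> $ i * u (reflection \<alpha> x)) = (\<Sum>\<alpha>\<in>Rp. k \<alpha> * u (reflection \<alpha> x) * 2)"
    by (subst sum.swap) (simp add: sum_distrib_left mult_ac)
  also have "\<dots> = 2 * \<gamma> * u x - 2 * \<A> u x"
    by (simp add: reflection_defect_def total_multiplicity_def sum_distrib_left sum_distrib_right sum_subtractf[symmetric] algebra_simps)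
  finally have "(\<Sum>i\<in>UNIV. T i (\<lambda>x. x $ i * u x) x) = (\<Sum>i\<in>UNIV. x $ i * T i u x) + real CARD('n) * u x
      + (2 * \<gamma> * u x - 2 * \<A> u x)"
    by (simp add: T_nth_mult[OF assms] sum.distrib)
  then show ?thesis
    unfolding sum_nth_mult_T by (simp add: hom_dim_def algebra_simps)
qed

lemma defect_radial_mult:
  "radial_pair \<phi> \<phi>' \<Longrightarrow> \<A> (\<lambda>x. \<phi> x * u x) x = \<phi> x * \<A> u x"
  unfolding reflection_defect_def sum_distrib_left
  by (intro sum.cong) (auto simp: algebra_simps radial_pairD(3)[of \<phi> \<phi>' "reflection _ x" x])

lemma defect_radial: "radial_pair \<phi> \<phi>' \<Longrightarrow> \<A> \<phi> x = 0"
  using defect_radial_mult[of \<phi> \<phi>' "\<lambda>x. 1" x] by (simp add: reflection_defect_def)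

text \<open>The two contributions of \<open>\<A>\<close> cancel, because it commutes with radial
  factors. So for radial factors \<open>\<Delta>\<close> obeys the product rule of the Euclidean
  Laplacian in dimension \<open>\<N>\<close>.\<close>

lemma Lap_radial_mult:
  assumes \<phi>: "radial_pair \<phi> \<phi>'" "radial_pair \<phi>' \<phi>''" and u: "smooth u"
  shows "\<Delta> (\<lambda>x. \<phi> x * u x) x = \<phi> x * \<Delta> u x + 2 * \<phi>' x * euler u x + (euler \<phi>' x + \<N> * \<phi>' x) * u x"
proof -
  note [simp] = radial_pairD(1)[OF \<phi>(1)] radial_pairD(1)[OF \<phi>(2)] u
  have sm: "smooth (\<lambda>x. \<phi> x * T i u x)" "smooth (\<lambda>x. \<phi>' x * u x)" "smooth (\<lambda>x. x $ i * (\<phi>' x * u x))" for i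
    by (intro smooth_mult smooth_T smooth_nth; simp)+
  have "T i (\<lambda>x. \<phi> x * u x) = (\<lambda>x. \<phi> x * T i u x + x $ i * (\<phi>' x * u x))" for i
    using T_radial_mult[OF \<phi>(1) u] by blast
  then have "\<Delta> (\<lambda>x. \<phi> x * u x) x = (\<Sum>i\<in>UNIV. T i (\<lambda>x. \<phi> x * T i u x) x + T i (\<lambda>x. x $ i * (\<phi>' x * u x)) x)"
    unfolding dunkl_laplacian_def by (simp add: T_add sm)
  also have "\<dots> = (\<Sum>i\<in>UNIV. \<phi> x * T i (T i u) x + \<phi>' x * (x $ i * T i u x)) + (\<Sum>i\<in>UNIV. T i (\<lambda>x. x $ i * (\<phi>' x * u x)) x)"
    by (simp add: T_radial_mult[OF \<phi>(1)] smooth_T sum.distrib mult_ac)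
  also have "\<dots> = \<phi> x * \<Delta> u x + \<phi>' x * (euler u x + \<A> u x)
      + (euler (\<lambda>x. \<phi>' x * u x) x - \<A> (\<lambda>x. \<phi>' x * u x) x + \<N> * (\<phi>' x * u x))"
    by (simp add: sum_T_nth_mult sm sum.distrib sum_distrib_left[symmetric] sum_nth_mult_T dunkl_laplacian_def)
  finally show ?thesis
    by (simp add: euler_mult defect_radial_mult[OF \<phi>(2)] algebra_simps)
qed

lemma Lap_const [simp]: "\<Delta> (\<lambda>x. c) x = 0"
proof -
  have "T i (\<lambda>x. c) = (\<lambda>x. 0)" for i by (rule ext) simp
  then show ?thesis unfolding dunkl_laplacian_def by simp
qed

lemma Lap_add: "smooth u \<Longrightarrow> smooth v \<Longrightarrow> \<Delta> (\<lambda>x. u x + v x) x = \<Delta> u x + \<Delta> v x"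
  unfolding dunkl_laplacian_def by (simp add: T_add[THEN ext] T_add smooth_T sum.distrib)

lemma Lap_cmult: "smooth u \<Longrightarrow> \<Delta> (\<lambda>x. c * u x) x = c * \<Delta> u x"
  unfolding dunkl_laplacian_def by (simp add: T_cmult[THEN ext] T_cmult smooth_T sum_distrib_left)

text \<open>The infinitesimal form of the fact that Dunkl operators lower the degree of homogeneity
  by one.\<close>

lemma T_euler:
  assumes u: "smooth u"
  shows "T i (euler u) x = euler (T i u) x + T i u x"
proof -
  have "T i u = (\<lambda>x. partial_derivative i u x + (\<Sum>\<alpha>\<in>Rp. (k \<alpha> * \<alpha> $ i) * reflection_quotient \<alpha> u x))"
    unfolding dunkl_operator_def[abs_def] by simp
  moreover have "euler (\<lambda>x. \<Sum>\<alpha>\<in>S. (k \<alpha> * \<alpha> $ i) * reflection_quotient \<alpha> u x) x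
      = (\<Sum>\<alpha>\<in>S. (k \<alpha> * \<alpha> $ i) * euler (reflection_quotient \<alpha> u) x)" if "finite S" "S \<subseteq> Rp" for S
    using that
  proof (induction S)
    case (insert a S)
    then have "smooth (reflection_quotient a u)" "smooth (\<lambda>x. \<Sum>\<alpha>\<in>S. (k \<alpha> * \<alpha> $ i) * reflection_quotient \<alpha> u x)"
      by (auto intro!: smooth_reflection_quotient smooth_sum smooth_cmult u simp: subset_iff)
    with insert show ?case by (simp add: euler_add smooth_cmult euler_cmult)
  qed simp
  moreover have "smooth (\<lambda>x. \<Sum>\<alpha>\<in>Rp. (k \<alpha> * \<alpha> $ i) * reflection_quotient \<alpha> u x)"
    by (intro smooth_sum smooth_cmult smooth_reflection_quotient u) auto
  ultimately have "euler (T i u) x = euler (partial_derivative i u) x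
      + (\<Sum>\<alpha>\<in>Rp. (k \<alpha> * \<alpha> $ i) * euler (reflection_quotient \<alpha> u) x)"
    by (simp add: euler_add smooth_partial_derivative u)
  then show ?thesis
    unfolding dunkl_operator_def
    by (simp add: partial_derivative_euler u reflection_quotient_euler distrib_left sum.distrib cong: sum.cong)
qed

lemma Lap_euler:
  assumes u: "smooth u"
  shows "\<Delta> (euler u) x = euler (\<Delta> u) x + 2 * \<Delta> u x"
proof -
  have "T i (euler u) = (\<lambda>x. euler (T i u) x + T i u x)" for i
    using T_euler[OF u] by blast
  then have "\<Delta> (euler u) x = (\<Sum>i\<in>UNIV. T i (euler (T i u)) x + T i (T i u) x)"
    unfolding dunkl_laplacian_def by (simp add: T_add smooth_T smooth_euler u)
  also have "\<dots> = (\<Sum>i\<in>UNIV. euler (T i (T i u)) x) + 2 * \<Delta> u x"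
    unfolding dunkl_laplacian_def by (simp add: T_euler smooth_T u sum.distrib sum_distrib_left)
  also have "(\<Sum>i\<in>UNIV. euler (T i (T i u)) x) = euler (\<Delta> u) x"
  proof -
    have "(\<Sum>i\<in>S. euler (T i (T i u)) x) = euler (\<lambda>x. \<Sum>i\<in>S. T i (T i u) x) x" if "finite S" for S :: "'n set"
      using that by induction (auto simp: euler_add smooth_T smooth_sum u)
    then show ?thesis unfolding dunkl_laplacian_def[abs_def] by simp
  qed
  finally show ?thesis .
qed

lemma angular_add:
  assumes "smooth u" "smooth v" shows "\<L> (\<lambda>x. u x + v x) x = \<L> u x + \<L> v x"
  using assms unfolding angular_def
  by (simp add: euler_add[THEN ext] euler_add smooth_euler Lap_add algebra_simps)

lemma angular_cmult:
  assumes "smooth u" shows "\<L> (\<lambda>x. c * u x) x = c * \<L> u x"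
  using assms unfolding angular_def
  by (simp add: euler_cmult[THEN ext] euler_cmult smooth_euler Lap_cmult algebra_simps)

lemma angular_diff:
  assumes "smooth u" "smooth v" shows "\<L> (\<lambda>x. u x - v x) x = \<L> u x - \<L> v x"
  using angular_add[OF assms(1) smooth_cmult[OF assms(2), of "-1"]] angular_cmult[OF assms(2), of "-1"] by simp

text \<open>\<open>\<Delta>\<close> lowers the degree of homogeneity by two and multiplication by
  \<open>x \<bullet> x\<close> restores it, so the angular operator has degree 0.\<close>

lemma angular_euler:
  assumes u: "smooth u"
  shows "\<L> (euler u) x = euler (\<L> u) x"
proof -
  have "euler (\<L> u) x = euler (euler (euler u)) x + (\<N> - 2) * euler (euler u) x
      - (2 * (x \<bullet> x) * \<Delta> u x + (x \<bullet> x) * euler (\<Delta> u) x)"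
    unfolding angular_def[abs_def]
    by (simp add: euler_diff euler_add euler_cmult euler_mult smooth_euler smooth_Lap smooth_add smooth_cmult smooth_mult u)
  then show ?thesis
    unfolding angular_def by (simp add: Lap_euler u algebra_simps)
qed

text \<open>The radial derivatives produced by the Euler part and by
  \<open>(x \<bullet> x) * \<Delta>\<close> agree in dimension \<open>\<N>\<close> and cancel: the
  operator sees only the angular variable.\<close>

lemma angular_radial_mult:
  assumes \<phi>: "radial_pair \<phi> \<phi>'" "radial_pair \<phi>' \<phi>''" and u: "smooth u"
  shows "\<L> (\<lambda>x. \<phi> x * u x) x = \<phi> x * \<L> u x"
proof -
  note [simp] = radial_pairD(1)[OF \<phi>(1)] radial_pairD(1)[OF \<phi>(2)] u
  have "euler (\<lambda>x. \<phi> x * u x) = (\<lambda>x. (x \<bullet> x) * (\<phi>' x * u x) + \<phi> x * euler u x)"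
    by (auto simp: euler_mult euler_radial[OF \<phi>(1)] mult.assoc)
  then have "euler (euler (\<lambda>x. \<phi> x * u x)) x = 2 * (x \<bullet> x) * (\<phi>' x * u x) + (x \<bullet> x) * (euler \<phi>' x * u x + \<phi>' x * euler u x)
     + (x \<bullet> x) * \<phi>' x * euler u x + \<phi> x * euler (euler u) x"
    by (simp add: euler_add euler_mult smooth_mult smooth_euler euler_radial[OF \<phi>(1)])
  then show ?thesis
    unfolding angular_def Lap_radial_mult[OF \<phi> u]
    by (simp add: euler_mult euler_radial[OF \<phi>(1)] algebra_simps)
qed

lemma angular_radial:
  assumes \<phi>: "radial_pair \<phi> \<phi>'" "radial_pair \<phi>' \<phi>''"
  shows "\<L> \<phi> x = 0"
proof -
  have "\<L> (\<lambda>x. 1) x = 0" by (simp add: angular_def euler_const[abs_def])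
  then show ?thesis
    using angular_radial_mult[OF \<phi> smooth_const, of 1 x] by simp
qed

end

section \<open>Lebesgue measure and the regularized weight\<close>

definition bounded_support :: "(real^'n \<Rightarrow> real) \<Rightarrow> bool" where
  "bounded_support u \<longleftrightarrow> (\<exists>K. \<forall>x. K < norm x \<longrightarrow> u x = 0)"

lemma bounded_supportI: "(\<And>x. K < norm x \<Longrightarrow> u x = 0) \<Longrightarrow> bounded_support u"
  unfolding bounded_support_def by blast

lemma bounded_supportE:
  assumes "bounded_support u"
  obtains K where "0 < K" "\<And>x. K < norm x \<Longrightarrow> u x = 0"
proof -
  obtain K where "\<forall>x. K < norm x \<longrightarrow> u x = 0" using assms unfolding bounded_support_def by blast
  then show ?thesis by (intro that[of "max K 1"]) auto
qed

lemma bounded_support_mult1: "bounded_support u \<Longrightarrow> bounded_support (\<lambda>x. u x * v x)"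
  unfolding bounded_support_def by (metis mult_zero_left)

lemma bounded_support_mult2: "bounded_support v \<Longrightarrow> bounded_support (\<lambda>x. u x * v x)"
  unfolding bounded_support_def by (metis mult_zero_right)

lemma bounded_support_zero [simp]: "bounded_support (\<lambda>x. 0)"
  unfolding bounded_support_def by simp

lemma bounded_support_add:
  assumes "bounded_support u" "bounded_support v" shows "bounded_support (\<lambda>x. u x + v x)"
proof -
  obtain K L where "\<And>x. K < norm x \<Longrightarrow> u x = 0" "\<And>x. L < norm x \<Longrightarrow> v x = 0"
    using assms unfolding bounded_support_def by blast
  then show ?thesis by (intro bounded_supportI[of "max K L"]) auto
qed

lemma bounded_support_minus: "bounded_support u \<Longrightarrow> bounded_support (\<lambda>x. - u x)"
  unfolding bounded_support_def by simp

lemma bounded_support_diff: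
  "bounded_support u \<Longrightarrow> bounded_support v \<Longrightarrow> bounded_support (\<lambda>x. u x - v x)"
  using bounded_support_add[OF _ bounded_support_minus, of u v] by simp

lemma bounded_support_sum:
  "(\<And>a. a \<in> S \<Longrightarrow> bounded_support (f a)) \<Longrightarrow> bounded_support (\<lambda>x. \<Sum>a\<in>S. f a x)"
  by (induction S rule: infinite_finite_induct) (auto intro: bounded_support_add)

lemma bounded_support_partial_derivative:
  fixes u :: "real^'n \<Rightarrow> real"
  assumes "bounded_support u" shows "bounded_support (partial_derivative i u)"
proof -
  obtain K where K: "\<And>x. K < norm x \<Longrightarrow> u x = 0"
    using assms unfolding bounded_support_def by blast
  show ?thesis
  proof (rule bounded_supportI)
    fix x :: "real^'n" assume x: "K < norm x"
    have "open {x::real^'n. K < norm x}" by (intro open_Collect_less continuous_intros)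
    then have "(u has_derivative (\<lambda>h. 0)) (at x)"
      by (rule has_derivative_transform_within_open[OF has_derivative_const[of 0]]) (use x K in auto)
    then show "partial_derivative i u x = 0" by (simp add: partial_derivative_eq)
  qed
qed

lemma bounded_support_euler: "bounded_support u \<Longrightarrow> bounded_support (euler u)"
  unfolding euler_def[abs_def]
  by (intro bounded_support_sum bounded_support_mult2 bounded_support_partial_derivative)

lemma bounded_support_reflected:
  "bounded_support u \<Longrightarrow> (norm \<alpha>)\<^sup>2 = 2 \<Longrightarrow> bounded_support (\<lambda>x. u (reflection \<alpha> x))"
  unfolding bounded_support_def by (metis norm_reflection)

lemma bounded_support_reflection_quotient:
  assumes "bounded_support u" "smooth u" "(norm \<alpha>)\<^sup>2 = 2"
  shows "bounded_support (reflection_quotient \<alpha> u)"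
proof -
  have "bounded_support (\<lambda>x. \<Sum>j\<in>UNIV. \<alpha> $ j * partial_derivative j u x)"
    by (intro bounded_support_sum bounded_support_mult2 bounded_support_partial_derivative assms)
  moreover have "frechet_derivative u (at x) \<alpha> = (\<Sum>j\<in>UNIV. \<alpha> $ j * partial_derivative j u x)" for x
    by (rule frechet_derivative_eq_sum[OF smooth_differentiable[OF assms(2)]])
  ultimately obtain K where "\<And>x. K < norm x \<Longrightarrow> frechet_derivative u (at x) \<alpha> = 0"
    unfolding bounded_support_def by auto
  moreover obtain L where "\<And>x. L < norm x \<Longrightarrow> u x = 0" "\<And>x. L < norm x \<Longrightarrow> u (reflection \<alpha> x) = 0"
    using assms unfolding bounded_support_def by (metis norm_reflection)
  ultimately show ?thesis
    by (intro bounded_supportI[of "max K L"]) (auto simp: reflection_quotient_def)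
qed

lemma test_functions_iff: "u \<in> test_functions \<longleftrightarrow> smooth u \<and> bounded_support u"
proof -
  have "compact (closure {x. u x \<noteq> 0}) \<longleftrightarrow> bounded {x. u x \<noteq> 0}" by simp
  also have "\<dots> \<longleftrightarrow> bounded_support u"
    unfolding bounded_iff bounded_support_def by (auto simp: not_less[symmetric])
  finally show ?thesis by (simp add: test_functions_def)
qed

lemma bounded_support_bound:
  assumes "continuous_on UNIV u" "bounded_support u"
  obtains B where "\<And>x. \<bar>u x\<bar> \<le> B"
proof -
  obtain K where K: "0 < K" "\<And>x. K < norm x \<Longrightarrow> u x = 0" using assms(2) by (rule bounded_supportE) blast
  have "compact (u ` cball 0 K)"
    by (intro compact_continuous_image continuous_on_subset[OF assms(1)]) auto
  then obtain B where B: "\<And>x. x \<in> cball 0 K \<Longrightarrow> \<bar>u x\<bar> \<le> B"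
    using compact_imp_bounded bounded_iff by (metis imageI real_norm_def)
  show ?thesis
  proof (rule that)
    fix x show "\<bar>u x\<bar> \<le> B"
      using B[of x] B[of 0] K by (cases "norm x \<le> K") auto
  qed
qed

lemma integrable_lborel_bounded_support:
  fixes u :: "real^'n \<Rightarrow> real"
  assumes "continuous_on UNIV u" "bounded_support u"
  shows "integrable lborel u"
proof -
  obtain K where K: "\<And>x. K < norm x \<Longrightarrow> u x = 0" using assms(2) by (rule bounded_supportE) blast
  have "integrable lborel (\<lambda>x. indicator (cball 0 K) x *\<^sub>R u x)"
    by (intro borel_integrable_compact continuous_on_subset[OF assms(1)]) auto
  moreover have "(\<lambda>x. indicator (cball 0 K) x *\<^sub>R u x) = u"
    using K by (fastforce simp: indicator_def not_le)
  ultimately show ?thesis by simp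
qed

section \<open>Translation and reflection invariance of Lebesgue measure\<close>

lemma integral_lborel_translate:
  fixes f :: "real^'n \<Rightarrow> real"
  assumes "f \<in> borel_measurable borel"
  shows "(LINT x|lborel. f (x + c)) = (LINT x|lborel. f x)"
proof -
  have "lborel = distr lborel borel (\<lambda>x::real^'n. c + 1 *\<^sub>R x)"
    using lborel_affine[of 1 c] by (simp add: density_1)
  then have "(LINT x|lborel. f x) = (LINT x|distr lborel borel (\<lambda>x::real^'n. c + 1 *\<^sub>R x). f x)"
    by simp
  also have "\<dots> = (LINT x|lborel. f (x + c))"
    using assms by (subst integral_distr) (auto simp: add.commute)
  finally show ?thesis by simp
qed

text \<open>Translation invariance makes every difference quotient integrate to zero. The steps are
  at most 1, so the quotients live in one ball of radius \<open>K + 1\<close>, and by the mean value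
  theorem they share one bound; dominated convergence yields the derivative.\<close>

lemma integral_lborel_partial_derivative:
  fixes u :: "real^'n \<Rightarrow> real"
  assumes u: "smooth u" "bounded_support u"
  shows "(LINT x|lborel. partial_derivative i u x) = 0"
proof -
  define D where "D n x = (u (x + (1 / real (Suc n)) *\<^sub>R axis i 1) - u x) * real (Suc n)" for n x
  obtain B where B: "\<And>x. \<bar>partial_derivative i u x\<bar> \<le> B"
    using bounded_support_bound[OF smooth_continuous_on[OF smooth_partial_derivative[OF u(1)]]
        bounded_support_partial_derivative[OF u(2)]] by blast
  obtain K where K: "\<And>x. K < norm x \<Longrightarrow> u x = 0" using u(2) by (rule bounded_supportE) blast
  have deriv: "((\<lambda>s. u (x + s *\<^sub>R axis i 1)) has_real_derivative partial_derivative i u (x + s *\<^sub>R axis i 1)) (at s)" for x s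
    using has_real_derivative_line[OF u(1), of x "axis i 1" s UNIV]
    by (simp add: axis_def if_distrib if_distribR cong: if_cong)
  have meas: "u \<in> borel_measurable borel" using u by blast
  have step: "norm ((1 / real (Suc n)) *\<^sub>R axis i (1::real)) \<le> 1" for n :: nat
    by simp
  have bound: "\<bar>D n x\<bar> \<le> B" for n x
  proof -
    obtain z where "u (x + (1 / real (Suc n)) *\<^sub>R axis i 1) - u (x + 0 *\<^sub>R axis i 1)
        = (1 / real (Suc n) - 0) * partial_derivative i u (x + z *\<^sub>R axis i 1)"
      using MVT2[of 0 "1 / real (Suc n)", OF _ deriv] by auto
    then have "D n x = partial_derivative i u (x + z *\<^sub>R axis i 1)" by (simp add: D_def)
    then show ?thesis using B by simp
  qed
  have supp: "D n x = 0" if "K + 1 < norm x" for n x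
  proof -
    have "norm x - norm ((1 / real (Suc n)) *\<^sub>R axis i (1::real)) \<le> norm (x + (1 / real (Suc n)) *\<^sub>R axis i 1)"
      by (rule norm_diff_ineq)
    then have "norm x - 1 \<le> norm (x + (1 / real (Suc n)) *\<^sub>R axis i 1)"
      using step[of n] by linarith
    then show ?thesis using that K by (simp add: D_def)
  qed
  have "(\<lambda>n. LINT x|lborel. D n x) \<longlonglongrightarrow> (LINT x|lborel. partial_derivative i u x)"
  proof (rule integral_dominated_convergence)
    show "integrable lborel (\<lambda>x. indicator (cball 0 (K + 1)) x *\<^sub>R B)"
      by (intro borel_integrable_compact) auto
    show "partial_derivative i u \<in> borel_measurable lborel"
      using u by (auto intro: smooth_borel_measurable smooth_partial_derivative)
    show "D n \<in> borel_measurable lborel" for n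
      unfolding D_def using meas by measurable
    show "AE x in lborel. (\<lambda>n. D n x) \<longlonglongrightarrow> partial_derivative i u x"
    proof (rule AE_I2)
      fix x
      have "((\<lambda>h. (u (x + h *\<^sub>R axis i 1) - u x) / h) \<longlongrightarrow> partial_derivative i u x) (at 0)"
        using deriv[of x 0] unfolding DERIV_def by simp
      moreover have "filterlim (\<lambda>n. 1 / real (Suc n)) (at 0) sequentially"
        unfolding filterlim_at using LIMSEQ_inverse_real_of_nat by (auto simp: inverse_eq_divide)
      ultimately have "(\<lambda>n. (u (x + (1 / real (Suc n)) *\<^sub>R axis i 1) - u x) / (1 / real (Suc n))) \<longlonglongrightarrow> partial_derivative i u x"
        by (rule filterlim_compose)
      then show "(\<lambda>n. D n x) \<longlonglongrightarrow> partial_derivative i u x" by (simp add: D_def)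
    qed
    show "AE x in lborel. norm (D n x) \<le> indicator (cball 0 (K + 1)) x *\<^sub>R B" for n
      using bound supp by (auto simp: indicator_def not_le)
  qed
  moreover have "(LINT x|lborel. D n x) = 0" for n
  proof -
    have "integrable lborel u" by (intro integrable_lborel_bounded_support u smooth_continuous_on)
    moreover have "integrable lborel (\<lambda>x. u (x + (1 / real (Suc n)) *\<^sub>R axis i 1))"
    proof (rule integrable_lborel_bounded_support)
      show "continuous_on UNIV (\<lambda>x. u (x + (1 / real (Suc n)) *\<^sub>R axis i 1))"
        by (intro continuous_on_compose2[OF smooth_continuous_on[OF u(1)]] continuous_intros) auto
      show "bounded_support (\<lambda>x. u (x + (1 / real (Suc n)) *\<^sub>R axis i 1))"
      proof (rule bounded_supportI)
        fix x :: "real^'n" assume x: "K + 1 < norm x"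
        then have "norm x > K + norm ((1 / real (Suc n)) *\<^sub>R axis i (1::real))"
          using step[of n] by linarith
        then have "K < norm (x + (1 / real (Suc n)) *\<^sub>R axis i 1)"
          using norm_diff_ineq[of x "(1 / real (Suc n)) *\<^sub>R axis i 1"] by linarith
        then show "u (x + (1 / real (Suc n)) *\<^sub>R axis i 1) = 0" by (rule K)
      qed
    qed
    ultimately show ?thesis
      using integral_lborel_translate[OF meas] by (simp add: D_def)
  qed
  ultimately show ?thesis by (simp add: LIMSEQ_const_iff)
qed

lemma nn_integral_lborel_translate:
  fixes f :: "real^'n \<Rightarrow> ennreal"
  assumes [measurable]: "f \<in> borel_measurable borel"
  shows "(\<integral>\<^sup>+x. f (x + c) \<partial>lborel) = (\<integral>\<^sup>+x. f x \<partial>lborel)"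
    and "(\<integral>\<^sup>+x. f (c - x) \<partial>lborel) = (\<integral>\<^sup>+x. f x \<partial>lborel)"
proof -
  have "lborel = distr lborel borel (\<lambda>x::real^'n. c + 1 *\<^sub>R x)"
    using lborel_affine[of 1 c] by (simp add: density_1)
  then have "(\<integral>\<^sup>+x. f x \<partial>lborel) = (\<integral>\<^sup>+x. f x \<partial>distr lborel borel (\<lambda>x::real^'n. c + 1 *\<^sub>R x))" by simp
  then show "(\<integral>\<^sup>+x. f (x + c) \<partial>lborel) = (\<integral>\<^sup>+x. f x \<partial>lborel)"
    by (subst (asm) nn_integral_distr) (auto simp: add.commute)
  have "lborel = distr lborel borel (\<lambda>x::real^'n. c + (-1) *\<^sub>R x)"
    using lborel_affine[of "-1" c] by (simp add: density_1)
  then have "(\<integral>\<^sup>+x. f x \<partial>lborel) = (\<integral>\<^sup>+x. f x \<partial>distr lborel borel (\<lambda>x::real^'n. c + (-1) *\<^sub>R x))" by simp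
  then show "(\<integral>\<^sup>+x. f (c - x) \<partial>lborel) = (\<integral>\<^sup>+x. f x \<partial>lborel)"
    by (subst (asm) nn_integral_distr) auto
qed

text \<open>
  The image of Lebesgue measure under a reflection is translation invariant, hence a multiple of
  Lebesgue measure (this is the double integral below), and the unit ball gives the factor 1.
\<close>

lemma nn_integral_lborel_reflection:
  fixes f :: "real^'n \<Rightarrow> ennreal"
  assumes \<alpha>: "(norm \<alpha>)\<^sup>2 = 2" and [measurable]: "f \<in> borel_measurable borel"
  shows "(\<integral>\<^sup>+x. f (reflection \<alpha> x) \<partial>lborel) = (\<integral>\<^sup>+x. f x \<partial>lborel)"
proof -
  let ?\<sigma> = "reflection \<alpha>"
  have "continuous_on UNIV ?\<sigma>"
    unfolding reflection_def by (intro continuous_intros) (use \<alpha> in auto)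
  then have [measurable]: "?\<sigma> \<in> borel_measurable borel" by (rule borel_measurable_continuous_onI)
  define g :: "real^'n \<Rightarrow> ennreal" where "g = indicator (ball 0 1)"
  have [measurable]: "g \<in> borel_measurable borel" unfolding g_def by (rule borel_measurable_indicator) simp
  have g_refl: "g (?\<sigma> x) = g x" for x using \<alpha> by (simp add: g_def indicator_def)
  have \<sigma>_diff: "?\<sigma> (x + c) = ?\<sigma> x + ?\<sigma> c" for x c using linear_add[OF linear_reflection] .
  have \<sigma>_neg: "?\<sigma> (- c) = - ?\<sigma> c" for c using linear_neg[OF linear_reflection] .
  have sf: "pair_sigma_finite (lborel :: (real^'n) measure) (lborel :: (real^'n) measure)" ..
  define V where "V = (\<integral>\<^sup>+y. g y \<partial>lborel)"
  have "V = emeasure lborel (ball (0::real^'n) 1)" by (simp add: V_def g_def)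
  then have V: "V \<noteq> 0" "V \<noteq> \<infinity>"
    using emeasure_bounded_finite[of "ball (0::real^'n) 1"] content_ball_pos[of 1 "0::real^'n"]
    by (auto simp: measure_def)
  have "(\<integral>\<^sup>+x. f (?\<sigma> x) \<partial>lborel) * V = (\<integral>\<^sup>+x. f (?\<sigma> x) * (\<integral>\<^sup>+y. g (y + ?\<sigma> x) \<partial>lborel) \<partial>lborel)"
    by (simp add: V_def nn_integral_lborel_translate nn_integral_multc)
  also have "\<dots> = (\<integral>\<^sup>+x. \<integral>\<^sup>+y. f (?\<sigma> x) * g (y + ?\<sigma> x) \<partial>lborel \<partial>lborel)"
    by (simp add: nn_integral_cmult)
  also have "\<dots> = (\<integral>\<^sup>+y. \<integral>\<^sup>+x. f (?\<sigma> x) * g (y + ?\<sigma> x) \<partial>lborel \<partial>lborel)"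
    by (rule pair_sigma_finite.Fubini'[OF sf]) (measurable; simp)
  also have "\<dots> = (\<integral>\<^sup>+y. \<integral>\<^sup>+x. f (?\<sigma> x - y) * g x \<partial>lborel \<partial>lborel)"
  proof (rule nn_integral_cong)
    fix y :: "real^'n"
    have "(\<integral>\<^sup>+x. f (?\<sigma> x) * g (y + ?\<sigma> x) \<partial>lborel)
        = (\<integral>\<^sup>+x. f (?\<sigma> (x + - ?\<sigma> y)) * g (y + ?\<sigma> (x + - ?\<sigma> y)) \<partial>lborel)"
      by (rule nn_integral_lborel_translate(1)[symmetric]) measurable
    also have "\<dots> = (\<integral>\<^sup>+x. f (?\<sigma> x - y) * g x \<partial>lborel)"
      by (simp only: \<sigma>_diff \<sigma>_neg reflection_reflection[OF \<alpha>]) (simp add: g_refl)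
    finally show "(\<integral>\<^sup>+x. f (?\<sigma> x) * g (y + ?\<sigma> x) \<partial>lborel) = (\<integral>\<^sup>+x. f (?\<sigma> x - y) * g x \<partial>lborel)" .
  qed
  also have "\<dots> = (\<integral>\<^sup>+x. \<integral>\<^sup>+y. f (?\<sigma> x - y) * g x \<partial>lborel \<partial>lborel)"
    by (rule pair_sigma_finite.Fubini'[OF sf, symmetric]) (measurable; simp)
  also have "\<dots> = (\<integral>\<^sup>+x. f x \<partial>lborel) * V"
    by (simp add: V_def nn_integral_lborel_translate nn_integral_multc nn_integral_cmult)
  finally have "V * (\<integral>\<^sup>+x. f (?\<sigma> x) \<partial>lborel) = V * (\<integral>\<^sup>+x. f x \<partial>lborel)"
    by (simp add: mult.commute)
  then show ?thesis using V by (simp add: ennreal_mult_cancel_left)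
qed

lemma integral_lborel_reflection:
  fixes f :: "real^'n \<Rightarrow> real"
  assumes \<alpha>: "(norm \<alpha>)\<^sup>2 = 2" and f [measurable]: "f \<in> borel_measurable borel"
  shows "(LINT x|lborel. f (reflection \<alpha> x)) = (LINT x|lborel. f x)"
proof -
  have "continuous_on UNIV (reflection \<alpha>)"
    unfolding reflection_def by (intro continuous_intros) (use \<alpha> in auto)
  then have [measurable]: "reflection \<alpha> \<in> borel_measurable borel" by (rule borel_measurable_continuous_onI)
  have "emeasure (distr lborel borel (reflection \<alpha>)) A = emeasure lborel A" if "A \<in> sets borel" for A
  proof -
    have "emeasure (distr lborel borel (reflection \<alpha>)) A = (\<integral>\<^sup>+x. indicator A (reflection \<alpha> x) \<partial>lborel)"
      using that by (simp add: nn_integral_distr flip: nn_integral_indicator)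
    also have "\<dots> = emeasure lborel A"
      using that by (subst nn_integral_lborel_reflection[OF \<alpha>]) auto
    finally show ?thesis .
  qed
  then have "distr lborel borel (reflection \<alpha>) = lborel" by (intro measure_eqI) auto
  moreover have "(LINT x|distr lborel borel (reflection \<alpha>). f x) = (LINT x|lborel. f (reflection \<alpha> x))"
    by (rule integral_distr) auto
  ultimately show ?thesis by simp
qed

text \<open>The products are falling factorials: this is the explicit sequence of derivatives of
  \<open>(t + \<epsilon>) powr p\<close> demanded by \<open>smooth_compose_real\<close>.\<close>

lemma powr_shift_has_derivative:
  fixes t :: real
  assumes "0 \<le> t" "0 < \<epsilon>"
  shows "((\<lambda>t. (\<Prod>j<n. p - real j) * (t + \<epsilon>) powr (p - real n)) has_real_derivative
      (\<Prod>j<Suc n. p - real j) * (t + \<epsilon>) powr (p - real (Suc n))) (at t)"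
  using assms by (auto intro!: derivative_eq_intros simp: diff_diff_eq add.commute)

context dunkl
begin

text \<open>\<open>dunkl_weight\<close> need not be differentiable on the hyperplanes. Adding a
  positive \<epsilon> to the squares gives a smooth weight with the same reflection symmetry, which
  dominates \<open>dunkl_weight\<close> and converges to it off the hyperplanes as \<epsilon> tends
  to 0.\<close>

definition regular_weight :: "real \<Rightarrow> real^'n \<Rightarrow> real" ("\<W>") where
  "\<W> \<epsilon> x = (\<Prod>\<alpha>\<in>Rp. ((\<alpha> \<bullet> x)\<^sup>2 + \<epsilon>) powr k \<alpha>)"

lemma reflection_in_R: "\<alpha> \<in> R \<Longrightarrow> \<beta> \<in> R \<Longrightarrow> reflection \<beta> \<alpha> \<in> R"
  using root_system unfolding normalized_root_system_def by blast

lemma k_reflection: "\<alpha> \<in> R \<Longrightarrow> \<beta> \<in> R \<Longrightarrow> k (reflection \<beta> \<alpha>) = k \<alpha>"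
  using multiplicity unfolding multiplicity_function_def reflection_group_def
  by (blast intro: generate.incl)

lemma k_minus:
  assumes "\<alpha> \<in> R" shows "k (- \<alpha>) = k \<alpha>"
proof -
  have "\<alpha> \<noteq> 0" using assms root_system unfolding normalized_root_system_def by auto
  then have "reflection \<alpha> \<alpha> = - \<alpha>" by (simp add: reflection_def scaleR_2)
  then show ?thesis using k_reflection[OF assms assms] by simp
qed

text \<open>A reflection permutes \<open>R\<close> but in general not \<open>Rp\<close>. For even
  \<open>F\<close> the product over \<open>R\<close> is the square of the product over
  \<open>Rp\<close>, and nonnegativity allows taking square roots.\<close>

lemma prod_positive_roots_reflection:
  assumes \<beta>: "\<beta> \<in> Rp" and F: "\<And>\<alpha>. \<alpha> \<in> R \<Longrightarrow> F (- \<alpha>) = F \<alpha>" "\<And>\<alpha>. 0 \<le> (F \<alpha> :: real)"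
  shows "(\<Prod>\<alpha>\<in>Rp. F (reflection \<beta> \<alpha>)) = (\<Prod>\<alpha>\<in>Rp. F \<alpha>)"
proof -
  have split: "(\<Prod>\<alpha>\<in>R. H \<alpha>) = (\<Prod>\<alpha>\<in>Rp. H \<alpha>)\<^sup>2" if "\<And>\<alpha>. \<alpha> \<in> R \<Longrightarrow> H (- \<alpha>) = (H \<alpha> :: real)" for H
  proof -
    have "(\<Prod>\<alpha>\<in>R. H \<alpha>) = (\<Prod>\<alpha>\<in>Rp. H \<alpha>) * (\<Prod>\<alpha>\<in>uminus ` Rp. H \<alpha>)"
      using positive unfolding positive_subsystem_def by (metis finite_Rp finite_imageI prod.union_disjoint)
    also have "(\<Prod>\<alpha>\<in>uminus ` Rp. H \<alpha>) = (\<Prod>\<alpha>\<in>Rp. H (- \<alpha>))"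
      by (subst prod.reindex) auto
    also have "\<dots> = (\<Prod>\<alpha>\<in>Rp. H \<alpha>)"
      using that Rp_subset by (intro prod.cong) auto
    finally show ?thesis by (simp add: power2_eq_square)
  qed
  have "reflection \<beta> ` R = R" using root_system Rp_subset[OF \<beta>] unfolding normalized_root_system_def by blast
  moreover have "inj (reflection \<beta>)" using reflection_reflection[OF norm_root[OF \<beta>]] by (metis injI)
  ultimately have "(\<Prod>\<alpha>\<in>R. F \<alpha>) = (\<Prod>\<alpha>\<in>R. F (reflection \<beta> \<alpha>))"
    by (metis (no_types, lifting) comp_apply inj_on_subset prod.cong prod.reindex subset_UNIV)
  moreover have "F (reflection \<beta> (- \<alpha>)) = F (reflection \<beta> \<alpha>)" if "\<alpha> \<in> R" for \<alpha>
    using F(1)[OF reflection_in_R[OF that Rp_subset[OF \<beta>]]] linear_neg[OF linear_reflection] by metis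
  ultimately have "(\<Prod>\<alpha>\<in>Rp. F (reflection \<beta> \<alpha>))\<^sup>2 = (\<Prod>\<alpha>\<in>Rp. F \<alpha>)\<^sup>2"
    using split[of F, OF F(1)] split[of "\<lambda>\<alpha>. F (reflection \<beta> \<alpha>)"] by simp
  then show ?thesis
    using F(2) by (simp add: power2_eq_iff_nonneg prod_nonneg)
qed

lemma inner_reflection_left:
  "\<beta> \<in> Rp \<Longrightarrow> \<alpha> \<bullet> reflection \<beta> x = reflection \<beta> \<alpha> \<bullet> x"
  by (metis inner_reflection_reflection norm_root reflection_reflection)

lemma regular_weight_reflection:
  assumes \<beta>: "\<beta> \<in> Rp" shows "\<W> \<epsilon> (reflection \<beta> x) = \<W> \<epsilon> x"
proof -
  have "\<W> \<epsilon> (reflection \<beta> x) = (\<Prod>\<alpha>\<in>Rp. ((reflection \<beta> \<alpha> \<bullet> x)\<^sup>2 + \<epsilon>) powr k (reflection \<beta> \<alpha>))"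
    unfolding regular_weight_def
    by (intro prod.cong) (auto simp: inner_reflection_left[OF \<beta>] k_reflection Rp_subset \<beta>)
  also have "\<dots> = \<W> \<epsilon> x"
    unfolding regular_weight_def
    by (rule prod_positive_roots_reflection[OF \<beta>, of "\<lambda>\<alpha>. ((\<alpha> \<bullet> x)\<^sup>2 + \<epsilon>) powr k \<alpha>"]) (auto simp: k_minus)
  finally show ?thesis .
qed

lemma weight_reflection:
  assumes \<beta>: "\<beta> \<in> Rp" shows "dunkl_weight Rp k (reflection \<beta> x) = dunkl_weight Rp k x"
proof -
  have "dunkl_weight Rp k (reflection \<beta> x) = (\<Prod>\<alpha>\<in>Rp. \<bar>reflection \<beta> \<alpha> \<bullet> x\<bar> powr (2 * k (reflection \<beta> \<alpha>)))"
    unfolding dunkl_weight_def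
    by (intro prod.cong) (auto simp: inner_reflection_left[OF \<beta>] k_reflection Rp_subset \<beta>)
  also have "\<dots> = dunkl_weight Rp k x"
    unfolding dunkl_weight_def
    by (rule prod_positive_roots_reflection[OF \<beta>, of "\<lambda>\<alpha>. \<bar>\<alpha> \<bullet> x\<bar> powr (2 * k \<alpha>)"]) (auto simp: k_minus)
  finally show ?thesis .
qed

lemma weight_nonneg [simp]: "0 \<le> dunkl_weight Rp k x"
  unfolding dunkl_weight_def by (intro prod_nonneg) auto

lemma weight_measurable [measurable]: "dunkl_weight Rp k \<in> borel_measurable borel"
  unfolding dunkl_weight_def[abs_def] by measurable

lemma weight_le_regular_weight:
  assumes "0 < \<epsilon>" shows "dunkl_weight Rp k x \<le> \<W> \<epsilon> x"
  unfolding dunkl_weight_def regular_weight_def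
proof (intro prod_mono conjI)
  fix \<alpha> assume "\<alpha> \<in> Rp"
  have "\<bar>\<alpha> \<bullet> x\<bar> powr (2 * k \<alpha>) = (\<bar>\<alpha> \<bullet> x\<bar> powr 2) powr k \<alpha>" by (simp only: powr_powr)
  also have "\<bar>\<alpha> \<bullet> x\<bar> powr 2 = (\<alpha> \<bullet> x)\<^sup>2" by (cases "\<alpha> \<bullet> x = 0") (auto simp: powr_numeral)
  also have "((\<alpha> \<bullet> x)\<^sup>2) powr k \<alpha> \<le> ((\<alpha> \<bullet> x)\<^sup>2 + \<epsilon>) powr k \<alpha>"
    using \<open>\<alpha> \<in> Rp\<close> assms by (intro powr_mono2) auto
  finally show "\<bar>\<alpha> \<bullet> x\<bar> powr (2 * k \<alpha>) \<le> ((\<alpha> \<bullet> x)\<^sup>2 + \<epsilon>) powr k \<alpha>" .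
qed auto

lemma regular_weight_mono: "0 \<le> \<epsilon> \<Longrightarrow> \<epsilon> \<le> \<epsilon>' \<Longrightarrow> \<W> \<epsilon> x \<le> \<W> \<epsilon>' x"
  unfolding regular_weight_def by (intro prod_mono conjI powr_mono2) auto

lemma regular_weight_nonneg [simp]: "0 \<le> \<W> \<epsilon> x"
  unfolding regular_weight_def by (intro prod_nonneg) auto

lemma smooth_regular_weight:
  assumes "0 < \<epsilon>" shows "smooth (\<W> \<epsilon>)"
proof -
  have "smooth (\<lambda>x. ((\<alpha> \<bullet> x)\<^sup>2 + \<epsilon>) powr k \<alpha>)" for \<alpha> :: "real^'n"
  proof -
    have "smooth (\<lambda>x. (\<lambda>n t. (\<Prod>j<n. k \<alpha> - real j) * (t + \<epsilon>) powr (k \<alpha> - real n)) 0 ((\<alpha> \<bullet> x)\<^sup>2))"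
      by (rule smooth_compose_real) (auto intro!: powr_shift_has_derivative[OF _ assms] smooth_power simp del: prod.lessThan_Suc of_nat_Suc)
    then show ?thesis by simp
  qed
  then show ?thesis unfolding regular_weight_def[abs_def] by auto
qed

lemma partial_derivative_regular_weight:
  assumes "0 < \<epsilon>"
  shows "partial_derivative i (\<W> \<epsilon>) x = (\<Sum>\<alpha>\<in>Rp. 2 * k \<alpha> * \<alpha> $ i * ((\<alpha> \<bullet> x) / ((\<alpha> \<bullet> x)\<^sup>2 + \<epsilon>))) * \<W> \<epsilon> x"
proof -
  define f where "f \<alpha> x = ((\<alpha> \<bullet> x)\<^sup>2 + \<epsilon>) powr k \<alpha>" for \<alpha> x :: "real^'n"
  have pos: "0 < (\<alpha> \<bullet> x)\<^sup>2 + \<epsilon>" for \<alpha> x :: "real^'n"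
    using assms by (simp add: add_nonneg_pos)
  have d: "((\<lambda>t. (t\<^sup>2 + \<epsilon>) powr p) has_real_derivative (2 * p * (t / (t\<^sup>2 + \<epsilon>)) * (t\<^sup>2 + \<epsilon>) powr p)) (at t)" for t p
    using assms by (auto intro!: derivative_eq_intros simp: powr_diff add_nonneg_pos divide_simps)
  note f' = partial_derivative_compose_real[OF smooth_differentiable[OF smooth_inner] d]
  have diff: "f \<alpha> differentiable (at x)" for \<alpha> x unfolding f_def by (rule f'(2))
  have "(\<lambda>x. \<Prod>\<alpha>\<in>S. f \<alpha> x) differentiable (at x) \<and> partial_derivative i (\<lambda>x. \<Prod>\<alpha>\<in>S. f \<alpha> x) x = (\<Sum>\<alpha>\<in>S. 2 * k \<alpha> * \<alpha> $ i * ((\<alpha> \<bullet> x) / ((\<alpha> \<bullet> x)\<^sup>2 + \<epsilon>))) * (\<Prod>\<alpha>\<in>S. f \<alpha> x)"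
    if "finite S" for S
    using that
  proof induction
    case (insert \<alpha> S)
    have "partial_derivative i (f \<alpha>) x = 2 * k \<alpha> * ((\<alpha> \<bullet> x) / ((\<alpha> \<bullet> x)\<^sup>2 + \<epsilon>)) * f \<alpha> x * \<alpha> $ i"
      unfolding f_def using f'(1)[where x = x and i = i] by simp
    with insert show ?case
      by (auto simp: partial_derivative_mult diff algebra_simps intro!: differentiable_mult)
  qed simp
  then show ?thesis unfolding regular_weight_def[abs_def] f_def[symmetric] by simp
qed

end

section \<open>Integration by parts\<close>

definition test :: "(real^'n \<Rightarrow> real) \<Rightarrow> bool" where
  "test u \<longleftrightarrow> smooth u \<and> bounded_support u"

lemma test_smooth: "test u \<Longrightarrow> smooth u" by (simp add: test_def)

lemma test_add: "test u \<Longrightarrow> test v \<Longrightarrow> test (\<lambda>x. u x + v x)"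
  by (simp add: test_def smooth_add bounded_support_add)

lemma test_diff: "test u \<Longrightarrow> test v \<Longrightarrow> test (\<lambda>x. u x - v x)"
  by (simp add: test_def smooth_diff bounded_support_diff)

lemma test_mult1: "test u \<Longrightarrow> smooth v \<Longrightarrow> test (\<lambda>x. u x * v x)"
  by (simp add: test_def smooth_mult bounded_support_mult1)

lemma test_mult2: "smooth u \<Longrightarrow> test v \<Longrightarrow> test (\<lambda>x. u x * v x)"
  by (simp add: test_def smooth_mult bounded_support_mult2)

lemma test_cmult: "test v \<Longrightarrow> test (\<lambda>x. c * v x)"
  by (simp add: test_mult2)

lemma test_sum: "(\<And>a. a \<in> S \<Longrightarrow> test (f a)) \<Longrightarrow> test (\<lambda>x. \<Sum>a\<in>S. f a x)"
  by (simp add: test_def smooth_sum bounded_support_sum)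

lemma test_euler: "test u \<Longrightarrow> test (euler u)"
  by (simp add: test_def smooth_euler bounded_support_euler)

context dunkl
begin

abbreviation weighted_measure :: "(real^'n) measure" ("\<mu>") where "\<mu> \<equiv> dunkl_measure Rp k"

lemma test_reflected: "test u \<Longrightarrow> \<alpha> \<in> Rp \<Longrightarrow> test (\<lambda>x. u (reflection \<alpha> x))"
  by (simp add: test_def smooth_reflected bounded_support_reflected)

lemma test_T: "test u \<Longrightarrow> test (T i u)"
  unfolding test_def dunkl_operator_def[abs_def]
  by (intro conjI smooth_add smooth_sum smooth_cmult smooth_reflection_quotient smooth_partial_derivative
      bounded_support_add bounded_support_sum bounded_support_mult2 bounded_support_reflection_quotient
      bounded_support_partial_derivative) auto

lemma test_defect: "test u \<Longrightarrow> test (\<A> u)"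
  unfolding reflection_defect_def[abs_def] by (intro test_sum test_cmult test_diff test_reflected)

lemma test_Lap: "test u \<Longrightarrow> test (\<Delta> u)"
  unfolding dunkl_laplacian_def[abs_def] by (intro test_sum test_T)

lemma test_angular: "test u \<Longrightarrow> test (\<L> u)"
  unfolding angular_def[abs_def]
  by (intro test_add test_diff test_cmult test_mult2 smooth_inner_self test_euler test_Lap)

lemmas test_intros = test_add test_diff test_cmult test_sum test_euler test_T test_defect test_Lap
  test_angular test_reflected

lemma AE_not_on_hyperplanes: "AE x in lborel. \<forall>\<alpha>\<in>Rp. \<alpha> \<bullet> x \<noteq> 0"
proof -
  have "AE x in lborel. \<alpha> \<bullet> x \<noteq> 0" if "\<alpha> \<in> Rp" for \<alpha>
  proof -
    have "\<alpha> \<noteq> 0" using norm_root[OF that] by auto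
    then have "{x. \<alpha> \<bullet> x = 0} \<in> null_sets lebesgue"
      using negligible_hyperplane[of \<alpha> 0] negligible_iff_null_sets by blast
    moreover have "{x. \<alpha> \<bullet> x = 0} \<in> sets lborel"
      by (simp add: borel_closed closed_hyperplane)
    ultimately have "{x. \<alpha> \<bullet> x = 0} \<in> null_sets lborel"
      by (simp add: null_sets_completion_iff)
    then show ?thesis by (rule AE_I') auto
  qed
  then show ?thesis using finite_Rp by (subst AE_finite_all) auto
qed

lemma integral_weighted:
  "f \<in> borel_measurable borel \<Longrightarrow> (LINT x|\<mu>. f x) = (LINT x|lborel. dunkl_weight Rp k x * f x)"
  unfolding dunkl_measure_def by (subst integral_density) auto

lemma integrable_weighted_iff:
  "f \<in> borel_measurable borel \<Longrightarrow> integrable \<mu> f \<longleftrightarrow> integrable lborel (\<lambda>x. dunkl_weight Rp k x * f x)"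
  unfolding dunkl_measure_def by (subst integrable_density) auto

lemma sets_weighted [simp, measurable_cong]: "sets \<mu> = sets borel"
  by (simp add: dunkl_measure_def)

lemma space_weighted [simp]: "space \<mu> = UNIV"
  by (simp add: dunkl_measure_def)

lemma integrable_continuous_bounded_support:
  assumes f: "continuous_on UNIV f" "bounded_support f"
  shows "integrable \<mu> f"
proof -
  have [measurable]: "f \<in> borel_measurable borel" using f(1) by (rule borel_measurable_continuous_onI)
  have "integrable lborel (\<lambda>x. \<W> 1 x * \<bar>f x\<bar>)"
  proof (rule integrable_lborel_bounded_support)
    show "continuous_on UNIV (\<lambda>x. \<W> 1 x * \<bar>f x\<bar>)"
      by (rule continuous_on_mult[OF smooth_continuous_on[OF smooth_regular_weight] continuous_on_rabs[OF f(1)]]) simp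
    show "bounded_support (\<lambda>x. \<W> 1 x * \<bar>f x\<bar>)"
      using f(2) by (auto simp: bounded_support_def)
  qed
  then have "integrable lborel (\<lambda>x. dunkl_weight Rp k x * f x)"
    by (rule Bochner_Integration.integrable_bound)
      (auto simp: abs_mult intro!: mult_right_mono order.trans[OF weight_le_regular_weight[of 1]] AE_I2)
  then show ?thesis by (simp add: integrable_weighted_iff)
qed

lemma integrable_test [intro]: "test f \<Longrightarrow> integrable \<mu> f"
  by (simp add: test_def integrable_continuous_bounded_support smooth_continuous_on)

lemma regular_weight_tendsto:
  assumes "\<forall>\<alpha>\<in>Rp. \<alpha> \<bullet> x \<noteq> 0" "\<epsilon> \<longlonglongrightarrow> 0"
  shows "(\<lambda>n. \<W> (\<epsilon> n) x) \<longlonglongrightarrow> dunkl_weight Rp k x"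
  unfolding regular_weight_def dunkl_weight_def
proof (rule tendsto_prod)
  fix \<alpha> assume \<alpha>: "\<alpha> \<in> Rp"
  then have "(\<lambda>n. ((\<alpha> \<bullet> x)\<^sup>2 + \<epsilon> n) powr k \<alpha>) \<longlonglongrightarrow> ((\<alpha> \<bullet> x)\<^sup>2 + 0) powr k \<alpha>"
    using assms by (intro tendsto_powr tendsto_add tendsto_const) auto
  moreover have "\<bar>\<alpha> \<bullet> x\<bar> powr (2 * k \<alpha>) = (\<bar>\<alpha> \<bullet> x\<bar> powr 2) powr k \<alpha>" by (simp only: powr_powr)
  ultimately show "(\<lambda>n. ((\<alpha> \<bullet> x)\<^sup>2 + \<epsilon> n) powr k \<alpha>) \<longlonglongrightarrow> \<bar>\<alpha> \<bullet> x\<bar> powr (2 * k \<alpha>)"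
    using assms(1) \<alpha> by (simp add: powr_numeral)
qed

text \<open>The divergence theorem for the smooth weight. The logarithmic derivative of
  \<open>\<W> \<epsilon>\<close> brings in \<open>2 * k \<alpha> * \<alpha> $ i\<close> times the
  function \<open>q \<alpha>\<close> of the proof, which is odd under the reflection in \<alpha>;
  averaging over that reflection replaces \<open>2 * g x\<close> by
  \<open>g x - g (reflection \<alpha> x)\<close>. The fraction is the price of the regularization:
  off the hyperplane it would be 1 for \<epsilon> = 0.\<close>

lemma integral_regular_weight_T:
  assumes g: "test g" and "0 < \<epsilon>"
  shows "(LINT x|lborel. \<W> \<epsilon> x * (partial_derivative i g x
    + (\<Sum>\<alpha>\<in>Rp. k \<alpha> * \<alpha> $ i * (reflection_quotient \<alpha> g x * ((\<alpha> \<bullet> x)\<^sup>2 / ((\<alpha> \<bullet> x)\<^sup>2 + \<epsilon>)))))) = 0"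
proof -
  note smooths = test_smooth[OF g] smooth_regular_weight[OF \<open>0 < \<epsilon>\<close>]
  have bs: "bounded_support g" using g by (simp add: test_def)
  have pos: "(\<alpha> \<bullet> x)\<^sup>2 + \<epsilon> \<noteq> 0" for \<alpha> x :: "real^'n"
    using \<open>0 < \<epsilon>\<close> by (smt (verit) zero_le_power2)
  define q where "q \<alpha> x = (\<alpha> \<bullet> x) / ((\<alpha> \<bullet> x)\<^sup>2 + \<epsilon>)" for \<alpha> x :: "real^'n"
  have cont_q: "continuous_on UNIV (q \<alpha>)" for \<alpha>
    unfolding q_def by (intro continuous_intros) (simp add: pos)
  have int_smooth: "integrable lborel h" if "smooth h" "bounded_support h" for h :: "real^'n \<Rightarrow> real"
    using that by (intro integrable_lborel_bounded_support smooth_continuous_on)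
  have int_q: "integrable lborel (\<lambda>x. q \<alpha> x * h x)" if "smooth h" "bounded_support h" for \<alpha> and h :: "real^'n \<Rightarrow> real"
    using that by (intro integrable_lborel_bounded_support continuous_on_mult cont_q smooth_continuous_on bounded_support_mult2)
  have refl: "2 * (LINT x|lborel. q \<alpha> x * (\<W> \<epsilon> x * g x))
      = (LINT x|lborel. q \<alpha> x * (\<W> \<epsilon> x * ((\<alpha> \<bullet> x) * reflection_quotient \<alpha> g x)))" if \<alpha>: "\<alpha> \<in> Rp" for \<alpha>
  proof -
    note sr = smooth_compose_linear[OF linear_reflection smooths(1), of \<alpha>]
    note br = bounded_support_reflected[OF bs norm_root[OF \<alpha>]]
    have [measurable]: "q \<alpha> \<in> borel_measurable borel" "\<W> \<epsilon> \<in> borel_measurable borel" "g \<in> borel_measurable borel"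
      using cont_q smooths by (auto intro: borel_measurable_continuous_onI)
    have "(LINT x|lborel. q \<alpha> x * (\<W> \<epsilon> x * g x))
        = (LINT x|lborel. q \<alpha> (reflection \<alpha> x) * (\<W> \<epsilon> (reflection \<alpha> x) * g (reflection \<alpha> x)))"
      by (rule integral_lborel_reflection[OF norm_root[OF \<alpha>], symmetric]) measurable
    also have "\<dots> = - (LINT x|lborel. q \<alpha> x * (\<W> \<epsilon> x * g (reflection \<alpha> x)))"
      using \<alpha> by (simp add: regular_weight_reflection q_def)
    finally have "2 * (LINT x|lborel. q \<alpha> x * (\<W> \<epsilon> x * g x)) = (LINT x|lborel. q \<alpha> x * (\<W> \<epsilon> x * g x))
        - (LINT x|lborel. q \<alpha> x * (\<W> \<epsilon> x * g (reflection \<alpha> x)))" by simp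
    also have "\<dots> = (LINT x|lborel. q \<alpha> x * (\<W> \<epsilon> x * g x) - q \<alpha> x * (\<W> \<epsilon> x * g (reflection \<alpha> x)))"
      by (intro Bochner_Integration.integral_diff[symmetric] int_q smooth_mult smooths sr bounded_support_mult2 bs br)
    finally show ?thesis
      using \<alpha> by (simp add: reflection_quotient_mult_inner algebra_simps)
  qed
  have "0 = (LINT x|lborel. partial_derivative i (\<lambda>x. \<W> \<epsilon> x * g x) x)"
    by (intro integral_lborel_partial_derivative[symmetric] smooth_mult smooths bounded_support_mult2 bs)
  also have "\<dots> = (LINT x|lborel. (\<Sum>\<alpha>\<in>Rp. (2 * k \<alpha> * \<alpha> $ i) * (q \<alpha> x * (\<W> \<epsilon> x * g x)))
      + \<W> \<epsilon> x * partial_derivative i g x)"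
    by (intro Bochner_Integration.integral_cong refl)
      (simp_all add: partial_derivative_mult smooth_differentiable smooths partial_derivative_regular_weight[OF \<open>0 < \<epsilon>\<close>]
        sum_distrib_right q_def mult.assoc)
  also have "\<dots> = (\<Sum>\<alpha>\<in>Rp. (2 * k \<alpha> * \<alpha> $ i) * (LINT x|lborel. q \<alpha> x * (\<W> \<epsilon> x * g x)))
      + (LINT x|lborel. \<W> \<epsilon> x * partial_derivative i g x)"
    by (subst Bochner_Integration.integral_add)
      (auto intro!: Bochner_Integration.integrable_sum integrable_mult_right int_q int_smooth smooth_mult smooths bounded_support_mult2 bs
        smooth_partial_derivative bounded_support_partial_derivative simp: Bochner_Integration.integral_sum int_q smooth_mult smooths bounded_support_mult2 bs)
  also have "(\<Sum>\<alpha>\<in>Rp. (2 * k \<alpha> * \<alpha> $ i) * (LINT x|lborel. q \<alpha> x * (\<W> \<epsilon> x * g x)))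
     = (\<Sum>\<alpha>\<in>Rp. (k \<alpha> * \<alpha> $ i) * (LINT x|lborel. q \<alpha> x * (\<W> \<epsilon> x * ((\<alpha> \<bullet> x) * reflection_quotient \<alpha> g x))))"
    by (intro sum.cong) (simp_all add: refl[symmetric])
  also have "\<dots> + (LINT x|lborel. \<W> \<epsilon> x * partial_derivative i g x)
     = (LINT x|lborel. (\<Sum>\<alpha>\<in>Rp. (k \<alpha> * \<alpha> $ i) * (q \<alpha> x * (\<W> \<epsilon> x * ((\<alpha> \<bullet> x) * reflection_quotient \<alpha> g x))))
        + \<W> \<epsilon> x * partial_derivative i g x)"
  proof -
    have *: "integrable lborel (\<lambda>x. q \<alpha> x * (\<W> \<epsilon> x * ((\<alpha> \<bullet> x) * reflection_quotient \<alpha> g x)))" if "\<alpha> \<in> Rp" for \<alpha>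
      using that by (intro int_q smooth_mult smooths smooth_inner smooth_reflection_quotient bounded_support_mult2
          bounded_support_reflection_quotient bs norm_root)
    show ?thesis
      by (subst Bochner_Integration.integral_add)
        (auto intro!: Bochner_Integration.integrable_sum integrable_mult_right * int_smooth smooth_mult smooths bounded_support_mult2 bs
          smooth_partial_derivative bounded_support_partial_derivative simp: Bochner_Integration.integral_sum *)
  qed
  also have "\<dots> = (LINT x|lborel. \<W> \<epsilon> x * (partial_derivative i g x
    + (\<Sum>\<alpha>\<in>Rp. k \<alpha> * \<alpha> $ i * (reflection_quotient \<alpha> g x * ((\<alpha> \<bullet> x)\<^sup>2 / ((\<alpha> \<bullet> x)\<^sup>2 + \<epsilon>))))))"
    by (intro Bochner_Integration.integral_cong HOL.refl)
      (simp add: q_def sum_distrib_left distrib_left power2_eq_square mult_ac)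
  finally show ?thesis by simp
qed

lemma abs_quotient_le_1: "0 \<le> a \<Longrightarrow> 0 < e \<Longrightarrow> \<bar>a / (a + e)\<bar> \<le> (1::real)"
  by (simp add: divide_le_eq_1)

text \<open>The limit of \<open>integral_regular_weight_T\<close> as \<epsilon> tends to 0. The
  fractions tend to 1 off the hyperplanes and never exceed 1, and the weights are dominated by
  \<open>\<W> 1\<close>.\<close>

lemma integral_T:
  assumes g: "test g"
  shows "(LINT x|\<mu>. T i g x) = 0"
proof -
  define \<epsilon> where "\<epsilon> n = inverse (real (Suc n))" for n
  have \<epsilon>: "0 < \<epsilon> n" "\<epsilon> n \<le> 1" for n by (auto simp: \<epsilon>_def divide_simps)
  have lim: "\<epsilon> \<longlonglongrightarrow> 0" unfolding \<epsilon>_def by (rule LIMSEQ_inverse_real_of_nat)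
  define s where "s n x = \<W> (\<epsilon> n) x * (partial_derivative i g x
    + (\<Sum>\<alpha>\<in>Rp. k \<alpha> * \<alpha> $ i * (reflection_quotient \<alpha> g x * ((\<alpha> \<bullet> x)\<^sup>2 / ((\<alpha> \<bullet> x)\<^sup>2 + \<epsilon> n)))))" for n x
  define w where "w x = \<W> 1 x * (\<bar>partial_derivative i g x\<bar> + (\<Sum>\<alpha>\<in>Rp. \<bar>k \<alpha> * \<alpha> $ i\<bar> * \<bar>reflection_quotient \<alpha> g x\<bar>))" for x
  note smooths = test_smooth[OF g] smooth_partial_derivative[OF test_smooth[OF g], of i] smooth_regular_weight[OF \<epsilon>(1)]
  have bs: "bounded_support g" using g by (simp add: test_def)
  have [measurable]: "reflection_quotient \<alpha> g \<in> borel_measurable borel" if "\<alpha> \<in> Rp" for \<alpha>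
    using that smooths by (intro smooth_borel_measurable smooth_reflection_quotient) auto
  have [measurable]: "partial_derivative i g \<in> borel_measurable borel" "\<W> (\<epsilon> n) \<in> borel_measurable borel" for n
    using smooths by auto
  have "(\<lambda>n. LINT x|lborel. s n x) \<longlonglongrightarrow> (LINT x|lborel. dunkl_weight Rp k x * T i g x)"
  proof (rule integral_dominated_convergence)
    show "(\<lambda>x. dunkl_weight Rp k x * T i g x) \<in> borel_measurable lborel"
      using smooth_borel_measurable[OF smooth_T[OF smooths(1), of i]] by measurable
    show "s n \<in> borel_measurable lborel" for n
      unfolding s_def by measurable
    show "integrable lborel w"
    proof (rule integrable_lborel_bounded_support)
      have abs: "bounded_support (\<lambda>x. \<bar>u x\<bar>)" if "bounded_support u" for u :: "real^'n \<Rightarrow> real"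
        using that by (simp add: bounded_support_def)
      show "continuous_on UNIV w" unfolding w_def
        by (intro continuous_intros smooth_continuous_on smooth_regular_weight smooth_reflection_quotient smooths) auto
      show "bounded_support w" unfolding w_def
        by (intro bounded_support_mult2 bounded_support_add bounded_support_sum abs bounded_support_partial_derivative
            bounded_support_reflection_quotient bs smooths norm_root)
    qed
    show "AE x in lborel. (\<lambda>n. s n x) \<longlonglongrightarrow> dunkl_weight Rp k x * T i g x"
      using AE_not_on_hyperplanes
    proof eventually_elim
      case (elim x)
      have "(\<lambda>n. (\<alpha> \<bullet> x)\<^sup>2 / ((\<alpha> \<bullet> x)\<^sup>2 + \<epsilon> n)) \<longlonglongrightarrow> (\<alpha> \<bullet> x)\<^sup>2 / ((\<alpha> \<bullet> x)\<^sup>2 + 0)" if "\<alpha> \<in> Rp" for \<alpha>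
        using that elim by (intro tendsto_intros lim) auto
      then have "(\<lambda>n. (\<alpha> \<bullet> x)\<^sup>2 / ((\<alpha> \<bullet> x)\<^sup>2 + \<epsilon> n)) \<longlonglongrightarrow> 1" if "\<alpha> \<in> Rp" for \<alpha>
        using that elim by auto
      then have "(\<lambda>n. s n x) \<longlonglongrightarrow> dunkl_weight Rp k x * (partial_derivative i g x
          + (\<Sum>\<alpha>\<in>Rp. k \<alpha> * \<alpha> $ i * (reflection_quotient \<alpha> g x * 1)))"
        unfolding s_def by (intro tendsto_intros regular_weight_tendsto[OF elim lim])
      then show ?case by (simp add: dunkl_operator_def)
    qed
    show "AE x in lborel. norm (s n x) \<le> w x" for n
    proof (rule AE_I2)
      fix x :: "real^'n"
      have "\<bar>(\<alpha> \<bullet> x)\<^sup>2 / ((\<alpha> \<bullet> x)\<^sup>2 + \<epsilon> n)\<bar> \<le> 1" for \<alpha>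
        using \<epsilon>(1)[of n] by (rule abs_quotient_le_1[OF zero_le_power2])
      then have "\<bar>k \<alpha> * \<alpha> $ i * (reflection_quotient \<alpha> g x * ((\<alpha> \<bullet> x)\<^sup>2 / ((\<alpha> \<bullet> x)\<^sup>2 + \<epsilon> n)))\<bar>
          \<le> \<bar>k \<alpha> * \<alpha> $ i\<bar> * (\<bar>reflection_quotient \<alpha> g x\<bar> * 1)" for \<alpha>
        unfolding abs_mult[of "k \<alpha> * \<alpha> $ i"] abs_mult[of "reflection_quotient \<alpha> g x"] by (intro mult_left_mono) auto
      then have "\<bar>\<Sum>\<alpha>\<in>Rp. k \<alpha> * \<alpha> $ i * (reflection_quotient \<alpha> g x * ((\<alpha> \<bullet> x)\<^sup>2 / ((\<alpha> \<bullet> x)\<^sup>2 + \<epsilon> n)))\<bar>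
          \<le> (\<Sum>\<alpha>\<in>Rp. \<bar>k \<alpha> * \<alpha> $ i\<bar> * \<bar>reflection_quotient \<alpha> g x\<bar>)"
        by (intro order.trans[OF sum_abs] sum_mono) auto
      then have "\<bar>partial_derivative i g x
          + (\<Sum>\<alpha>\<in>Rp. k \<alpha> * \<alpha> $ i * (reflection_quotient \<alpha> g x * ((\<alpha> \<bullet> x)\<^sup>2 / ((\<alpha> \<bullet> x)\<^sup>2 + \<epsilon> n))))\<bar>
          \<le> \<bar>partial_derivative i g x\<bar> + (\<Sum>\<alpha>\<in>Rp. \<bar>k \<alpha> * \<alpha> $ i\<bar> * \<bar>reflection_quotient \<alpha> g x\<bar>)"
        by linarith
      then show "norm (s n x) \<le> w x"
        unfolding s_def w_def using \<epsilon>[of n] by (simp add: abs_mult regular_weight_mono mult_mono)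
    qed
  qed
  moreover have "(LINT x|lborel. s n x) = 0" for n
    unfolding s_def by (rule integral_regular_weight_T[OF g \<epsilon>(1)])
  ultimately have "(LINT x|lborel. dunkl_weight Rp k x * T i g x) = 0"
    by (simp add: LIMSEQ_const_iff)
  then show ?thesis
    using smooth_borel_measurable[OF smooth_T[OF smooths(1), of i]] by (simp add: integral_weighted)
qed

lemma integral_reflected:
  fixes f :: "real^'n \<Rightarrow> real"
  assumes "\<alpha> \<in> Rp" "f \<in> borel_measurable borel"
  shows "(LINT x|\<mu>. f (reflection \<alpha> x)) = (LINT x|\<mu>. f x)"
proof -
  have "continuous_on UNIV (reflection \<alpha>)"
    unfolding reflection_def by (intro continuous_intros) (use norm_root[OF assms(1)] in auto)
  then have [measurable]: "reflection \<alpha> \<in> borel_measurable borel" by (rule borel_measurable_continuous_onI)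
  note [measurable] = assms(2)
  have "(LINT x|\<mu>. f (reflection \<alpha> x)) = (LINT x|lborel. dunkl_weight Rp k (reflection \<alpha> x) * f (reflection \<alpha> x))"
    using assms by (subst integral_weighted) (auto simp: weight_reflection)
  also have "\<dots> = (LINT x|lborel. dunkl_weight Rp k x * f x)"
    by (rule integral_lborel_reflection[OF norm_root[OF assms(1)]]) measurable
  finally show ?thesis using assms by (simp add: integral_weighted)
qed

lemma integral_mult_defect:
  assumes "test f" "smooth g"
  shows "(LINT x|\<mu>. f x * \<A> g x) = (LINT x|\<mu>. \<A> f x * g x)"
proof -
  have "(LINT x|\<mu>. f x * (g x - g (reflection \<alpha> x))) = (LINT x|\<mu>. (f x - f (reflection \<alpha> x)) * g x)"
    if \<alpha>: "\<alpha> \<in> Rp" for \<alpha>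
  proof -
    note [simp] = smooth_reflected[OF assms(2) \<alpha>] test_reflected[OF assms(1) \<alpha>]
    have tests: "test (\<lambda>x. f x * g (reflection \<alpha> x))" "test (\<lambda>x. f (reflection \<alpha> x) * g x)" "test (\<lambda>x. f x * g x)"
      by (intro test_mult1 assms; simp add: assms)+
    have "(LINT x|\<mu>. f (reflection \<alpha> x) * g (reflection \<alpha> (reflection \<alpha> x))) = (LINT x|\<mu>. f x * g (reflection \<alpha> x))"
      by (rule integral_reflected[OF \<alpha>, of "\<lambda>x. f x * g (reflection \<alpha> x)"])
        (rule smooth_borel_measurable[OF test_smooth[OF tests(1)]])
    then have "(LINT x|\<mu>. f x * g (reflection \<alpha> x)) = (LINT x|\<mu>. f (reflection \<alpha> x) * g x)"
      using \<alpha> by simp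
    then show ?thesis
      unfolding right_diff_distrib left_diff_distrib
      using tests by (simp add: integrable_test)
  qed
  then have "(\<Sum>\<alpha>\<in>Rp. k \<alpha> * (LINT x|\<mu>. f x * (g x - g (reflection \<alpha> x))))
      = (\<Sum>\<alpha>\<in>Rp. k \<alpha> * (LINT x|\<mu>. (f x - f (reflection \<alpha> x)) * g x))" by simp
  moreover have "(LINT x|\<mu>. f x * \<A> g x) = (LINT x|\<mu>. (\<Sum>\<alpha>\<in>Rp. k \<alpha> * (f x * (g x - g (reflection \<alpha> x)))))"
    "(LINT x|\<mu>. \<A> f x * g x) = (LINT x|\<mu>. (\<Sum>\<alpha>\<in>Rp. k \<alpha> * ((f x - f (reflection \<alpha> x)) * g x)))"
    by (simp_all add: reflection_defect_def sum_distrib_left sum_distrib_right mult_ac)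
  moreover have "test (\<lambda>x. f x * (g x - g (reflection \<alpha> x)))" "test (\<lambda>x. (f x - f (reflection \<alpha> x)) * g x)" if "\<alpha> \<in> Rp" for \<alpha>
    using that assms by (auto intro!: test_mult1 test_diff test_reflected smooth_diff smooth_reflected)
  ultimately show ?thesis
    by (simp add: integrable_test)
qed

text \<open>By \<open>sum_T_nth_mult\<close> the function
  \<open>euler f x - \<A> f x + \<N> * f x\<close> is a sum of Dunkl derivatives, and
  \<open>\<A> f\<close> integrates to zero because \<open>\<A>\<close> is symmetric and annihilates
  constants.\<close>

lemma integral_euler:
  assumes f: "test f"
  shows "(LINT x|\<mu>. euler f x) = - \<N> * (LINT x|\<mu>. f x)"
proof -
  have "(LINT x|\<mu>. (\<Sum>i\<in>UNIV. T i (\<lambda>x. x $ i * f x) x)) = 0"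
  proof -
    have "test (\<lambda>x. x $ i * f x)" for i using f by (simp add: test_mult2)
    then show ?thesis
      by (subst Bochner_Integration.integral_sum) (auto simp: integral_T intro!: integrable_test test_T)
  qed
  then have "(LINT x|\<mu>. euler f x - \<A> f x + \<N> * f x) = 0"
    by (simp add: sum_T_nth_mult test_smooth f)
  moreover have "(LINT x|\<mu>. \<A> f x) = 0"
    using integral_mult_defect[OF f, of "\<lambda>x. 1"] by (simp add: reflection_defect_def[of "\<lambda>x. 1"])
  moreover have "integrable \<mu> (euler f)" "integrable \<mu> (\<A> f)" "integrable \<mu> f"
    using f by (auto intro!: integrable_test test_intros)
  ultimately show ?thesis by simp
qed

text \<open>\<open>integral_T\<close> for the product of \<open>u\<close> and \<open>v\<close>; the
  correction terms of \<open>T_mult\<close>, called \<open>h \<alpha>\<close> here, are odd under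
  their reflections and integrate to zero.\<close>

lemma integral_T_mult:
  assumes u: "test u" and v: "smooth v"
  shows "(LINT x|\<mu>. T i u x * v x) = - (LINT x|\<mu>. u x * T i v x)"
proof -
  have bs: "bounded_support u" and su: "smooth u" using u by (auto simp: test_def)
  define h where "h \<alpha> x = reflection_quotient \<alpha> u x * (v x - v (reflection \<alpha> x))" for \<alpha> x
  have test_h: "test (h \<alpha>)" if "\<alpha> \<in> Rp" for \<alpha>
    unfolding h_def using that bs su v
    by (intro test_mult1 smooth_diff smooth_reflected)
      (auto simp: test_def intro!: smooth_reflection_quotient bounded_support_reflection_quotient)
  have "(LINT x|\<mu>. h \<alpha> x) = 0" if \<alpha>: "\<alpha> \<in> Rp" for \<alpha>
  proof -
    have "h \<alpha> (reflection \<alpha> x) = - h \<alpha> x" for x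
    proof (cases "\<alpha> \<bullet> x = 0")
      case True
      then show ?thesis using norm_root[OF \<alpha>] by (simp add: h_def reflection_normalized)
    next
      case False
      then show ?thesis using \<alpha> by (simp add: h_def reflection_quotient_def divide_simps) (simp add: algebra_simps)
    qed
    moreover have "(LINT x|\<mu>. h \<alpha> (reflection \<alpha> x)) = (LINT x|\<mu>. h \<alpha> x)"
      using test_smooth[OF test_h[OF \<alpha>]] by (intro integral_reflected \<alpha>) auto
    ultimately show ?thesis by simp
  qed
  then have "(LINT x|\<mu>. (\<Sum>\<alpha>\<in>Rp. (k \<alpha> * \<alpha> $ i) * h \<alpha> x)) = 0"
    by (subst Bochner_Integration.integral_sum) (auto intro!: integrable_test test_cmult test_h)
  moreover have "(LINT x|\<mu>. T i (\<lambda>x. u x * v x) x) = 0"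
    by (intro integral_T test_mult1 u v)
  then have "(LINT x|\<mu>. u x * T i v x + T i u x * v x - (\<Sum>\<alpha>\<in>Rp. (k \<alpha> * \<alpha> $ i) * h \<alpha> x)) = 0"
    by (simp add: T_mult su v h_def)
  moreover have "integrable \<mu> (\<lambda>x. u x * T i v x)" "integrable \<mu> (\<lambda>x. T i u x * v x)"
      "integrable \<mu> (\<lambda>x. \<Sum>\<alpha>\<in>Rp. (k \<alpha> * \<alpha> $ i) * h \<alpha> x)"
    by (auto intro!: integrable_test test_sum test_cmult test_h) (auto intro!: test_mult1 test_T smooth_T u v)
  ultimately show ?thesis by simp
qed

lemma defect_invariant_mult:
  assumes "\<And>x y. norm x = norm y \<Longrightarrow> \<phi> x = \<phi> y"
  shows "\<A> (\<lambda>x. \<phi> x * u x) x = \<phi> x * \<A> u x"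
  unfolding reflection_defect_def sum_distrib_left
  by (intro sum.cong) (auto simp: algebra_simps assms[of "reflection _ x" x])

text \<open>The Euler part of the operator contributes the integrand
  \<open>euler (\<rho> J) + \<N> \<rho> J - \<theta> J\<close> with the antisymmetric
  \<open>J\<close> of the proof, and its first two terms cancel by \<open>integral_euler\<close>.
  Integrating \<open>\<Delta>\<close> by parts leaves \<open>\<theta> J\<close> with the opposite
  sign, where \<theta> is the radial derivative of \<open>(x \<bullet> x) * \<rho> x\<close> divided
  by the radius. \<open>\<A>\<close> drops out because it is symmetric for radial weights.\<close>

lemma angular_symmetric:
  assumes \<rho>: "radial_pair \<rho> \<rho>'" "test \<rho>" and f: "smooth f" and g: "smooth g"
  shows "(LINT x|\<mu>. \<rho> x * (\<L> f x * g x)) = (LINT x|\<mu>. \<rho> x * (f x * \<L> g x))"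
proof -
  define \<theta> where "\<theta> x = 2 * \<rho> x + (x \<bullet> x) * \<rho>' x" for x
  define sr where "sr x = (x \<bullet> x) * \<rho> x" for x
  define J where "J x = f x * euler g x - g x * euler f x" for x
  have "radial_pair sr \<theta>"
    unfolding \<theta>_def sr_def[abs_def] using radial_pair_mult[OF radial_pair_inner_self \<rho>(1)] by simp
  note \<theta>_pair = this
  have smooth_\<rho>': "smooth \<rho>'" using \<rho> by (simp add: radial_pair_def)
  \<comment> \<open>\<open>euler \<rho> x = (x \<bullet> x) * \<rho>' x\<close>, so away from the
    origin \<open>\<rho>'\<close> vanishes together with \<open>euler \<rho>\<close>; hence the
    request \<open>0 < K\<close>.\<close>
  have "bounded_support \<rho>'"
  proof -
    obtain K where K: "0 < K" "\<And>x. K < norm x \<Longrightarrow> euler \<rho> x = 0"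
      using bounded_support_euler[of \<rho>] \<rho>(2) unfolding test_def by (metis bounded_supportE)
    then show ?thesis
      by (intro bounded_supportI[of K]) (fastforce simp: euler_radial[OF \<rho>(1)])
  qed
  then have test_\<rho>': "test \<rho>'" using smooth_\<rho>' by (simp add: test_def)
  have test_\<theta>: "test \<theta>"
    unfolding \<theta>_def[abs_def] by (intro test_add test_cmult \<rho> test_mult2[OF _ test_\<rho>']) auto
  have test_J: "smooth J" unfolding J_def[abs_def] using f g by (intro smooth_diff smooth_mult smooth_euler)
  have test_sr: "test sr" unfolding sr_def[abs_def] by (intro test_mult2 \<rho>) auto
  have half: "(LINT x|\<mu>. (sr x * f x) * \<Delta> g x)
      = - (\<Sum>i\<in>UNIV. LINT x|\<mu>. sr x * T i f x * T i g x) - (LINT x|\<mu>. \<theta> x * f x * euler g x) - (LINT x|\<mu>. \<theta> x * f x * \<A> g x)"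
    if f: "smooth f" and g: "smooth g" for f g
  proof -
    define w where "w x = sr x * f x" for x
    have w: "test w" unfolding w_def[abs_def] using f test_sr by (intro test_mult1)
    have tests: "test (\<lambda>x. sr x * T i f x * T i g x)" "test (\<lambda>x. \<theta> x * f x * euler g x)"
      "test (\<lambda>x. \<theta> x * f x * \<A> g x)" "test (\<lambda>x. \<theta> x * f x * (x $ i * T i g x))" for i
      using f g test_sr test_\<theta> by (auto intro!: test_mult1 smooth_T smooth_euler smooth_defect smooth_mult)
    have "(LINT x|\<mu>. w x * \<Delta> g x) = (\<Sum>i\<in>UNIV. LINT x|\<mu>. w x * T i (T i g) x)"
      unfolding dunkl_laplacian_def sum_distrib_left
      by (intro Bochner_Integration.integral_sum integrable_test test_mult1 w smooth_T g)
    also have "\<dots> = (\<Sum>i\<in>UNIV. - (LINT x|\<mu>. T i w x * T i g x))"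
      using integral_T_mult[OF w smooth_T[OF g]] by simp
    also have "\<dots> = (\<Sum>i\<in>UNIV. - ((LINT x|\<mu>. sr x * T i f x * T i g x) + (LINT x|\<mu>. \<theta> x * f x * (x $ i * T i g x))))"
    proof (intro sum.cong refl arg_cong[where f = uminus])
      fix i
      have "(LINT x|\<mu>. T i w x * T i g x) = (LINT x|\<mu>. sr x * T i f x * T i g x + \<theta> x * f x * (x $ i * T i g x))"
        unfolding w_def[abs_def] T_radial_mult[OF \<theta>_pair f] by (simp add: algebra_simps)
      then show "(LINT x|\<mu>. T i w x * T i g x) = (LINT x|\<mu>. sr x * T i f x * T i g x) + (LINT x|\<mu>. \<theta> x * f x * (x $ i * T i g x))"
        by (simp add: integrable_test tests)
    qed
    also have "\<dots> = - (\<Sum>i\<in>UNIV. LINT x|\<mu>. sr x * T i f x * T i g x) - (LINT x|\<mu>. \<theta> x * f x * (\<Sum>i\<in>UNIV. x $ i * T i g x))"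
      by (simp add: sum_negf sum_subtractf sum_distrib_left integrable_test tests)
    also have "(LINT x|\<mu>. \<theta> x * f x * (\<Sum>i\<in>UNIV. x $ i * T i g x)) = (LINT x|\<mu>. \<theta> x * f x * euler g x + \<theta> x * f x * \<A> g x)"
      unfolding sum_nth_mult_T by (simp add: algebra_simps)
    finally show ?thesis
      unfolding w_def by (simp add: integrable_test tests)
  qed
  have A: "(LINT x|\<mu>. \<theta> x * f x * \<A> g x) = (LINT x|\<mu>. \<theta> x * g x * \<A> f x)"
  proof -
    have "\<A> (\<lambda>x. \<theta> x * f x) x = \<theta> x * \<A> f x" for x
      by (rule defect_invariant_mult) (rule radial_pairD(4)[OF \<theta>_pair])
    then show ?thesis
      using integral_mult_defect[OF test_mult1[OF test_\<theta> f] g] by (simp add: mult_ac)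
  qed
  have tests: "test (\<lambda>x. sr x * f x * \<Delta> g x)" "test (\<lambda>x. sr x * g x * \<Delta> f x)"
    "test (\<lambda>x. \<theta> x * f x * euler g x)" "test (\<lambda>x. \<theta> x * g x * euler f x)" "test (\<lambda>x. \<rho> x * J x)" "test (\<lambda>x. \<theta> x * J x)"
    "test (\<lambda>x. \<rho> x * (\<L> f x * g x))" "test (\<lambda>x. \<rho> x * (f x * \<L> g x))"
    using f g \<rho>(2) test_sr test_\<theta> by (auto intro!: test_mult1 smooth_euler smooth_angular smooth_Lap smooth_mult test_J)
  have sum_sym: "(\<Sum>i\<in>UNIV. LINT x|\<mu>. sr x * T i g x * T i f x) = (\<Sum>i\<in>UNIV. LINT x|\<mu>. sr x * T i f x * T i g x)"
    by (simp add: mult_ac)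
  have "(LINT x|\<mu>. sr x * f x * \<Delta> g x) - (LINT x|\<mu>. sr x * g x * \<Delta> f x)
      = (LINT x|\<mu>. \<theta> x * g x * euler f x) - (LINT x|\<mu>. \<theta> x * f x * euler g x)"
    using half[OF f g] half[OF g f] A sum_sym by simp
  also have "\<dots> = - (LINT x|\<mu>. \<theta> x * f x * euler g x - \<theta> x * g x * euler f x)"
    by (simp add: integrable_test tests)
  also have "\<dots> = - (LINT x|\<mu>. \<theta> x * J x)"
    by (simp add: J_def algebra_simps)
  finally have *: "(LINT x|\<mu>. sr x * f x * \<Delta> g x) - (LINT x|\<mu>. sr x * g x * \<Delta> f x)
     = - (LINT x|\<mu>. \<theta> x * J x)" .
  have "(LINT x|\<mu>. \<rho> x * (f x * \<L> g x)) - (LINT x|\<mu>. \<rho> x * (\<L> f x * g x))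
     = (LINT x|\<mu>. \<rho> x * (f x * \<L> g x) - \<rho> x * (\<L> f x * g x))"
    by (simp add: integrable_test tests)
  also have "\<dots> = (LINT x|\<mu>. euler (\<lambda>x. \<rho> x * J x) x + \<N> * (\<rho> x * J x) - \<theta> x * J x
      - (sr x * f x * \<Delta> g x - sr x * g x * \<Delta> f x))"
  proof (rule Bochner_Integration.integral_cong[OF refl])
    fix x
    have "euler (\<lambda>x. \<rho> x * J x) x = (x \<bullet> x) * \<rho>' x * J x + \<rho> x * (f x * euler (euler g) x - g x * euler (euler f) x)"
      using f g test_J test_smooth[OF \<rho>(2)] unfolding J_def[abs_def]
      by (simp add: euler_mult euler_diff euler_radial[OF \<rho>(1)] smooth_euler smooth_mult smooth_diff)
    then show "\<rho> x * (f x * \<L> g x) - \<rho> x * (\<L> f x * g x) = euler (\<lambda>x. \<rho> x * J x) x + \<N> * (\<rho> x * J x) - \<theta> x * J x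
      - (sr x * f x * \<Delta> g x - sr x * g x * \<Delta> f x)"
      unfolding angular_def \<theta>_def J_def sr_def by (simp add: algebra_simps)
  qed
  also have "\<dots> = (LINT x|\<mu>. euler (\<lambda>x. \<rho> x * J x) x) + \<N> * (LINT x|\<mu>. \<rho> x * J x) - (LINT x|\<mu>. \<theta> x * J x)
      - ((LINT x|\<mu>. sr x * f x * \<Delta> g x) - (LINT x|\<mu>. sr x * g x * \<Delta> f x))"
    by (simp add: integrable_test tests test_euler)
  also have "\<dots> = 0"
    unfolding * by (simp add: integral_euler tests)
  finally show ?thesis by simp
qed

end

section \<open>Homogeneous polynomials and the Fischer decomposition\<close>

inductive homogeneous_polynomial :: "nat \<Rightarrow> (real^'n \<Rightarrow> real) \<Rightarrow> bool" where
  const: "homogeneous_polynomial 0 (\<lambda>x. c)"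
| zero: "homogeneous_polynomial n (\<lambda>x. 0)"
| nth_mult: "homogeneous_polynomial n p \<Longrightarrow> homogeneous_polynomial (Suc n) (\<lambda>x. x $ i * p x)"
| add: "homogeneous_polynomial n p \<Longrightarrow> homogeneous_polynomial n q \<Longrightarrow> homogeneous_polynomial n (\<lambda>x. p x + q x)"

lemma homogeneous_polynomial_cmult:
  "homogeneous_polynomial n p \<Longrightarrow> homogeneous_polynomial n (\<lambda>x. c * p x)"
proof (induction rule: homogeneous_polynomial.induct)
  case (nth_mult n p i)
  then show ?case using homogeneous_polynomial.nth_mult[of n "\<lambda>x. c * p x" i] by (simp add: mult.left_commute)
qed (auto simp: distrib_left intro: homogeneous_polynomial.intros)

lemma homogeneous_polynomial_sum:
  "(\<And>a. a \<in> S \<Longrightarrow> homogeneous_polynomial n (f a)) \<Longrightarrow> homogeneous_polynomial n (\<lambda>x. \<Sum>a\<in>S. f a x)"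
  by (induction S rule: infinite_finite_induct) (auto intro: homogeneous_polynomial.intros)

lemma homogeneous_polynomial_diff:
  "homogeneous_polynomial n p \<Longrightarrow> homogeneous_polynomial n q \<Longrightarrow> homogeneous_polynomial n (\<lambda>x. p x - q x)"
  using homogeneous_polynomial.add[OF _ homogeneous_polynomial_cmult[of n q "-1"], of p] by simp

lemma homogeneous_polynomial_mult:
  "homogeneous_polynomial m p \<Longrightarrow> homogeneous_polynomial n q \<Longrightarrow> homogeneous_polynomial (m + n) (\<lambda>x. p x * q x)"
proof (induction rule: homogeneous_polynomial.induct)
  case (nth_mult m p i)
  then show ?case using homogeneous_polynomial.nth_mult[of "m + n" "\<lambda>x. p x * q x" i] by (simp add: mult.assoc)
qed (auto simp: distrib_right intro: homogeneous_polynomial.intros homogeneous_polynomial_cmult)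

lemma homogeneous_polynomial_inner:
  "homogeneous_polynomial 1 (\<lambda>x. a \<bullet> x)"
proof -
  have "homogeneous_polynomial (Suc 0) (\<lambda>x. a $ i * (x $ i * 1))" for i
    by (intro homogeneous_polynomial_cmult homogeneous_polynomial.nth_mult homogeneous_polynomial.const)
  then show ?thesis
    using homogeneous_polynomial_sum[of UNIV "Suc 0" "\<lambda>i x. a $ i * (x $ i * 1)"] by (simp add: inner_vec_def)
qed

lemma homogeneous_polynomial_inner_self_power:
  "homogeneous_polynomial (2 * j) (\<lambda>x. (x \<bullet> x) ^ j)"
proof (induction j)
  case (Suc j)
  have "homogeneous_polynomial (Suc (Suc 0)) (\<lambda>x. x $ i * (x $ i * 1))" for i
    by (intro homogeneous_polynomial.nth_mult homogeneous_polynomial.const)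
  from homogeneous_polynomial_sum[of UNIV "Suc (Suc 0)", OF this]
  have "homogeneous_polynomial 2 (\<lambda>x::real^'a. x \<bullet> x)" by (simp add: inner_vec_def numeral_2_eq_2)
  from homogeneous_polynomial_mult[OF this Suc] show ?case by simp
qed (simp add: homogeneous_polynomial.const)

lemma homogeneous_polynomial_smooth: "homogeneous_polynomial n p \<Longrightarrow> smooth p"
  by (induction rule: homogeneous_polynomial.induct) auto

lemma euler_homogeneous: "homogeneous_polynomial n p \<Longrightarrow> euler p x = real n * p x"
proof (induction arbitrary: x rule: homogeneous_polynomial.induct)
  case (nth_mult n p i)
  have "euler (\<lambda>x. x $ i) x = x $ i"
    using euler_inner[of "axis i 1" x] by (simp add: inner_axis')
  moreover have "smooth p" using nth_mult.hyps by (rule homogeneous_polynomial_smooth)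
  ultimately show ?case using nth_mult.IH
    by (simp add: euler_mult) (simp add: algebra_simps)
next
  case (add n p q)
  then show ?case by (simp add: euler_add homogeneous_polynomial_smooth algebra_simps)
qed auto

lemma homogeneous_polynomial_0_const: "homogeneous_polynomial n p \<Longrightarrow> n = 0 \<Longrightarrow> \<exists>c. \<forall>x. p x = c"
  by (induction rule: homogeneous_polynomial.induct) auto

lemma homogeneous_polynomial_reflected:
  assumes "homogeneous_polynomial n p" "(norm \<alpha>)\<^sup>2 = 2"
  shows "homogeneous_polynomial n (\<lambda>x. p (reflection \<alpha> x))"
  using assms(1)
proof (induction rule: homogeneous_polynomial.induct)
  case (nth_mult n p i)
  have "homogeneous_polynomial (Suc n) (\<lambda>x. x $ i * p (reflection \<alpha> x) - \<alpha> $ i * ((\<alpha> \<bullet> x) * p (reflection \<alpha> x)))"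
    using homogeneous_polynomial_mult[OF homogeneous_polynomial_inner nth_mult.IH]
    by (intro homogeneous_polynomial_diff homogeneous_polynomial_cmult homogeneous_polynomial.nth_mult nth_mult.IH) auto
  then show ?case using assms(2) by (simp add: reflection_normalized algebra_simps)
qed (auto intro: homogeneous_polynomial.intros)

inductive polynomial_map :: "(real^'n \<Rightarrow> real) \<Rightarrow> bool" where
  homogeneous: "homogeneous_polynomial n p \<Longrightarrow> polynomial_map p"
| add: "polynomial_map p \<Longrightarrow> polynomial_map q \<Longrightarrow> polynomial_map (\<lambda>x. p x + q x)"

lemma polynomial_map_mult:
  "polynomial_map p \<Longrightarrow> polynomial_map q \<Longrightarrow> polynomial_map (\<lambda>x. p x * q x)"
proof (induction rule: polynomial_map.induct)
  case (homogeneous n p)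
  from this(2,1) show ?case
    by (induction rule: polynomial_map.induct)
      (auto simp: distrib_left intro: polynomial_map.intros homogeneous_polynomial_mult)
qed (auto simp: distrib_right intro: polynomial_map.add)

text \<open>The link to the polynomials delivered by the Stone-Weierstrass theorem; a linear form is
  the inner product with the vector of its values on the axes.\<close>

lemma real_polynomial_function_polynomial_map:
  fixes g :: "real^'n \<Rightarrow> real"
  shows "real_polynomial_function g \<Longrightarrow> polynomial_map g"
proof (induction rule: real_polynomial_function.induct)
  case (linear f)
  then have lin: "linear f" by (rule bounded_linear.linear)
  have "f x = (\<chi> i. f (axis i 1)) \<bullet> x" for x
  proof -
    have "f x = f (\<Sum>i\<in>UNIV. (x $ i) *\<^sub>R axis i 1)"
      using basis_expansion[of x] by (simp add: scalar_mult_eq_scaleR)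
    then show ?thesis by (simp add: linear_sum[OF lin] linear_cmul[OF lin] inner_vec_def mult.commute)
  qed
  then have "f = (\<lambda>x. (\<chi> i. f (axis i 1)) \<bullet> x)" by blast
  then show ?case using polynomial_map.homogeneous[OF homogeneous_polynomial_inner] by metis
qed (auto intro: polynomial_map_mult polynomial_map.intros homogeneous_polynomial.const)

lemma radial_pair_power:
  "radial_pair (\<lambda>x. (x \<bullet> x) ^ j) (\<lambda>x. 2 * real j * (x \<bullet> x) ^ (j - 1))"
proof (induction j)
  case (Suc j)
  have "(\<lambda>x::real^'a. 2 * (x \<bullet> x) ^ j + (x \<bullet> x) * (2 * real j * (x \<bullet> x) ^ (j - 1))) = (\<lambda>x. 2 * real (Suc j) * (x \<bullet> x) ^ j)"
    by (cases j) (auto simp: algebra_simps)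
  then show ?case
    using radial_pair_mult[OF radial_pair_inner_self Suc] by simp
qed (simp add: radial_pair_const)

lemma radial_pair_cmult: "radial_pair \<phi> \<phi>' \<Longrightarrow> radial_pair (\<lambda>x. c * \<phi> x) (\<lambda>x. c * \<phi>' x)"
  using radial_pair_mult[OF radial_pair_const[of c], of \<phi> \<phi>'] by simp

context dunkl
begin

text \<open>Degree 0 carries the stronger conclusion that the derivative vanishes, because in the
  induction step \<open>x $ j * T i p x\<close> has to stay in degree 0. The reflected terms of
  \<open>T_nth_mult\<close> keep the degree of \<open>p\<close>.\<close>

lemma T_homogeneous:
  assumes "homogeneous_polynomial n p"
  shows "(n = 0 \<longrightarrow> T i p = (\<lambda>x. 0)) \<and> (\<forall>m. n = Suc m \<longrightarrow> homogeneous_polynomial m (T i p))"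
  using assms
proof (induction rule: homogeneous_polynomial.induct)
  case (const c)
  then show ?case using T_const by auto
next
  case (zero n)
  have "T i (\<lambda>x. 0) = (\<lambda>x. 0)" using T_const by auto
  then show ?case by (simp add: homogeneous_polynomial.zero)
next
  case (nth_mult n p j)
  have "homogeneous_polynomial n (\<lambda>x. x $ j * T i p x)"
  proof (cases n)
    case 0
    then show ?thesis using nth_mult.IH by (simp add: homogeneous_polynomial.zero)
  next
    case (Suc m)
    then show ?thesis using nth_mult.IH by (auto intro: homogeneous_polynomial.nth_mult)
  qed
  moreover have "homogeneous_polynomial n (\<lambda>x. if i = j then p x else 0)"
    using nth_mult by (cases "i = j") (auto intro: homogeneous_polynomial.zero)
  moreover have "homogeneous_polynomial n (\<lambda>x. \<Sum>\<alpha>\<in>Rp. k \<alpha> * \<alpha> $ i * \<alpha> $ j * p (reflection \<alpha> x))"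
    using nth_mult by (intro homogeneous_polynomial_sum homogeneous_polynomial_cmult homogeneous_polynomial_reflected) auto
  moreover have "T i (\<lambda>x. x $ j * p x) = (\<lambda>x. x $ j * T i p x + (if i = j then p x else 0)
    + (\<Sum>\<alpha>\<in>Rp. k \<alpha> * \<alpha> $ i * \<alpha> $ j * p (reflection \<alpha> x)))"
    using T_nth_mult[OF homogeneous_polynomial_smooth[OF nth_mult.hyps]] by blast
  ultimately show ?case by (auto intro: homogeneous_polynomial.add)
next
  case (add n p q)
  have "T i (\<lambda>x. p x + q x) = (\<lambda>x. T i p x + T i q x)"
    using add.hyps by (intro ext T_add homogeneous_polynomial_smooth)
  with add.IH show ?case by (auto intro: homogeneous_polynomial.add)
qed

lemma Lap_homogeneous:
  assumes "homogeneous_polynomial n p"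
  shows "n < 2 \<Longrightarrow> \<Delta> p x = 0" "n = Suc (Suc m) \<Longrightarrow> homogeneous_polynomial m (\<Delta> p)"
proof -
  have T0: "T i (T i p) = (\<lambda>x. 0)" if "n < 2" for i
  proof (cases n)
    case 0
    then have "T i p = (\<lambda>x. 0)" using T_homogeneous[OF assms, of i] by auto
    then show ?thesis using T_const by auto
  next
    case (Suc m)
    with that have "n = Suc 0" by simp
    then have "homogeneous_polynomial 0 (T i p)" using T_homogeneous[OF assms, of i] by auto
    then show ?thesis using T_homogeneous by blast
  qed
  show "n < 2 \<Longrightarrow> \<Delta> p x = 0" by (simp add: dunkl_laplacian_def T0)
  assume n: "n = Suc (Suc m)"
  then have "homogeneous_polynomial m (T i (T i p))" for i
    using T_homogeneous[OF assms, of i] T_homogeneous[of "Suc m" "T i p" i] by auto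
  then show "homogeneous_polynomial m (\<Delta> p)"
    unfolding dunkl_laplacian_def[abs_def] by (intro homogeneous_polynomial_sum)
qed

lemma hom_dim_pos: "0 < \<N>"
  using total_multiplicity_nonneg by (simp add: hom_dim_def add_pos_nonneg)

lemma Lap_sum:
  assumes "finite S" "\<And>a. a \<in> S \<Longrightarrow> smooth (f a)"
  shows "\<Delta> (\<lambda>x. \<Sum>a\<in>S. f a x) x = (\<Sum>a\<in>S. \<Delta> (f a) x)"
  using assms
proof (induction S rule: finite_induct)
  case (insert a S)
  then have "smooth (\<lambda>x. \<Sum>a\<in>S. f a x)" by auto
  with insert show ?case by (simp add: Lap_add)
qed simp

text \<open>By induction \<open>\<Delta> p\<close>, of degree \<open>m = n - 2\<close>, is
  decomposed and then lifted: \<open>\<Delta>\<close> maps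
  \<open>(x \<bullet> x) ^ Suc j * h j x\<close> to the positive multiple \<open>e j\<close> of
  \<open>(x \<bullet> x) ^ j * h j x\<close>. Dividing by the \<open>e j\<close> gives
  \<open>H\<close> with the same Laplacian as \<open>p\<close>, and the difference of
  \<open>p\<close> and \<open>H\<close> is the new harmonic term with \<open>j = 0\<close>.\<close>

lemma Fischer_decomposition:
  assumes "homogeneous_polynomial n p"
  shows "\<exists>h. (\<forall>j\<le>n div 2. homogeneous_polynomial (n - 2 * j) (h j) \<and> (\<forall>x. \<Delta> (h j) x = 0)) \<and>
     (\<forall>x. p x = (\<Sum>j\<le>n div 2. (x \<bullet> x) ^ j * h j x))"
  using assms
proof (induction n arbitrary: p rule: less_induct)
  case (less n)
  show ?case
  proof (cases "n < 2")
    case True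
    then show ?thesis using less.prems Lap_homogeneous(1)[OF less.prems]
      by (intro exI[of _ "\<lambda>_. p"]) auto
  next
    case False
    then obtain m where n: "n = Suc (Suc m)" using that[of "n - 2"] by simp
    obtain h where h: "\<And>j. j \<le> m div 2 \<Longrightarrow> homogeneous_polynomial (m - 2 * j) (h j)"
       "\<And>j x. j \<le> m div 2 \<Longrightarrow> \<Delta> (h j) x = 0"
       and sum: "\<And>x. \<Delta> p x = (\<Sum>j\<le>m div 2. (x \<bullet> x) ^ j * h j x)"
      using less.IH[of m "\<Delta> p"] Lap_homogeneous(2)[OF less.prems n] n by auto
    \<comment> \<open>From \<open>Lap_radial_mult\<close>: the radial derivative of the factor gives
      \<open>2 * Suc j\<close>, and the bracket is \<open>2 * (m - 2 * j)\<close> from the degree of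
      \<open>h j\<close> plus \<open>2 * j + \<N>\<close> from the factor itself.\<close>
    define e where "e j = 2 * real (Suc j) * (2 * real m - 2 * real j + \<N>)" for j
    have e: "e j > 0" if "j \<le> m div 2" for j
      using that hom_dim_pos unfolding e_def by (intro mult_pos_pos) auto
    have smooth_h: "smooth (h j)" if "j \<le> m div 2" for j
      using h(1)[OF that] by (rule homogeneous_polynomial_smooth)
    have lap: "\<Delta> (\<lambda>x. (x \<bullet> x) ^ Suc j * h j x) x = e j * ((x \<bullet> x) ^ j * h j x)" if j: "j \<le> m div 2" for j x
    proof -
      have eul: "euler (\<lambda>x. 2 * real (Suc j) * (x \<bullet> x) ^ j) x = 2 * real j * (2 * real (Suc j) * (x \<bullet> x) ^ j)"
        using euler_homogeneous[OF homogeneous_polynomial_cmult[OF homogeneous_polynomial_inner_self_power[of j]], of "2 * real (Suc j)" x]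
        by simp
      have "radial_pair (\<lambda>x. (x \<bullet> x) ^ Suc j) (\<lambda>x. 2 * real (Suc j) * (x \<bullet> x) ^ j)"
        using radial_pair_power[of "Suc j"] by simp
      from Lap_radial_mult[OF this radial_pair_cmult[OF radial_pair_power] smooth_h[OF j], of x]
      have "\<Delta> (\<lambda>x. (x \<bullet> x) ^ Suc j * h j x) x = 2 * (2 * real (Suc j) * (x \<bullet> x) ^ j) * ((real m - 2 * real j) * h j x)
          + (2 * real j * (2 * real (Suc j) * (x \<bullet> x) ^ j) + \<N> * (2 * real (Suc j) * (x \<bullet> x) ^ j)) * h j x"
        using j unfolding eul h(2)[OF j] euler_homogeneous[OF h(1)[OF j]] by (simp add: of_nat_diff)
      also have "\<dots> = e j * ((x \<bullet> x) ^ j * h j x)"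
        unfolding e_def by (simp add: algebra_simps del: of_nat_Suc)
      finally show ?thesis .
    qed
    define H where "H x = (\<Sum>j\<le>m div 2. (1 / e j) * ((x \<bullet> x) ^ Suc j * h j x))" for x
    have hom: "homogeneous_polynomial n (\<lambda>x. (x \<bullet> x) ^ Suc j * h j x)" if j: "j \<le> m div 2" for j
    proof -
      have "2 * Suc j + (m - 2 * j) = n" using j n by simp
      then show ?thesis
        using homogeneous_polynomial_mult[OF homogeneous_polynomial_inner_self_power[of "Suc j"] h(1)[OF j]] by metis
    qed
    have hom_H: "homogeneous_polynomial n H"
      unfolding H_def[abs_def] using hom by (intro homogeneous_polynomial_sum homogeneous_polynomial_cmult) auto
    have "\<Delta> H x = \<Delta> p x" for x
    proof -
      have sm: "smooth (\<lambda>x. (x \<bullet> x) ^ Suc j * h j x)" if "j \<le> m div 2" for j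
        using hom[OF that] by (rule homogeneous_polynomial_smooth)
      then have "\<Delta> H x = (\<Sum>j\<le>m div 2. \<Delta> (\<lambda>x. (1 / e j) * ((x \<bullet> x) ^ Suc j * h j x)) x)"
        unfolding H_def[abs_def] by (intro Lap_sum smooth_cmult) auto
      also have "\<dots> = (\<Sum>j\<le>m div 2. (1 / e j) * (e j * ((x \<bullet> x) ^ j * h j x)))"
        by (intro sum.cong refl) (simp only: Lap_cmult[OF sm] lap atMost_iff)
      also have "\<dots> = \<Delta> p x"
        unfolding sum using e by (intro sum.cong) (auto simp: less_le)
      finally show ?thesis .
    qed
    then have harm: "\<Delta> (\<lambda>x. p x - H x) x = 0" for x
      using Lap_add[OF homogeneous_polynomial_smooth[OF less.prems] smooth_cmult[OF homogeneous_polynomial_smooth[OF hom_H], of "-1"]]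
        Lap_cmult[OF homogeneous_polynomial_smooth[OF hom_H], of "-1"] by simp
    define h' where "h' j = (case j of 0 \<Rightarrow> \<lambda>x. p x - H x | Suc i \<Rightarrow> \<lambda>x. (1 / e i) * h i x)" for j
    have nm: "n div 2 = Suc (m div 2)" using n by simp
    have "homogeneous_polynomial (n - 2 * j) (h' j) \<and> (\<forall>x. \<Delta> (h' j) x = 0)" if "j \<le> n div 2" for j
    proof (cases j)
      case 0
      then show ?thesis using harm homogeneous_polynomial_diff[OF less.prems hom_H] by (simp add: h'_def)
    next
      case (Suc i)
      with that nm have i: "i \<le> m div 2" by simp
      then have "n - 2 * j = m - 2 * i" using n Suc by simp
      then show ?thesis
        using Suc i h(2)[OF i] homogeneous_polynomial_cmult[OF h(1)[OF i]]
        by (simp add: h'_def Lap_cmult[OF smooth_h[OF i]] del: times_divide_eq_left)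
    qed
    moreover have "p x = (\<Sum>j\<le>n div 2. (x \<bullet> x) ^ j * h' j x)" for x
    proof -
      have "(\<Sum>j\<le>n div 2. (x \<bullet> x) ^ j * h' j x) = h' 0 x + (\<Sum>j\<le>m div 2. (x \<bullet> x) ^ Suc j * h' (Suc j) x)"
        unfolding nm by (subst sum.atMost_Suc_shift) simp
      also have "\<dots> = p x" by (simp add: h'_def H_def mult_ac)
      finally show ?thesis by simp
    qed
    ultimately show ?thesis by blast
  qed
qed

text \<open>
  The angular eigenvalue of a harmonic polynomial of degree \<open>a\<close>, unchanged under multiplication
  by radial functions.
\<close>

definition eigenvalue :: "nat \<Rightarrow> real" where "eigenvalue a = real a * (real a + \<N> - 2)"

text \<open>The index is the angular degree: for polynomials, component \<open>a\<close> collects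
  radial multiples of harmonic polynomials of degree \<open>a\<close>, and component 0 is radial.
  Vanishing beyond \<open>D\<close> lets decompositions of different lengths be added.\<close>

definition eigen_decomposition :: "(real^'n \<Rightarrow> real) \<Rightarrow> nat \<Rightarrow> (nat \<Rightarrow> real^'n \<Rightarrow> real) \<Rightarrow> bool" where
  "eigen_decomposition p D f \<longleftrightarrow> (\<forall>a. smooth (f a)) \<and> (\<forall>a x. \<L> (f a) x = eigenvalue a * f a x) \<and>
     (\<forall>x. \<A> (f 0) x = 0) \<and> (\<forall>x. p x = (\<Sum>a\<le>D. f a x)) \<and> (\<forall>a>D. \<forall>x. f a x = 0)"

definition eigen_sum :: "(real^'n \<Rightarrow> real) \<Rightarrow> bool" where
  "eigen_sum p \<longleftrightarrow> (\<exists>D f. eigen_decomposition p D f)"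

lemma defect_add: "\<A> (\<lambda>x. u x + v x) x = \<A> u x + \<A> v x"
  by (simp add: reflection_defect_def sum.distrib[symmetric] algebra_simps)

lemma defect_cmult: "\<A> (\<lambda>x. c * u x) x = c * \<A> u x"
  by (rule defect_invariant_mult) simp

lemma eigen_sum_add:
  assumes "eigen_sum p" "eigen_sum q" shows "eigen_sum (\<lambda>x. p x + q x)"
proof -
  obtain D f D' f' where f: "eigen_decomposition p D f" "eigen_decomposition q D' f'"
    using assms unfolding eigen_sum_def by blast
  have sum: "(\<Sum>a\<le>max D D'. g a x) = (\<Sum>a\<le>E. g a x)" if "\<forall>a>E. \<forall>x. g a x = 0" "E \<le> max D D'"
    for E x and g :: "nat \<Rightarrow> real^'n \<Rightarrow> real"
    using that by (intro sum.mono_neutral_right) auto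
  have "eigen_decomposition (\<lambda>x. p x + q x) (max D D') (\<lambda>a x. f a x + f' a x)"
    using f unfolding eigen_decomposition_def
    by (auto simp: angular_add defect_add sum.distrib sum[of D] sum[of D'] distrib_left)
  then show ?thesis unfolding eigen_sum_def by blast
qed

lemma eigen_sum_zero: "eigen_sum (\<lambda>x. 0)"
proof -
  have "\<L> (\<lambda>x. 0) x = 0" for x using angular_radial[OF radial_pair_const radial_pair_const, of 0] .
  then have "eigen_decomposition (\<lambda>x. 0) 0 (\<lambda>a x. 0)"
    by (simp add: eigen_decomposition_def reflection_defect_def)
  then show ?thesis unfolding eigen_sum_def by blast
qed

lemma eigen_sum_finite_sum:
  "(\<And>j. j \<in> S \<Longrightarrow> eigen_sum (f j)) \<Longrightarrow> eigen_sum (\<lambda>x. \<Sum>j\<in>S. f j x)"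
  by (induction S rule: infinite_finite_induct) (auto intro: eigen_sum_add eigen_sum_zero)

lemma angular_harmonic:
  assumes "homogeneous_polynomial d h" "\<And>x. \<Delta> h x = 0"
  shows "\<L> h x = eigenvalue d * h x"
proof -
  have "euler h = (\<lambda>x. real d * h x)" using euler_homogeneous[OF assms(1)] by blast
  then show ?thesis
    using assms by (simp add: angular_def euler_cmult homogeneous_polynomial_smooth eigenvalue_def algebra_simps)
qed

text \<open>A Fischer summand is an eigenfunction with the eigenvalue of its harmonic factor, since
  radial factors pass through \<open>\<L>\<close>. If the harmonic factor has degree 0, the summand
  is radial and \<open>\<A>\<close> annihilates it.\<close>

lemma eigen_sum_polynomial: "polynomial_map p \<Longrightarrow> eigen_sum p"
proof (induction rule: polynomial_map.induct)
  case (homogeneous n p)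
  obtain h where h: "\<And>j. j \<le> n div 2 \<Longrightarrow> homogeneous_polynomial (n - 2 * j) (h j)"
      "\<And>j x. j \<le> n div 2 \<Longrightarrow> \<Delta> (h j) x = 0"
    and p: "\<And>x. p x = (\<Sum>j\<le>n div 2. (x \<bullet> x) ^ j * h j x)"
    using Fischer_decomposition[OF homogeneous] by blast
  have "eigen_sum (\<lambda>x. (x \<bullet> x) ^ j * h j x)" if j: "j \<le> n div 2" for j
  proof -
    define d where "d = n - 2 * j"
    define u where "u x = (x \<bullet> x) ^ j * h j x" for x
    note hj = h(1)[OF j, folded d_def]
    have rad: "radial_pair (\<lambda>x::real^'n. (x \<bullet> x) ^ j) (\<lambda>x. 2 * real j * (x \<bullet> x) ^ (j - 1))"
      "radial_pair (\<lambda>x::real^'n. 2 * real j * (x \<bullet> x) ^ (j - 1)) (\<lambda>x. 2 * real j * (2 * real (j - 1) * (x \<bullet> x) ^ (j - 1 - 1)))"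
      by (intro radial_pair_power radial_pair_cmult)+
    have Lu: "\<L> u x = eigenvalue d * u x" for x
      unfolding u_def[abs_def]
      using angular_radial_mult[OF rad homogeneous_polynomial_smooth[OF hj]] angular_harmonic[OF hj] h(2)[OF j] by simp
    have L0: "\<L> (\<lambda>x. 0) x = 0" for x using angular_radial[OF radial_pair_const radial_pair_const, of 0] .
    have su: "smooth u" unfolding u_def[abs_def] using hj by (intro smooth_mult smooth_power) (auto intro: homogeneous_polynomial_smooth)
    have A0: "\<A> u x = 0" if d0: "d = 0" for x
    proof -
      obtain c where "\<forall>x. h j x = c" using homogeneous_polynomial_0_const[OF hj d0] by blast
      then have "u = (\<lambda>x. (x \<bullet> x) ^ j * c)" by (auto simp: u_def)
      then show ?thesis
        using defect_radial_mult[OF rad(1), of "\<lambda>x. c" x] by (simp add: reflection_defect_def)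
    qed
    have "eigen_decomposition u d (\<lambda>a. if a = d then u else (\<lambda>x. 0))"
      using Lu L0 su A0 unfolding eigen_decomposition_def
      by (auto simp: reflection_defect_def[of "\<lambda>x. 0"] if_distribR sum.delta cong: if_cong)
    then show ?thesis unfolding eigen_sum_def u_def[abs_def] by blast
  qed
  then have "eigen_sum (\<lambda>x. \<Sum>j\<le>n div 2. (x \<bullet> x) ^ j * h j x)"
    by (intro eigen_sum_finite_sum) auto
  moreover have "p = (\<lambda>x. \<Sum>j\<le>n div 2. (x \<bullet> x) ^ j * h j x)" using p by blast
  ultimately show ?case by simp
qed (rule eigen_sum_add)

lemma eigen_sum_smooth:
  assumes "eigen_sum p" shows "smooth p"
proof -
  obtain D f where "eigen_decomposition p D f"
    using assms unfolding eigen_sum_def by blast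
  then have "\<forall>a. smooth (f a)" "\<forall>x. p x = (\<Sum>a\<le>D. f a x)"
    unfolding eigen_decomposition_def by blast+
  then have "p = (\<lambda>x. \<Sum>a\<le>D. f a x)" "smooth (\<lambda>x. \<Sum>a\<le>D. f a x)" by auto
  then show ?thesis by simp
qed

end

section \<open>Spectral analysis of the angular operator\<close>

lemma le_if_all_pos_le_add_mult:
  fixes a b c :: real
  assumes "\<And>\<eta>. 0 < \<eta> \<Longrightarrow> a \<le> b + \<eta> * c"
  shows "a \<le> b"
proof (rule tendsto_lowerbound)
  show "((\<lambda>\<eta>. b + \<eta> * c) \<longlongrightarrow> b) (at_right 0)"
    by (auto intro!: tendsto_eq_intros)
  show "eventually (\<lambda>\<eta>. a \<le> b + \<eta> * c) (at_right 0)"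
    using assms by (auto simp: eventually_at_right_less intro: eventually_mono[OF eventually_at_right_less])
qed auto

lemma (in dunkl) angular_sum:
  assumes "finite S" "\<And>a. a \<in> S \<Longrightarrow> smooth (f a)"
  shows "\<L> (\<lambda>x. \<Sum>a\<in>S. f a x) x = (\<Sum>a\<in>S. \<L> (f a) x)"
  using assms
proof (induction S rule: finite_induct)
  case empty
  then show ?case using angular_radial[OF radial_pair_const radial_pair_const, of 0 x] by simp
next
  case (insert a S)
  then have "smooth (\<lambda>x. \<Sum>a\<in>S. f a x)" by auto
  with insert show ?case by (simp add: angular_add)
qed

text \<open>Polynomials are in general not square integrable for the weighted measure. A compactly
  supported weight makes them so, and being radial it preserves the symmetry of \<open>\<L>\<close>
  and \<open>\<A>\<close>.\<close>

locale dunkl_cutoff = dunkl R Rp k for R Rp :: "(real^'n) set" and k +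
  fixes \<rho> \<rho>' :: "real^'n \<Rightarrow> real"
  assumes radial_cutoff: "radial_pair \<rho> \<rho>'" and test_cutoff: "test \<rho>" and cutoff_nonneg: "0 \<le> \<rho> x"
begin

text \<open>On smooth functions this form is only positive semidefinite, since \<open>\<rho>\<close>
  vanishes far out.\<close>

definition ip :: "(real^'n \<Rightarrow> real) \<Rightarrow> (real^'n \<Rightarrow> real) \<Rightarrow> real" where
  "ip f g = (LINT x|\<mu>. \<rho> x * (f x * g x))"

definition nrm :: "(real^'n \<Rightarrow> real) \<Rightarrow> real" where "nrm f = sqrt (ip f f)"

lemma integrable_ip: "smooth f \<Longrightarrow> smooth g \<Longrightarrow> integrable \<mu> (\<lambda>x. \<rho> x * (f x * g x))"
  by (intro integrable_test test_mult1 test_cutoff smooth_mult)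

lemma ip_commute: "ip f g = ip g f"
  by (simp add: ip_def mult.commute)

lemma ip_add:
  assumes "smooth f" "smooth g" "smooth h" shows "ip (\<lambda>x. f x + g x) h = ip f h + ip g h"
proof -
  have "ip (\<lambda>x. f x + g x) h = (LINT x|\<mu>. \<rho> x * (f x * h x) + \<rho> x * (g x * h x))"
    by (simp add: ip_def algebra_simps)
  then show ?thesis using integrable_ip assms by (simp add: ip_def)
qed

lemma ip_cmult: "ip (\<lambda>x. c * f x) h = c * ip f h"
proof -
  have "ip (\<lambda>x. c * f x) h = (LINT x|\<mu>. c * (\<rho> x * (f x * h x)))"
    by (simp add: ip_def mult_ac)
  then show ?thesis by (simp add: ip_def)
qed

lemma ip_diff:
  assumes "smooth f" "smooth g" "smooth h" shows "ip (\<lambda>x. f x - g x) h = ip f h - ip g h"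
  using ip_add[OF assms(1) smooth_cmult[OF assms(2), of "-1"] assms(3)] ip_cmult[of "-1" g h] by simp

lemma ip_zero [simp]: "ip (\<lambda>x. 0) h = 0" "ip h (\<lambda>x. 0) = 0"
  by (simp_all add: ip_def)

lemma ip_sum:
  assumes "finite S" "\<And>a. a \<in> S \<Longrightarrow> smooth (f a)" "smooth h"
  shows "ip (\<lambda>x. \<Sum>a\<in>S. f a x) h = (\<Sum>a\<in>S. ip (f a) h)"
  using assms
proof (induction S rule: finite_induct)
  case (insert a S)
  then have "smooth (\<lambda>x. \<Sum>a\<in>S. f a x)" by auto
  with insert show ?case by (simp add: ip_add)
qed simp

lemma ip_add_right:
  "smooth f \<Longrightarrow> smooth g \<Longrightarrow> smooth h \<Longrightarrow> ip h (\<lambda>x. f x + g x) = ip h f + ip h g"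
  by (simp only: ip_commute[of h] ip_add)

lemma ip_diff_right:
  "smooth f \<Longrightarrow> smooth g \<Longrightarrow> smooth h \<Longrightarrow> ip h (\<lambda>x. f x - g x) = ip h f - ip h g"
  by (simp only: ip_commute[of h] ip_diff)

lemma ip_cmult_right: "ip h (\<lambda>x. c * f x) = c * ip h f"
  by (simp only: ip_commute[of h] ip_cmult)

lemma ip_sum_right:
  "finite S \<Longrightarrow> (\<And>a. a \<in> S \<Longrightarrow> smooth (f a)) \<Longrightarrow> smooth h \<Longrightarrow> ip h (\<lambda>x. \<Sum>a\<in>S. f a x) = (\<Sum>a\<in>S. ip h (f a))"
  by (simp only: ip_commute[of h] ip_sum)

lemma ip_nonneg: "0 \<le> ip f f"
  unfolding ip_def by (intro Bochner_Integration.integral_nonneg mult_nonneg_nonneg cutoff_nonneg zero_le_square)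

lemma nrm_power2: "(nrm f)\<^sup>2 = ip f f"
  by (simp add: nrm_def ip_nonneg)

lemma nrm_nonneg [simp]: "0 \<le> nrm f"
  by (simp add: nrm_def ip_nonneg)

lemma ip_add_add:
  assumes "smooth f" "smooth g"
  shows "ip (\<lambda>x. f x + g x) (\<lambda>x. f x + g x) = ip f f + 2 * ip f g + ip g g"
  using assms ip_commute[of g f] by (simp add: ip_add ip_add_right smooth_add)

lemma ip_Cauchy_Schwarz:
  assumes f: "smooth f" and g: "smooth g"
  shows "ip f g \<le> nrm f * nrm g"
proof -
  have *: "0 \<le> ip f f + 2 * t * ip f g + t\<^sup>2 * ip g g" for t
    using ip_nonneg[of "\<lambda>x. f x + t * g x"] ip_add_add[OF f smooth_cmult[OF g, of t]]
    by (simp add: ip_cmult ip_cmult_right power2_eq_square mult_ac)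
  have "(ip f g)\<^sup>2 \<le> ip f f * ip g g"
  proof (cases "ip g g = 0")
    case False
    then have pos: "0 < ip g g" using ip_nonneg[of g] by linarith
    have "0 \<le> ip f f - (ip f g)\<^sup>2 / ip g g"
      using *[of "- ip f g / ip g g"] pos by (simp add: power2_eq_square field_simps)
    then show ?thesis using pos by (simp add: field_simps)
  next
    case True
    have "ip f g = 0"
    proof (rule ccontr)
      assume "ip f g \<noteq> 0"
      \<comment> \<open>With \<open>ip g g = 0\<close> the expression is affine in \<open>t\<close>,
        and this \<open>t\<close> makes it equal to -1.\<close>
      then show False using *[of "- (ip f f + 1) / (2 * ip f g)"] True by (simp add: field_simps)
    qed
    then show ?thesis using True by simp
  qed
  then have "\<bar>ip f g\<bar> \<le> sqrt (ip f f * ip g g)" by (simp add: real_le_rsqrt real_sqrt_abs[symmetric] del: real_sqrt_abs)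
  then show ?thesis by (simp add: nrm_def real_sqrt_mult)
qed

lemma ip_abs_le:
  assumes f: "smooth f" and g: "smooth g"
  shows "\<bar>ip f g\<bar> \<le> nrm f * nrm g"
proof -
  have "nrm (\<lambda>x. (-1) * f x) = nrm f"
    unfolding nrm_def ip_cmult ip_cmult_right by simp
  then have "- ip f g \<le> nrm f * nrm g"
    using ip_Cauchy_Schwarz[OF smooth_cmult[OF f, of "-1"] g] ip_cmult[of "-1" f g] by simp
  then show ?thesis using ip_Cauchy_Schwarz[OF f g] by linarith
qed

lemma nrm_triangle:
  assumes f: "smooth f" and g: "smooth g"
  shows "nrm (\<lambda>x. f x + g x) \<le> nrm f + nrm g"
proof (rule power2_le_imp_le)
  show "(nrm (\<lambda>x. f x + g x))\<^sup>2 \<le> (nrm f + nrm g)\<^sup>2"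
    using ip_add_add[OF f g] ip_Cauchy_Schwarz[OF f g] by (simp add: nrm_power2 power2_sum)
qed simp

lemma nrm_cmult: "nrm (\<lambda>x. c * f x) = \<bar>c\<bar> * nrm f"
  unfolding nrm_def ip_cmult ip_cmult_right
  by (simp add: real_sqrt_mult mult.assoc[symmetric])

lemma ip_angular: "smooth f \<Longrightarrow> smooth g \<Longrightarrow> ip (\<L> f) g = ip f (\<L> g)"
  unfolding ip_def by (rule angular_symmetric[OF radial_cutoff test_cutoff])

lemma ip_defect:
  assumes f: "smooth f" and g: "smooth g"
  shows "ip (\<A> f) g = ip f (\<A> g)"
proof -
  have "\<A> (\<lambda>x. \<rho> x * f x) x = \<rho> x * \<A> f x" for x by (rule defect_radial_mult[OF radial_cutoff])
  then show ?thesis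
    using integral_mult_defect[OF test_mult1[OF test_cutoff f] g] by (simp add: ip_def mult.assoc)
qed

text \<open>Reflections are isometries for the form, so Cauchy-Schwarz places
  \<open>ip f (r \<alpha>)\<close> between \<open>- ip f f\<close> and \<open>ip f f\<close>; each
  root then contributes between 0 and \<open>2 * k \<alpha>\<close> times
  \<open>ip f f\<close>.\<close>

lemma ip_defect_bounds:
  assumes f: "smooth f"
  shows "0 \<le> ip f (\<A> f)" "ip f (\<A> f) \<le> 2 * \<gamma> * ip f f"
proof -
  define r where "r \<alpha> x = f (reflection \<alpha> x)" for \<alpha> x
  have r: "smooth (r \<alpha>)" if "\<alpha> \<in> Rp" for \<alpha> unfolding r_def[abs_def] by (rule smooth_reflected[OF f that])
  have rr: "ip (r \<alpha>) (r \<alpha>) = ip f f" if \<alpha>: "\<alpha> \<in> Rp" for \<alpha>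
  proof -
    have "\<rho> (reflection \<alpha> x) = \<rho> x" for x
      by (rule radial_pairD(3)[OF radial_cutoff]) (simp add: \<alpha>)
    moreover have "(\<lambda>x. \<rho> x * (f x * f x)) \<in> borel_measurable borel"
      using f test_smooth[OF test_cutoff] by (intro smooth_borel_measurable smooth_mult)
    ultimately show ?thesis
      using integral_reflected[OF \<alpha>, of "\<lambda>x. \<rho> x * (f x * f x)"] by (simp add: ip_def r_def)
  qed
  have le: "\<bar>ip f (r \<alpha>)\<bar> \<le> ip f f" if "\<alpha> \<in> Rp" for \<alpha>
  proof -
    have "nrm (r \<alpha>) = nrm f" using rr[OF that] by (simp add: nrm_def)
    then show ?thesis using ip_abs_le[OF f r[OF that]] by (simp add: nrm_power2[symmetric] power2_eq_square)
  qed
  have "ip f (\<A> f) = ip f (\<lambda>x. \<Sum>\<alpha>\<in>Rp. k \<alpha> * (f x - r \<alpha> x))"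
    unfolding reflection_defect_def[abs_def] r_def by (rule refl)
  also have "\<dots> = (\<Sum>\<alpha>\<in>Rp. k \<alpha> * (ip f f - ip f (r \<alpha>)))"
    using f r by (simp add: ip_sum_right smooth_cmult smooth_diff ip_cmult_right ip_diff_right)
  finally have eq: "ip f (\<A> f) = (\<Sum>\<alpha>\<in>Rp. k \<alpha> * (ip f f - ip f (r \<alpha>)))" .
  show "0 \<le> ip f (\<A> f)"
    unfolding eq using le by (intro sum_nonneg mult_nonneg_nonneg) (auto simp: abs_le_iff)
  have "(\<Sum>\<alpha>\<in>Rp. k \<alpha> * (ip f f - ip f (r \<alpha>))) \<le> (\<Sum>\<alpha>\<in>Rp. k \<alpha> * (2 * ip f f))"
    using le by (intro sum_mono mult_left_mono) (force simp: abs_le_iff)+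
  also have "\<dots> = 2 * \<gamma> * ip f f"
    by (simp add: total_multiplicity_def sum_distrib_right sum_distrib_left mult_ac)
  finally show "ip f (\<A> f) \<le> 2 * \<gamma> * ip f f" unfolding eq .
qed

lemma eigen_orthogonal:
  assumes "smooth f" "smooth g" "\<And>x. \<L> f x = c * f x" "\<And>x. \<L> g x = d * g x" "c \<noteq> d"
  shows "ip f g = 0"
proof -
  have "\<L> f = (\<lambda>x. c * f x)" "\<L> g = (\<lambda>x. d * g x)" using assms by auto
  then have "c * ip f g = d * ip f g"
    using ip_angular[OF assms(1,2)] by (simp add: ip_cmult ip_cmult_right)
  then show ?thesis using assms(5) by simp
qed

end

context dunkl begin

lemma eigenvalue_inj:
  assumes "2 \<le> \<N>" "eigenvalue a = eigenvalue b" shows "a = b"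
proof -
  have "(real a - real b) * (real a + real b + \<N> - 2) = 0"
    using assms(2) by (simp add: eigenvalue_def algebra_simps)
  then show ?thesis using assms(1) by auto
qed

lemma eigenvalue_nonneg: "2 \<le> \<N> \<Longrightarrow> 0 \<le> eigenvalue a"
  by (simp add: eigenvalue_def)

lemma eigenvalue_ge:
  assumes "2 \<le> \<N>" "1 \<le> a" shows "\<N> - 1 \<le> eigenvalue a"
proof -
  have "1 * (1 + \<N> - 2) \<le> real a * (real a + \<N> - 2)"
    using assms by (intro mult_mono) auto
  then show ?thesis by (simp add: eigenvalue_def)
qed

end

section \<open>Quadratic forms of eigenfunction sums and the passage to smooth functions\<close>

context dunkl_cutoff
begin

context
  fixes p D f assumes decomposition: "eigen_decomposition p D f" and hom_dim_ge_2: "2 \<le> \<N>"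
begin

lemma decomposition_props:
  "smooth (f a)" "\<L> (f a) x = eigenvalue a * f a x" "\<A> (f 0) x = 0" "p = (\<lambda>x. \<Sum>a\<le>D. f a x)"
  using decomposition unfolding eigen_decomposition_def by auto

lemma ip_components: "ip (f a) (f b) = (if a = b then ip (f a) (f a) else 0)"
proof (cases "a = b")
  case False
  then have "eigenvalue a \<noteq> eigenvalue b" using eigenvalue_inj[OF hom_dim_ge_2] by blast
  then have "ip (f a) (f b) = 0"
    by (rule eigen_orthogonal[rotated -1]) (rule decomposition_props)+
  then show ?thesis using False by simp
qed simp

lemma ip_component_sums:
  assumes "S \<subseteq> {..D}" "S' \<subseteq> {..D}"
  shows "ip (\<lambda>x. \<Sum>a\<in>S. c a * f a x) (\<lambda>x. \<Sum>a\<in>S'. d a * f a x) = (\<Sum>a\<in>S \<inter> S'. c a * d a * ip (f a) (f a))"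
proof -
  have fin: "finite S" "finite S'" using assms finite_subset by auto
  have sm: "smooth (\<lambda>x. c * f a x)" "smooth (\<lambda>x. \<Sum>a\<in>S'. d a * f a x)" for a c
    by (intro smooth_cmult smooth_sum decomposition_props)+
  have "ip (\<lambda>x. \<Sum>a\<in>S. c a * f a x) (\<lambda>x. \<Sum>a\<in>S'. d a * f a x) = (\<Sum>a\<in>S. c a * ip (f a) (\<lambda>x. \<Sum>a\<in>S'. d a * f a x))"
    using fin sm by (simp add: ip_sum ip_cmult)
  also have "\<dots> = (\<Sum>a\<in>S. c a * (\<Sum>b\<in>S'. d b * ip (f a) (f b)))"
    using fin sm decomposition_props(1) by (simp add: ip_sum_right smooth_cmult ip_cmult_right)
  also have "\<dots> = (\<Sum>a\<in>S. c a * (\<Sum>b\<in>S'. if a = b then d a * ip (f a) (f a) else 0))"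
    by (intro sum.cong refl arg_cong2[where f = "(*)"]) (subst ip_components, simp)
  also have "\<dots> = (\<Sum>a\<in>S. if a \<in> S' then c a * d a * ip (f a) (f a) else 0)"
    using fin by (intro sum.cong) (auto simp: sum.delta')
  also have "\<dots> = (\<Sum>a\<in>S \<inter> S'. c a * d a * ip (f a) (f a))"
    using fin by (simp add: sum.inter_restrict)
  finally show ?thesis .
qed

lemma angular_decomposition: "\<L> p = (\<lambda>x. \<Sum>a\<le>D. eigenvalue a * f a x)"
  unfolding decomposition_props(4) by (simp add: angular_sum decomposition_props(1,2) fun_eq_iff)

lemma ip_decomposition:
  "ip p p = (\<Sum>a\<le>D. ip (f a) (f a))"
  "ip p (\<L> p) = (\<Sum>a\<le>D. eigenvalue a * ip (f a) (f a))"
  "ip (\<L> p) (\<L> p) = (\<Sum>a\<le>D. (eigenvalue a)\<^sup>2 * ip (f a) (f a))"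
  using ip_component_sums[of "{..D}" "{..D}" "\<lambda>a. 1" "\<lambda>a. 1"]
    ip_component_sums[of "{..D}" "{..D}" "\<lambda>a. 1" eigenvalue]
    ip_component_sums[of "{..D}" "{..D}" eigenvalue eigenvalue]
  unfolding angular_decomposition by (auto simp: decomposition_props(4)[symmetric] power2_eq_square)

text \<open>The sum starts at 1 because \<^term>\<open>\<A>\<close> annihilates the radial component \<^term>\<open>f 0\<close>.\<close>

lemma ip_defect_decomposition: "ip p (\<A> p) \<le> 2 * \<gamma> * (\<Sum>a\<in>{1..D}. ip (f a) (f a))"
proof -
  define q where "q x = (\<Sum>a\<in>{1..D}. 1 * f a x)" for x
  have q: "smooth q" unfolding q_def[abs_def] by (intro smooth_sum smooth_cmult decomposition_props)
  have p: "p = (\<lambda>x. f 0 x + q x)"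
  proof -
    have "{..D} = insert 0 {1..D}" by auto
    then show ?thesis unfolding decomposition_props(4) q_def by auto
  qed
  have sp: "smooth p" unfolding p by (intro smooth_add q decomposition_props)
  have Ap: "\<A> p = \<A> q" unfolding p by (auto simp: defect_add decomposition_props(3) fun_eq_iff)
  have "ip p (\<A> p) = ip (\<A> q) q"
    using ip_defect[OF sp q] by (simp add: Ap)
  also have "\<dots> \<le> 2 * \<gamma> * ip q q"
    using ip_defect_bounds(2)[OF q] by (simp add: ip_commute)
  also have "ip q q = (\<Sum>a\<in>{1..D}. ip (f a) (f a))"
    unfolding q_def[abs_def] by (subst ip_component_sums) auto
  finally show ?thesis .
qed

text \<open>The inverse of \<open>\<L> + 1\<close> on finite sums of eigenfunctions: component
  \<open>a\<close> is divided by \<open>eigenvalue a + 1\<close>, which is at least 1, so the norm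
  does not grow.\<close>

lemma eigen_sum_resolvent:
  "\<exists>q. eigen_sum q \<and> (\<forall>x. \<L> q x + q x = p x) \<and> ip q q \<le> ip p p"
proof -
  define c where "c a = 1 / (eigenvalue a + 1)" for a
  define q where "q x = (\<Sum>a\<le>D. c a * f a x)" for x
  have e: "0 \<le> eigenvalue a" for a by (rule eigenvalue_nonneg[OF hom_dim_ge_2])
  have c: "c a * eigenvalue a + c a = 1" "0 \<le> c a" "c a \<le> 1" for a
    using e[of a] by (auto simp: c_def field_simps)
  have "eigen_decomposition q D (\<lambda>a x. c a * f a x)"
    using decomposition unfolding eigen_decomposition_def
    by (auto simp: angular_cmult defect_cmult q_def intro: smooth_cmult)
  moreover have "\<L> q x + q x = p x" for x
  proof -
    have "\<L> q x + q x = (\<Sum>a\<le>D. (c a * eigenvalue a + c a) * f a x)"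
      unfolding q_def[abs_def]
      by (simp add: angular_sum angular_cmult smooth_cmult decomposition_props(1,2) sum.distrib[symmetric] algebra_simps)
    then show ?thesis by (simp add: c decomposition_props(4))
  qed
  moreover have "ip q q \<le> ip p p"
  proof -
    have "ip q q = (\<Sum>a\<le>D. c a * c a * ip (f a) (f a))"
      unfolding q_def[abs_def] by (subst ip_component_sums) auto
    also have "\<dots> \<le> (\<Sum>a\<le>D. 1 * 1 * ip (f a) (f a))"
      using c by (intro sum_mono mult_right_mono mult_mono ip_nonneg) auto
    finally show ?thesis by (simp add: ip_decomposition)
  qed
  ultimately show ?thesis unfolding eigen_sum_def by blast
qed

lemma eigen_sum_angular_nonneg: "0 \<le> ip p (\<L> p)"
  unfolding ip_decomposition by (intro sum_nonneg mult_nonneg_nonneg eigenvalue_nonneg hom_dim_ge_2 ip_nonneg)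

text \<open>After diagonalization only the inequality \<open>key\<close> for a single eigenvalue is
  left. The component \<open>a = 0\<close> may be added freely: its eigenvalue is 0, and the bound
  for \<open>\<A>\<close> does not involve it.\<close>

lemma eigen_sum_angular_defect:
  assumes "5 + 4 * \<gamma> \<le> \<N>"
  shows "0 \<le> ip (\<L> p) (\<L> p) + \<N> * (\<N> - 8) / 4 * ip p (\<L> p) - \<N>\<^sup>2 / 2 * ip p (\<A> p)"
proof -
  have N5: "5 \<le> \<N>" using assms total_multiplicity_nonneg by linarith
  have key: "\<N>\<^sup>2 * \<gamma> \<le> (eigenvalue a)\<^sup>2 + \<N> * (\<N> - 8) / 4 * eigenvalue a" if "1 \<le> a" for a
  proof -
    have ge: "\<N> - 1 \<le> eigenvalue a" using eigenvalue_ge[OF hom_dim_ge_2 that] .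
    have "\<N>\<^sup>2 * \<gamma> \<le> \<N>\<^sup>2 * ((\<N> - 5) / 4)" using assms by (intro mult_left_mono) auto
    \<comment> \<open>The hypothesis has replaced \<gamma> by \<open>(\<N> - 5) / 4\<close>. The
      right side is the quadratic at the lowest nonzero eigenvalue \<open>\<N> - 1\<close>, and it
      exceeds the left side by exactly 1.\<close>
    also have "\<dots> \<le> (\<N> - 1) * (\<N> - 1 + \<N> * (\<N> - 8) / 4)"
      by (simp add: field_simps power2_eq_square)
    also have "\<dots> \<le> eigenvalue a * (eigenvalue a + \<N> * (\<N> - 8) / 4)"
    proof (intro mult_mono add_right_mono ge)
      \<comment> \<open>Monotonicity of the product asks for the smaller second factor,
        \<open>(\<N> * (\<N> - 4) - 4) / 4\<close>, to be nonnegative, although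
        \<open>\<N> - 8\<close> may be negative.\<close>
      have "0 \<le> \<N> * (\<N> - 4) - 4" using mult_mono[of 5 \<N> 1 "\<N> - 4"] N5 by simp
      then show "0 \<le> \<N> - 1 + \<N> * (\<N> - 8) / 4" by (simp add: field_simps)
    qed (use ge N5 in auto)
    finally show ?thesis by (simp add: power2_eq_square algebra_simps)
  qed
  have "\<N>\<^sup>2 / 2 * ip p (\<A> p) \<le> \<N>\<^sup>2 / 2 * (2 * \<gamma> * (\<Sum>a\<in>{1..D}. ip (f a) (f a)))"
    by (intro mult_left_mono ip_defect_decomposition) auto
  also have "\<dots> = (\<Sum>a\<in>{1..D}. \<N>\<^sup>2 * \<gamma> * ip (f a) (f a))"
    by (simp add: sum_distrib_left mult.assoc)
  also have "\<dots> \<le> (\<Sum>a\<in>{1..D}. ((eigenvalue a)\<^sup>2 + \<N> * (\<N> - 8) / 4 * eigenvalue a) * ip (f a) (f a))"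
    by (intro sum_mono mult_right_mono key ip_nonneg) auto
  also have "\<dots> = (\<Sum>a\<le>D. ((eigenvalue a)\<^sup>2 + \<N> * (\<N> - 8) / 4 * eigenvalue a) * ip (f a) (f a))"
    by (intro sum.mono_neutral_left) (auto simp: eigenvalue_def not_less_eq_eq)
  also have "\<dots> = ip (\<L> p) (\<L> p) + \<N> * (\<N> - 8) / 4 * ip p (\<L> p)"
    unfolding ip_decomposition by (simp only: distrib_right sum.distrib sum_distrib_left mult.assoc)
  finally show ?thesis by simp
qed

end

text \<open>Stone-Weierstrass on a ball carrying \<open>\<rho>\<close>: uniform closeness there
  bounds the norm through the total mass of \<open>\<rho>\<close>.\<close>

lemma eigen_sum_dense:
  assumes g: "smooth g" and "0 < e"
  shows "\<exists>p. eigen_sum p \<and> nrm (\<lambda>x. g x - p x) \<le> e"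
proof -
  obtain K where K: "\<And>x. K < norm x \<Longrightarrow> \<rho> x = 0"
    using test_cutoff unfolding test_def by (metis bounded_supportE)
  have int: "integrable \<mu> \<rho>" using test_cutoff by (rule integrable_test)
  \<comment> \<open>Adding 1 to the mass permits division by \<open>sqrt C\<close>.\<close>
  define C where "C = (LINT x|\<mu>. \<rho> x) + 1"
  have "0 \<le> (LINT x|\<mu>. \<rho> x)" using cutoff_nonneg by (intro Bochner_Integration.integral_nonneg)
  then have C: "0 < C" by (simp add: C_def)
  define d where "d = e / sqrt C"
  have d: "0 < d" using C \<open>0 < e\<close> by (simp add: d_def)
  obtain p where p: "real_polynomial_function p" and close: "\<And>x. x \<in> cball 0 K \<Longrightarrow> \<bar>g x - p x\<bar> < d"
    using Stone_Weierstrass_real_polynomial_function[OF compact_cball smooth_continuous_on[OF g] d, of 0 K]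
    by auto
  have ep: "eigen_sum p" using p by (intro eigen_sum_polynomial real_polynomial_function_polynomial_map)
  have sp: "smooth (\<lambda>x. g x - p x)" using g eigen_sum_smooth[OF ep] by (rule smooth_diff)
  have "ip (\<lambda>x. g x - p x) (\<lambda>x. g x - p x) \<le> (LINT x|\<mu>. \<rho> x * d\<^sup>2)"
    unfolding ip_def
  proof (rule integral_mono)
    fix x
    show "\<rho> x * ((g x - p x) * (g x - p x)) \<le> \<rho> x * d\<^sup>2"
    proof (cases "norm x \<le> K")
      case True
      then have "\<bar>g x - p x\<bar> * \<bar>g x - p x\<bar> \<le> d * d"
        using close[of x] by (intro mult_mono) auto
      then show ?thesis using cutoff_nonneg by (intro mult_left_mono) (auto simp: power2_eq_square)
    qed (simp add: K)
  qed (use int sp in \<open>auto intro: integrable_ip\<close>)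
  also have "\<dots> \<le> d\<^sup>2 * C" by (simp add: C_def algebra_simps)
  also have "\<dots> = e\<^sup>2" using C by (simp add: d_def power_divide)
  finally have "nrm (\<lambda>x. g x - p x) \<le> sqrt (e\<^sup>2)" unfolding nrm_def by (rule real_sqrt_le_mono)
  then show ?thesis using ep \<open>0 < e\<close> by auto
qed

text \<open>A duality argument, because positivity of \<open>\<L>\<close> on all smooth functions is
  itself derived from this bound. Pair \<open>z\<close> with an approximating sum of eigenfunctions
  \<open>p = \<L> q + q\<close>: symmetry moves the operator onto \<open>z\<close>, the norm of
  \<open>q\<close> is at most that of \<open>p\<close>, and \<open>p\<close> tends to
  \<open>z\<close>.\<close>

lemma nrm_le_resolvent:
  assumes z: "smooth z" and N: "2 \<le> \<N>"
  shows "nrm z \<le> nrm (\<lambda>x. \<L> z x + z x)"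
proof -
  define e where "e = nrm (\<lambda>x. \<L> z x + z x)"
  have sLz: "smooth (\<L> z)" "smooth (\<lambda>x. \<L> z x + z x)" using z by auto
  have "nrm z * nrm z \<le> e * nrm z + \<eta> * (nrm z + e)" if \<eta>: "0 < \<eta>" for \<eta>
  proof -
    obtain p where p: "eigen_sum p" and close: "nrm (\<lambda>x. z x - p x) \<le> \<eta>"
      using eigen_sum_dense[OF z \<eta>] by blast
    obtain D f where "eigen_decomposition p D f" using p unfolding eigen_sum_def by blast
    then obtain q where q: "eigen_sum q" "\<And>x. \<L> q x + q x = p x" "ip q q \<le> ip p p"
      using eigen_sum_resolvent[OF _ N] by blast
    have sp: "smooth p" and sq: "smooth q" "smooth (\<L> q)" using p q eigen_sum_smooth by auto
    have szp: "smooth (\<lambda>x. z x - p x)" "smooth (\<lambda>x. p x - z x)" using z sp by auto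
    have "ip z p = ip p z" by (rule ip_commute)
    also have "\<dots> = ip (\<L> q) z + ip q z"
      using ip_add[OF sq(2,1) z] q(2) by (simp add: ip_def)
    also have "\<dots> = ip (\<lambda>x. \<L> z x + z x) q"
      using ip_add[OF sLz(1) z sq(1)] ip_angular[OF z sq(1)] by (simp add: ip_commute)
    also have "\<dots> \<le> e * nrm q" unfolding e_def by (rule ip_Cauchy_Schwarz[OF sLz(2) sq(1)])
    also have "\<dots> \<le> e * nrm p" using q(3) by (intro mult_left_mono) (simp_all add: e_def nrm_def ip_nonneg)
    also have "nrm p \<le> nrm z + nrm (\<lambda>x. p x - z x)"
      using nrm_triangle[OF z szp(2)] by simp
    also have "nrm (\<lambda>x. p x - z x) = nrm (\<lambda>x. z x - p x)"
      using nrm_cmult[of "-1" "\<lambda>x. z x - p x"] by simp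
    finally have 1: "ip z p \<le> e * (nrm z + \<eta>)"
      using close by (smt (verit) e_def nrm_nonneg mult_left_mono)
    have "ip (\<lambda>x. z x - p x) z \<le> \<eta> * nrm z"
      using ip_Cauchy_Schwarz[OF szp(1) z] close mult_right_mono[OF close nrm_nonneg[of z]] by linarith
    then have "ip z z \<le> \<eta> * nrm z + ip z p"
      using ip_diff[OF z sp z] by (simp add: ip_commute)
    with 1 show ?thesis
      using nrm_power2[of z] by (simp add: power2_eq_square algebra_simps)
  qed
  then have "nrm z * nrm z \<le> e * nrm z" by (rule le_if_all_pos_le_add_mult)
  then show ?thesis
    unfolding e_def[symmetric] using nrm_nonneg[of z] by (cases "nrm z = 0") (auto simp: e_def mult_le_cancel_right)
qed

text \<open>This amounts to the essential self-adjointness of \<^term>\<open>\<L>\<close>.\<close>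

lemma eigen_sum_graph_dense:
  assumes w: "smooth w" and "0 < e" and N: "2 \<le> \<N>"
  shows "\<exists>q. eigen_sum q \<and> nrm (\<lambda>x. w x - q x) \<le> e \<and> nrm (\<lambda>x. \<L> w x - \<L> q x) \<le> 2 * e"
proof -
  have sg: "smooth (\<lambda>x. \<L> w x + w x)" using w by auto
  obtain p where p: "eigen_sum p" and close: "nrm (\<lambda>x. \<L> w x + w x - p x) \<le> e"
    using eigen_sum_dense[OF sg \<open>0 < e\<close>] by blast
  obtain D f where "eigen_decomposition p D f" using p unfolding eigen_sum_def by blast
  then obtain q where q: "eigen_sum q" "\<And>x. \<L> q x + q x = p x"
    using eigen_sum_resolvent[OF _ N] by blast
  have sq: "smooth q" using q eigen_sum_smooth by auto
  \<comment> \<open>\<open>\<L> z + z\<close> equals \<open>\<L> w + w - p\<close> and is small by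
    the choice of \<open>p\<close>. Then \<open>nrm_le_resolvent\<close> makes \<open>z\<close>
    small, and the difference of the two makes \<open>\<L> z\<close> small, whence the factor
    2.\<close>
  define z where "z x = w x - q x" for x
  have sz: "smooth z" unfolding z_def[abs_def] using w sq by auto
  have Lz: "\<L> z x = \<L> w x - \<L> q x" for x unfolding z_def[abs_def] by (rule angular_diff[OF w sq])
  have "(\<lambda>x. \<L> z x + z x) = (\<lambda>x. \<L> w x + w x - p x)"
    using q(2) by (auto simp: Lz z_def fun_eq_iff algebra_simps) (metis add.commute)?
  then have res: "nrm (\<lambda>x. \<L> z x + z x) \<le> e" using close by simp
  then have z: "nrm z \<le> e" using nrm_le_resolvent[OF sz N] by linarith
  have "nrm (\<L> z) \<le> nrm (\<lambda>x. \<L> z x + z x) + nrm (\<lambda>x. (-1) * z x)"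
    using nrm_triangle[of "\<lambda>x. \<L> z x + z x" "\<lambda>x. (-1) * z x"] sz by (auto intro: smooth_minus)
  then have "nrm (\<L> z) \<le> 2 * e" using res z nrm_cmult[of "-1" z] by simp
  moreover have "\<L> z = (\<lambda>x. \<L> w x - \<L> q x)" using Lz by blast
  ultimately show ?thesis using q(1) z unfolding z_def[abs_def] by auto
qed

lemma eigen_sum_sequence:
  assumes w: "smooth w" and N: "2 \<le> \<N>"
  obtains q where "\<And>n. eigen_sum (q n)" "(\<lambda>n. nrm (\<lambda>x. w x - q n x)) \<longlonglongrightarrow> 0"
    "(\<lambda>n. nrm (\<lambda>x. \<L> w x - \<L> (q n) x)) \<longlonglongrightarrow> 0"
proof -
  have "\<exists>q. \<forall>n. eigen_sum (q n) \<and> nrm (\<lambda>x. w x - q n x) \<le> inverse (real (Suc n))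
      \<and> nrm (\<lambda>x. \<L> w x - \<L> (q n) x) \<le> 2 * inverse (real (Suc n))"
    by (intro choice allI eigen_sum_graph_dense[OF w _ N]) simp
  then obtain q where q: "\<And>n. eigen_sum (q n)" "\<And>n. nrm (\<lambda>x. w x - q n x) \<le> inverse (real (Suc n))"
      "\<And>n. nrm (\<lambda>x. \<L> w x - \<L> (q n) x) \<le> 2 * inverse (real (Suc n))" by blast
  have "(\<lambda>n. nrm (\<lambda>x. w x - q n x)) \<longlonglongrightarrow> 0"
    by (rule tendsto_sandwich[OF always_eventually always_eventually tendsto_const LIMSEQ_inverse_real_of_nat])
      (intro allI q nrm_nonneg)+
  moreover have "(\<lambda>n. 2 * inverse (real (Suc n))) \<longlonglongrightarrow> 0"
    using tendsto_mult_left[OF LIMSEQ_inverse_real_of_nat, of 2] by simp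
  then have "(\<lambda>n. nrm (\<lambda>x. \<L> w x - \<L> (q n) x)) \<longlonglongrightarrow> 0"
    by (rule tendsto_sandwich[OF always_eventually always_eventually tendsto_const, rotated -1])
      (intro allI q nrm_nonneg)+
  ultimately show ?thesis using that q(1) by blast
qed

lemma ip_tendsto:
  assumes f: "smooth f" "\<And>n. smooth (f' n)" "(\<lambda>n. nrm (\<lambda>x. f x - f' n x)) \<longlonglongrightarrow> 0"
    and g: "smooth g" "\<And>n. smooth (g' n)" "(\<lambda>n. nrm (\<lambda>x. g x - g' n x)) \<longlonglongrightarrow> 0"
  shows "(\<lambda>n. ip (f' n) (g' n)) \<longlonglongrightarrow> ip f g"
proof -
  have bound: "\<bar>ip (f' n) (g' n) - ip f g\<bar> \<le> nrm f * nrm (\<lambda>x. g x - g' n x) + nrm (\<lambda>x. f x - f' n x) * nrm g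
      + nrm (\<lambda>x. f x - f' n x) * nrm (\<lambda>x. g x - g' n x)" for n
  proof -
    have sm: "smooth (\<lambda>x. f x - f' n x)" "smooth (\<lambda>x. g x - g' n x)" using f g by auto
    have expand: "ip u (\<lambda>x. g x - g' n x) = ip u g - ip u (g' n)" if "smooth u" for u
      using g that by (simp add: ip_diff_right)
    have "ip (f' n) (g' n) - ip f g = ip (\<lambda>x. f x - f' n x) (\<lambda>x. g x - g' n x) - ip f (\<lambda>x. g x - g' n x) - ip (\<lambda>x. f x - f' n x) g"
      using f g by (simp add: expand ip_diff sm)
    moreover have "\<bar>ip (\<lambda>x. f x - f' n x) (\<lambda>x. g x - g' n x)\<bar> \<le> nrm (\<lambda>x. f x - f' n x) * nrm (\<lambda>x. g x - g' n x)"
      "\<bar>ip f (\<lambda>x. g x - g' n x)\<bar> \<le> nrm f * nrm (\<lambda>x. g x - g' n x)" "\<bar>ip (\<lambda>x. f x - f' n x) g\<bar> \<le> nrm (\<lambda>x. f x - f' n x) * nrm g"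
      by (intro ip_abs_le sm f g)+
    ultimately show ?thesis by linarith
  qed
  have "(\<lambda>n. nrm f * nrm (\<lambda>x. g x - g' n x) + nrm (\<lambda>x. f x - f' n x) * nrm g
      + nrm (\<lambda>x. f x - f' n x) * nrm (\<lambda>x. g x - g' n x)) \<longlonglongrightarrow> nrm f * 0 + 0 * nrm g + 0 * 0"
    by (intro tendsto_intros f g)
  then have lim: "(\<lambda>n. nrm f * nrm (\<lambda>x. g x - g' n x) + nrm (\<lambda>x. f x - f' n x) * nrm g
      + nrm (\<lambda>x. f x - f' n x) * nrm (\<lambda>x. g x - g' n x)) \<longlonglongrightarrow> 0" by simp
  have "(\<lambda>n. ip (f' n) (g' n) - ip f g) \<longlonglongrightarrow> 0"
    by (rule Lim_null_comparison[OF _ lim]) (simp add: bound)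
  then show ?thesis by (simp add: LIM_zero_iff)
qed

lemma ip_angular_nonneg:
  assumes w: "smooth w" and N: "2 \<le> \<N>"
  shows "0 \<le> ip w (\<L> w)"
proof -
  obtain q where q: "\<And>n. eigen_sum (q n)" "(\<lambda>n. nrm (\<lambda>x. w x - q n x)) \<longlonglongrightarrow> 0"
    "(\<lambda>n. nrm (\<lambda>x. \<L> w x - \<L> (q n) x)) \<longlonglongrightarrow> 0"
    using eigen_sum_sequence[OF w N] by blast
  have "0 \<le> ip (q n) (\<L> (q n))" for n
    using q(1)[of n] eigen_sum_angular_nonneg[OF _ N] unfolding eigen_sum_def by blast
  moreover have "(\<lambda>n. ip (q n) (\<L> (q n))) \<longlonglongrightarrow> ip w (\<L> w)"
    by (intro ip_tendsto smooth_angular w eigen_sum_smooth q)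
  ultimately show ?thesis by (intro LIMSEQ_le_const) auto
qed

text \<open>The form of \<open>\<A>\<close> enters with a negative sign, so a lower bound for it at
  \<open>q n\<close> suffices. Positivity at \<open>w - q n\<close> supplies
  \<open>2 * ip (q n) (\<A> w) - ip w (\<A> w)\<close>, where \<open>\<A>\<close> acts only on the
  fixed \<open>w\<close>; this passes to the limit without convergence of
  \<open>\<A> (q n)\<close>.\<close>

lemma ip_angular_defect:
  assumes w: "smooth w" and N: "5 + 4 * \<gamma> \<le> \<N>"
  shows "0 \<le> ip (\<L> w) (\<L> w) + \<N> * (\<N> - 8) / 4 * ip w (\<L> w) - \<N>\<^sup>2 / 2 * ip w (\<A> w)"
proof -
  have N2: "2 \<le> \<N>" using N total_multiplicity_nonneg by linarith
  obtain q where q: "\<And>n. eigen_sum (q n)" "(\<lambda>n. nrm (\<lambda>x. w x - q n x)) \<longlonglongrightarrow> 0"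
    "(\<lambda>n. nrm (\<lambda>x. \<L> w x - \<L> (q n) x)) \<longlonglongrightarrow> 0"
    using eigen_sum_sequence[OF w N2] by blast
  have sq: "smooth (q n)" for n using q(1) by (rule eigen_sum_smooth)
  have sA: "smooth (\<A> w)" using w by auto
  have "0 \<le> ip (\<L> (q n)) (\<L> (q n)) + \<N> * (\<N> - 8) / 4 * ip (q n) (\<L> (q n))
      - \<N>\<^sup>2 / 2 * (2 * ip (q n) (\<A> w) - ip w (\<A> w))" for n
  proof -
    have sz: "smooth (\<lambda>x. w x - q n x)" using w sq by auto
    have "\<A> (\<lambda>x. w x - q n x) = (\<lambda>x. \<A> w x - \<A> (q n) x)"
      using defect_add[of w "\<lambda>x. (-1) * q n x"] defect_cmult[of "-1" "q n"] by (auto simp: fun_eq_iff)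
    moreover have "smooth (\<A> (q n))" using sq by auto
    ultimately have "ip (\<lambda>x. w x - q n x) (\<A> (\<lambda>x. w x - q n x)) = ip w (\<A> w) - ip w (\<A> (q n)) - (ip (q n) (\<A> w) - ip (q n) (\<A> (q n)))"
      using w sq sA by (simp add: ip_diff ip_diff_right smooth_diff)
    also have "ip w (\<A> (q n)) = ip (q n) (\<A> w)"
      using ip_defect[OF w sq] by (simp add: ip_commute)
    finally have "2 * ip (q n) (\<A> w) - ip w (\<A> w) \<le> ip (q n) (\<A> (q n))"
      using ip_defect_bounds(1)[OF sz] by simp
    then have "\<N>\<^sup>2 / 2 * (2 * ip (q n) (\<A> w) - ip w (\<A> w)) \<le> \<N>\<^sup>2 / 2 * ip (q n) (\<A> (q n))"
      by (intro mult_left_mono) auto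
    moreover obtain D f where "eigen_decomposition (q n) D f" using q(1) unfolding eigen_sum_def by blast
    from eigen_sum_angular_defect[OF this N2 N]
    have "0 \<le> ip (\<L> (q n)) (\<L> (q n)) + \<N> * (\<N> - 8) / 4 * ip (q n) (\<L> (q n)) - \<N>\<^sup>2 / 2 * ip (q n) (\<A> (q n))" .
    ultimately show ?thesis by linarith
  qed
  moreover have "(\<lambda>n. ip (\<L> (q n)) (\<L> (q n)) + \<N> * (\<N> - 8) / 4 * ip (q n) (\<L> (q n))
      - \<N>\<^sup>2 / 2 * (2 * ip (q n) (\<A> w) - ip w (\<A> w))) \<longlonglongrightarrow>
      ip (\<L> w) (\<L> w) + \<N> * (\<N> - 8) / 4 * ip w (\<L> w) - \<N>\<^sup>2 / 2 * (2 * ip w (\<A> w) - ip w (\<A> w))"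
    using q(2,3) w sq sA by (intro tendsto_intros ip_tendsto smooth_angular) (auto simp: nrm_def)
  ultimately show ?thesis by (intro LIMSEQ_le_const) (auto simp: algebra_simps)
qed

end

section \<open>Functions divisible by the squared radius\<close>

text \<open>With \<open>y = 1 / t\<close> and \<open>P'\<close> the derivative of \<open>P\<close>,
  the derivative of \<open>P y * exp (- y)\<close> with respect to \<open>t\<close> is
  \<open>y\<^sup>2 * (P y - P' y) * exp (- y)\<close>; the factor \<open>[:0, 0, 1:]\<close> is this
  \<open>y\<^sup>2\<close>.\<close>

primrec flat_poly :: "nat \<Rightarrow> real poly" where
  "flat_poly 0 = 1"
| "flat_poly (Suc n) = [:0, 0, 1:] * (flat_poly n - pderiv (flat_poly n))"

text \<open>The \<open>n\<close>-th derivative of the function \<open>exp (- 1 / t)\<close>, extended by 0 to \<open>t \<le> 0\<close>.\<close>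

definition flat :: "nat \<Rightarrow> real \<Rightarrow> real" where
  "flat n t = (if t \<le> 0 then 0 else poly (flat_poly n) (inverse t) * exp (- inverse t))"

lemma tendsto_poly_mult_exp: "((\<lambda>y::real. poly q y * exp (- y)) \<longlongrightarrow> 0) at_top"
proof -
  have "((\<lambda>y::real. \<Sum>i\<le>degree q. coeff q i * (y ^ i / exp y)) \<longlongrightarrow> (\<Sum>i\<le>degree q. coeff q i * 0)) at_top"
    by (intro tendsto_sum tendsto_mult tendsto_const tendsto_power_div_exp_0)
  then show ?thesis
    by (simp add: poly_altdef sum_distrib_right exp_minus divide_inverse mult.assoc)
qed

lemma flat_has_derivative: "(flat n has_real_derivative flat (Suc n) t) (at t)"
proof -
  consider "t < 0" | "t > 0" | "t = 0" by linarith
  then show ?thesis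
  proof cases
    case 1
    have "((\<lambda>t. 0) has_real_derivative 0) (at t)" by simp
    then have "(flat n has_real_derivative 0) (at t)"
      by (rule has_field_derivative_transform_within_open[of _ _ _ "{..<0}"]) (use 1 in \<open>auto simp: flat_def\<close>)
    then show ?thesis using 1 by (simp add: flat_def)
  next
    case 2
    have "((\<lambda>t. poly (flat_poly n) (inverse t) * exp (- inverse t)) has_real_derivative flat (Suc n) t) (at t)"
      using 2 by (auto intro!: derivative_eq_intros DERIV_chain2[OF poly_DERIV]
          simp: flat_def power2_eq_square divide_simps) (simp add: algebra_simps)
    then show ?thesis
      by (rule has_field_derivative_transform_within_open[of _ _ _ "{0<..}"]) (use 2 in \<open>auto simp: flat_def\<close>)
  next
    case 3
    have "((\<lambda>h. flat n h / h) \<longlongrightarrow> 0) (at_left 0)"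
      by (rule tendsto_eventually) (auto simp: eventually_at_left_field flat_def intro!: exI[of _ "-1"])
    moreover have "((\<lambda>h. flat n h / h) \<longlongrightarrow> 0) (at_right 0)"
    proof -
      \<comment> \<open>To the right of the origin the difference quotient is \<open>y\<close> times
        the polynomial times \<open>exp (- y)\<close>, with \<open>y = 1 / h\<close> tending to
        infinity; \<open>[:0, 1:]\<close> is this extra \<open>y\<close>.\<close>
      have "((\<lambda>h. poly ([:0, 1:] * flat_poly n) (inverse h) * exp (- inverse h)) \<longlongrightarrow> 0) (at_right 0)"
        by (rule filterlim_compose[OF tendsto_poly_mult_exp filterlim_inverse_at_top_right])
      moreover have "eventually (\<lambda>h. poly ([:0, 1:] * flat_poly n) (inverse h) * exp (- inverse h) = flat n h / h) (at_right 0)"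
        unfolding eventually_at_right_field by (rule exI[of _ 1]) (simp add: flat_def divide_inverse)
      ultimately show ?thesis by (rule Lim_transform_eventually)
    qed
    ultimately have "((\<lambda>h. flat n h / h) \<longlongrightarrow> 0) (at 0)"
      by (simp add: filterlim_split_at)
    then show ?thesis unfolding 3 DERIV_def by (simp add: flat_def)
  qed
qed

lemma flat_nonpos: "t \<le> 0 \<Longrightarrow> flat 0 t = 0"
  and flat_pos: "0 < t \<Longrightarrow> 0 < flat 0 t"
  by (simp_all add: flat_def)

lemma flat_nonneg: "0 \<le> flat 0 t"
  by (simp add: flat_def)

lemma flat_mono: "s \<le> t \<Longrightarrow> flat 0 s \<le> flat 0 t"
  by (auto simp: flat_def le_imp_inverse_le)

lemma flat_derivative_nonneg: "0 \<le> flat 1 t"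
  by (simp add: flat_def)

lemma radial_pair_compose_real:
  fixes G :: "nat \<Rightarrow> real \<Rightarrow> real"
  assumes \<phi>: "radial_pair \<phi> \<phi>'" and G: "\<And>n t. t \<in> range \<phi> \<Longrightarrow> (G n has_real_derivative G (Suc n) t) (at t)"
  shows "radial_pair (\<lambda>x. G 0 (\<phi> x)) (\<lambda>x. G 1 (\<phi> x) * \<phi>' x)"
proof -
  have sm: "smooth (\<lambda>x. G 0 (\<phi> x))" "smooth (\<lambda>x. G 1 (\<phi> x))"
    using smooth_compose_real[of \<phi> G] smooth_compose_real[of \<phi> "\<lambda>n. G (Suc n)"] G radial_pairD(1)[OF \<phi>] by auto
  have pd: "partial_derivative i (\<lambda>x. G 0 (\<phi> x)) x = x $ i * (G 1 (\<phi> x) * \<phi>' x)" for i x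
    by (simp add: partial_derivative_compose_real(1)[OF smooth_differentiable[OF radial_pairD(1)[OF \<phi>]] G]
        radial_pairD(5)[OF \<phi>])
  show ?thesis
    unfolding radial_pair_def
  proof (intro conjI allI impI)
    fix x y :: "real^'a" assume eq: "norm x = norm y"
    show "G 0 (\<phi> x) = G 0 (\<phi> y)" unfolding radial_pairD(3)[OF \<phi> eq] ..
    show "G 1 (\<phi> x) * \<phi>' x = G 1 (\<phi> y) * \<phi>' y" unfolding radial_pairD(3,4)[OF \<phi> eq] ..
  qed (intro sm pd smooth_mult radial_pairD(2)[OF \<phi>])+
qed

lemma radial_pair_diff:
  "radial_pair \<phi> \<phi>' \<Longrightarrow> radial_pair \<psi> \<psi>' \<Longrightarrow> radial_pair (\<lambda>x. \<phi> x - \<psi> x) (\<lambda>x. \<phi>' x - \<psi>' x)"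
  unfolding radial_pair_def[of "\<lambda>x. \<phi> x - \<psi> x"]
  by (intro conjI allI impI)
    (auto simp: partial_derivative_diff smooth_differentiable radial_pairD(1,2,5) right_diff_distrib
      intro!: smooth_diff arg_cong2[where f = "(-)"] dest: radial_pairD(3,4))

text \<open>A decreasing radial bump function that is constant on the ball of radius \<open>K\<close>.\<close>

definition bump :: "real \<Rightarrow> real^'n \<Rightarrow> real" where
  "bump K x = flat 0 (flat 0 1 - flat 0 ((x \<bullet> x) / K\<^sup>2 - 1))"

text \<open>Two successive radial derivatives are provided because \<open>angular_radial\<close>
  consumes two; the sign of the first is used for the lower bound in the sharpness proof.\<close>

lemma bump_radial_pair:
  assumes "0 < K"
  obtains \<phi>' \<phi>'' where "radial_pair (bump K :: real^'n \<Rightarrow> real) \<phi>'" "radial_pair \<phi>' \<phi>''" "\<And>x. \<phi>' x \<le> 0"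
proof -
  define u where "u x = (1 / K\<^sup>2) * (x \<bullet> x) - 1" for x :: "real^'n"
  have u: "radial_pair u (\<lambda>x. (1 / K\<^sup>2) * 2 - 0)"
    unfolding u_def[abs_def] by (intro radial_pair_diff radial_pair_cmult radial_pair_inner_self radial_pair_const)
  have flat: "radial_pair (\<lambda>x. flat n (\<phi> x)) (\<lambda>x. flat (Suc n) (\<phi> x) * \<phi>' x)"
    if "radial_pair \<phi> \<phi>'" for n \<phi> and \<phi>' :: "real^'n \<Rightarrow> real"
    using radial_pair_compose_real[OF that, of "\<lambda>m. flat (m + n)"] flat_has_derivative by simp
  define w where "w x = flat 0 1 - flat 0 (u x)" for x
  have w: "radial_pair w (\<lambda>x. 0 - flat (Suc 0) (u x) * ((1 / K\<^sup>2) * 2 - 0))"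
    unfolding w_def[abs_def] by (intro radial_pair_diff radial_pair_const flat u)
  have eq: "bump K = (\<lambda>x. flat 0 (w x))"
    by (auto simp: bump_def w_def u_def)
  have pair: "radial_pair (bump K) (\<lambda>x. flat (Suc 0) (w x) * (0 - flat (Suc 0) (u x) * ((1 / K\<^sup>2) * 2 - 0)))"
    unfolding eq by (rule flat[OF w])
  have pair': "\<exists>\<phi>''. radial_pair (\<lambda>x. flat (Suc 0) (w x) * (0 - flat (Suc 0) (u x) * ((1 / K\<^sup>2) * 2 - 0))) \<phi>''"
    by (rule exI) (rule radial_pair_mult[OF flat[OF w]
      radial_pair_diff[OF radial_pair_const radial_pair_mult[OF flat[OF u] radial_pair_const]]])
  have "flat (Suc 0) (w x) * (0 - flat (Suc 0) (u x) * ((1 / K\<^sup>2) * 2 - 0)) \<le> 0" for x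
    using flat_derivative_nonneg by (intro mult_nonneg_nonpos) auto
  with pair pair' show ?thesis using that by blast
qed

lemma bump_nonneg: "0 \<le> bump K x"
  by (simp add: bump_def flat_nonneg)

lemma bump_constant:
  assumes "0 < K" "norm x \<le> K" shows "bump K x = flat 0 (flat 0 1)"
proof -
  have "(x \<bullet> x) / K\<^sup>2 \<le> 1" using assms by (simp add: dot_square_norm power_mono)
  then show ?thesis by (simp add: bump_def flat_nonpos)
qed

lemma bump_constant_pos: "0 < flat 0 (flat 0 1)"
  by (intro flat_pos) simp

lemma bump_zero:
  assumes "0 < K" "2 * K \<le> norm x" shows "bump K x = 0"
proof -
  have "(2 * K)\<^sup>2 \<le> (norm x)\<^sup>2" using assms by (intro power_mono) auto
  then have "4 * K\<^sup>2 \<le> x \<bullet> x" by (simp add: dot_square_norm power_mult_distrib)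
  then have "4 \<le> (x \<bullet> x) / K\<^sup>2" using assms by (simp add: pos_le_divide_eq)
  then have "1 \<le> (x \<bullet> x) / K\<^sup>2 - 1" by simp
  then have "flat 0 1 \<le> flat 0 ((x \<bullet> x) / K\<^sup>2 - 1)" by (rule flat_mono)
  then show ?thesis by (simp add: bump_def flat_nonpos)
qed

lemma test_bump:
  assumes "0 < K" shows "test (bump K :: real^'n \<Rightarrow> real)"
proof -
  have "smooth (bump K :: real^'n \<Rightarrow> real)"
    using bump_radial_pair[OF assms] radial_pairD(1) by metis
  moreover have "bounded_support (bump K :: real^'n \<Rightarrow> real)"
    by (rule bounded_supportI[of "2 * K"]) (simp add: bump_zero[OF assms])
  ultimately show ?thesis by (simp add: test_def)
qed

lemma euler_bump_zero:
  fixes x :: "real^'n"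
  assumes "0 < K" "norm x < K" shows "euler (bump K) x = 0"
proof -
  have "(bump K has_derivative (\<lambda>h. 0)) (at x)"
    by (rule has_derivative_transform_within_open[OF has_derivative_const[of "flat 0 (flat 0 1)"] open_ball[of 0 K]])
      (use assms in \<open>auto simp: bump_constant\<close>)
  then show ?thesis by (simp add: euler_def partial_derivative_eq)
qed

section \<open>Quadratic identities for functions of the form |x|^2 v\<close>

context dunkl
begin

definition shifted_euler :: "(real^'n \<Rightarrow> real) \<Rightarrow> real^'n \<Rightarrow> real" ("\<F>") where
  "\<F> u x = euler u x + \<N> / 2 * u x"

lemma test_shifted_euler: "test u \<Longrightarrow> test (\<F> u)"
  unfolding shifted_euler_def[abs_def] by (intro test_add test_cmult test_euler)

lemma integral_shifted_euler:
  assumes f: "test f" and g: "test g"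
  shows "(LINT x|\<mu>. \<F> f x * g x) = - (LINT x|\<mu>. f x * \<F> g x)"
proof -
  have fg: "test (\<lambda>x. f x * g x)" "test (\<lambda>x. \<F> f x * g x)" "test (\<lambda>x. f x * \<F> g x)"
    using f g test_shifted_euler test_smooth by (auto intro!: test_mult1)
  have "(LINT x|\<mu>. euler (\<lambda>x. f x * g x) x + \<N> * (f x * g x)) = 0"
    using fg by (simp add: integrable_test test_euler integral_euler)
  moreover have "euler (\<lambda>x. f x * g x) x + \<N> * (f x * g x) = \<F> f x * g x + f x * \<F> g x" for x
    using f g by (simp add: euler_mult test_smooth shifted_euler_def algebra_simps)
  ultimately have "(LINT x|\<mu>. \<F> f x * g x + f x * \<F> g x) = 0" by simp
  then show ?thesis using fg by (simp add: integrable_test)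
qed

lemma cutoff_bump:
  assumes "0 < K"
  obtains \<rho>' where "dunkl_cutoff R Rp k (bump K) \<rho>'"
proof -
  obtain \<rho>' where \<rho>': "radial_pair (bump K :: real^'n \<Rightarrow> real) \<rho>'"
    using bump_radial_pair[OF assms] by metis
  have "dunkl_cutoff R Rp k (bump K) \<rho>'"
    by unfold_locales (use \<rho>' test_bump[OF assms] bump_nonneg in auto)
  then show ?thesis by (rule that)
qed

text \<open>Transfers results from the cut-off forms \<open>ip\<close> to the measure itself: on the
  ball carrying \<open>f\<close> the bump is a positive constant, which can be divided out.\<close>

lemma integral_bump_mult:
  assumes "0 < K" "\<And>x. K < norm x \<Longrightarrow> f x = 0"
  shows "(LINT x|\<mu>. bump K x * f x) = flat 0 (flat 0 1) * (LINT x|\<mu>. f x)"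
proof -
  have "bump K x * f x = flat 0 (flat 0 1) * f x" for x
    using bump_constant[OF assms(1), of x] assms(2)[of x] by (cases "norm x \<le> K") auto
  then have "(LINT x|\<mu>. bump K x * f x) = (LINT x|\<mu>. flat 0 (flat 0 1) * f x)"
    by (intro Bochner_Integration.integral_cong refl)
  then show ?thesis by simp
qed

lemma common_support:
  fixes f g :: "real^'n \<Rightarrow> real"
  assumes "test f" "test g"
  obtains K where "0 < K" "\<And>x. K < norm x \<Longrightarrow> f x = 0" "\<And>x. K < norm x \<Longrightarrow> g x = 0"
proof -
  obtain K where K: "0 < K" "\<And>x. K < norm x \<Longrightarrow> f x = 0"
    using assms(1) unfolding test_def by (metis bounded_supportE)
  obtain L where L: "0 < L" "\<And>x. L < norm x \<Longrightarrow> g x = 0"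
    using assms(2) unfolding test_def by (metis bounded_supportE)
  show ?thesis by (rule that[of "max K L"]) (use K L in auto)
qed

lemma angular_shifted_euler:
  assumes "smooth u" shows "\<L> (\<F> u) x = \<F> (\<L> u) x"
proof -
  have "\<L> (\<F> u) x = \<L> (euler u) x + \<L> (\<lambda>x. \<N> / 2 * u x) x"
    unfolding shifted_euler_def[abs_def] by (intro angular_add smooth_euler smooth_cmult assms)
  also have "\<dots> = euler (\<L> u) x + \<N> / 2 * \<L> u x"
    by (simp only: angular_euler[OF assms] angular_cmult[OF assms])
  finally show ?thesis by (simp only: shifted_euler_def)
qed

lemma integral_angular:
  assumes f: "test f" and g: "test g"
  shows "(LINT x|\<mu>. \<L> f x * g x) = (LINT x|\<mu>. f x * \<L> g x)"
proof -
  obtain K where K: "0 < K" "\<And>x. K < norm x \<Longrightarrow> f x = 0" "\<And>x. K < norm x \<Longrightarrow> g x = 0"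
    using common_support[OF f g] by blast
  obtain \<rho>' where "dunkl_cutoff R Rp k (bump K) \<rho>'" by (rule cutoff_bump[OF K(1)])
  then interpret dunkl_cutoff R Rp k "bump K" \<rho>' .
  show ?thesis
    using ip_angular[OF test_smooth[OF f] test_smooth[OF g]] bump_constant_pos
    unfolding ip_def by (simp add: integral_bump_mult[OF K(1)] K)
qed

lemma shifted_euler_twice:
  assumes v: "smooth v"
  shows "\<F> (\<F> v) x = euler (euler v) x + \<N> * euler v x + (\<N> / 2)\<^sup>2 * v x"
proof -
  have "\<F> (\<F> v) x = euler (euler v) x + \<N> / 2 * euler v x + \<N> / 2 * (euler v x + \<N> / 2 * v x)"
    unfolding shifted_euler_def[abs_def] using v
    by (subst euler_add) (auto intro: smooth_euler smooth_cmult simp: euler_cmult simp del: times_divide_eq_left)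
  then show ?thesis by (simp add: power2_eq_square field_simps)
qed

text \<open>The left side is \<open>(E + 2) (E + \<N>) v - \<L> v\<close> with \<open>E\<close> the
  Euler operator; substituting \<open>E = \<F> - \<N> / 2\<close> gives the polynomial in
  \<open>\<F>\<close>.\<close>

lemma Lap_inner_self_mult:
  assumes v: "smooth v"
  shows "\<Delta> (\<lambda>x. (x \<bullet> x) * v x) x = \<F> (\<F> v) x + 2 * \<F> v x - \<N> * (\<N> - 4) / 4 * v x - \<L> v x"
proof -
  have "\<F> (\<F> v) x = euler (euler v) x + \<N> * euler v x + (\<N> / 2)\<^sup>2 * v x"
    by (rule shifted_euler_twice[OF v])
  then show ?thesis
    unfolding Lap_radial_mult[OF radial_pair_inner_self radial_pair_const v] shifted_euler_def angular_def
    by (simp add: field_simps power2_eq_square)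
qed

text \<open>The square of \<open>Lap_inner_self_mult\<close> is expanded. Since \<open>\<F>\<close>
  is skew and commutes with the symmetric \<open>\<L>\<close>, the pairings of \<open>\<F> v\<close>
  with \<open>v\<close>, \<open>\<L> v\<close> and \<open>\<F> (\<F> v)\<close> vanish, while those
  of \<open>\<F> (\<F> v)\<close> with \<open>v\<close> and \<open>\<L> v\<close> turn into minus
  the pairings of \<open>\<F> v\<close> with \<open>\<F> v\<close> and
  \<open>\<L> (\<F> v)\<close>.\<close>

lemma integral_Lap_inner_self_mult:
  assumes v: "test v"
  shows "(LINT x|\<mu>. (\<Delta> (\<lambda>x. (x \<bullet> x) * v x) x)\<^sup>2) = (LINT x|\<mu>. \<F> (\<F> v) x * \<F> (\<F> v) x)
     + (4 + 2 * (\<N> * (\<N> - 4) / 4)) * (LINT x|\<mu>. \<F> v x * \<F> v x) + (\<N> * (\<N> - 4) / 4)\<^sup>2 * (LINT x|\<mu>. v x * v x)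
     + 2 * (LINT x|\<mu>. \<F> v x * \<L> (\<F> v) x) + 2 * (\<N> * (\<N> - 4) / 4) * (LINT x|\<mu>. v x * \<L> v x) + (LINT x|\<mu>. \<L> v x * \<L> v x)"
proof -
  define a where "a = \<N> * (\<N> - 4) / 4"
  define J where "J f g = (LINT x|\<mu>. f x * g x)" for f g :: "real^'n \<Rightarrow> real"
  define X Y W where "X = \<F> (\<F> v)" and "Y = \<F> v" and "W = \<L> v"
  have tests: "test X" "test Y" "test W" "test v" "test (\<L> Y)"
    unfolding X_def Y_def W_def by (intro test_shifted_euler test_angular v)+
  have int: "integrable \<mu> (\<lambda>x. f x * g x)" if "test f" "test g" for f g
    using that by (intro integrable_test test_mult1 test_smooth)
  have comm: "J f g = J g f" for f g by (simp add: J_def mult.commute)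
  have skew: "J (\<F> f) g = - J f (\<F> g)" if "test f" "test g" for f g
    unfolding J_def by (rule integral_shifted_euler[OF that])
  have skew0: "J (\<F> f) f = 0" if "test f" for f
    using skew[OF that that] comm[of "\<F> f" f] by simp
  have FW: "\<F> W = \<L> Y"
    unfolding W_def Y_def using angular_shifted_euler[OF test_smooth[OF v]] by auto
  have XY: "J X Y = 0" and Yv: "J Y v = 0"
    unfolding X_def Y_def by (intro skew0 test_shifted_euler v)+
  have Xv: "J X v = - J Y Y"
    using skew[of Y v] tests by (simp add: X_def Y_def)
  have XW: "J X W = - J Y (\<L> Y)"
    using skew[of Y W] tests FW by (simp add: X_def Y_def)
  have YW: "J Y W = 0"
  proof -
    have "J Y W = - J v (\<L> Y)" using skew[of v W] tests FW by (simp add: Y_def)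
    also have "J v (\<L> Y) = J W Y"
      unfolding J_def W_def by (rule integral_angular[symmetric]) (use tests in auto)
    finally show ?thesis using comm[of Y W] by simp
  qed
  have "(\<Delta> (\<lambda>x. (x \<bullet> x) * v x) x)\<^sup>2 = X x * X x + 4 * (Y x * Y x) + a\<^sup>2 * (v x * v x) + W x * W x
     + 4 * (X x * Y x) - 2 * a * (X x * v x) - 2 * (X x * W x) - 4 * a * (Y x * v x) - 4 * (Y x * W x) + 2 * a * (v x * W x)" for x
    unfolding Lap_inner_self_mult[OF test_smooth[OF v]] X_def[symmetric] Y_def[symmetric] W_def[symmetric] a_def[symmetric]
    by (simp only: power2_eq_square algebra_simps) (simp add: Y_def X_def)
  then have "(LINT x|\<mu>. (\<Delta> (\<lambda>x. (x \<bullet> x) * v x) x)\<^sup>2) = J X X + 4 * J Y Y + a\<^sup>2 * J v v + J W W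
     + 4 * J X Y - 2 * a * J X v - 2 * J X W - 4 * a * J Y v - 4 * J Y W + 2 * a * J v W"
    using tests by (simp add: int J_def)
  also have "\<dots> = J X X + (4 + 2 * a) * J Y Y + a\<^sup>2 * J v v + 2 * J Y (\<L> Y) + 2 * a * J v W + J W W"
    unfolding XY Yv Xv XW YW by (simp add: algebra_simps)
  finally show ?thesis unfolding J_def X_def Y_def W_def a_def .
qed

lemma AE_not_zero: "AE x in \<mu>. x \<noteq> 0"
  unfolding dunkl_measure_def by (subst AE_density) (auto intro: eventually_mono[OF AE_lborel_singleton])

lemma T_inner_self_mult: "smooth v \<Longrightarrow> T i (\<lambda>x. (x \<bullet> x) * v x) x = (x \<bullet> x) * T i v x + 2 * (x $ i * v x)"
  using T_radial_mult[OF radial_pair_inner_self] by simp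

lemma norm_gradient_power2: "(norm (dunkl_gradient Rp k u x))\<^sup>2 = (\<Sum>i\<in>UNIV. (T i u x)\<^sup>2)"
  unfolding power2_norm_eq_inner inner_vec_def dunkl_gradient_def by (simp add: power2_eq_square)

lemma gradient_quotient_measurable:
  assumes "smooth u"
  shows "(\<lambda>x. (norm (dunkl_gradient Rp k u x))\<^sup>2 / (norm x)\<^sup>2) \<in> borel_measurable borel"
proof -
  have [measurable]: "T i u \<in> borel_measurable borel" for i
    using smooth_T[OF assms] by (rule smooth_borel_measurable)
  show ?thesis unfolding norm_gradient_power2 by measurable
qed

text \<open>Off the origin the quotient is \<open>x \<bullet> x\<close> times the squared gradient
  of \<open>v\<close>, plus \<open>4 * v * (euler v + \<A> v + v)\<close>. Moving one Dunkl operator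
  across in the first term yields \<open>\<Delta> v\<close> and
  \<open>- 2 * v * (euler v + \<A> v)\<close>, so \<open>\<A>\<close> survives with coefficient 4 -
  2 = 2. The rest is expressed by \<open>\<F>\<close> and \<open>\<L>\<close>.\<close>

lemma integral_gradient_inner_self_mult:
  assumes v: "test v"
  shows "(LINT x|\<mu>. (norm (dunkl_gradient Rp k (\<lambda>x. (x \<bullet> x) * v x) x))\<^sup>2 / (norm x)\<^sup>2)
    = (LINT x|\<mu>. \<F> v x * \<F> v x) + (\<N> / 2 - 2)\<^sup>2 * (LINT x|\<mu>. v x * v x) + (LINT x|\<mu>. v x * \<L> v x) + 2 * (LINT x|\<mu>. v x * \<A> v x)"
proof -
  note sv = test_smooth[OF v]
  define J where "J f g = (LINT x|\<mu>. f x * g x)" for f g :: "real^'n \<Rightarrow> real"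
  have int: "integrable \<mu> (\<lambda>x. v x * f x)" if "smooth f" for f
    using that by (intro integrable_test test_mult1 v)
  have test_sT: "test (\<lambda>x. (x \<bullet> x) * T i v x)" for i by (intro test_mult2 test_T v) auto
  have "(LINT x|\<mu>. (norm (dunkl_gradient Rp k (\<lambda>x. (x \<bullet> x) * v x) x))\<^sup>2 / (norm x)\<^sup>2)
      = (LINT x|\<mu>. (\<Sum>i\<in>UNIV. (x \<bullet> x) * T i v x * T i v x) + (4 * (v x * euler v x) + 4 * (v x * \<A> v x) + 4 * (v x * v x)))"
  \<comment> \<open>Only almost everywhere: at the origin division by zero makes the left side
    0.\<close>
  proof (rule integral_cong_AE)
    show "AE x in \<mu>. (norm (dunkl_gradient Rp k (\<lambda>x. (x \<bullet> x) * v x) x))\<^sup>2 / (norm x)\<^sup>2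
        = (\<Sum>i\<in>UNIV. (x \<bullet> x) * T i v x * T i v x) + (4 * (v x * euler v x) + 4 * (v x * \<A> v x) + 4 * (v x * v x))"
      using AE_not_zero
    proof eventually_elim
      case (elim x)
      have "(norm (dunkl_gradient Rp k (\<lambda>x. (x \<bullet> x) * v x) x))\<^sup>2 = (\<Sum>i\<in>UNIV. ((x \<bullet> x) * T i v x + 2 * (x $ i * v x))\<^sup>2)"
        unfolding norm_gradient_power2 T_inner_self_mult[OF sv] ..
      also have "\<dots> = (\<Sum>i\<in>UNIV. (x \<bullet> x) * ((x \<bullet> x) * T i v x * T i v x) + 4 * (x \<bullet> x) * v x * (x $ i * T i v x) + 4 * (v x * v x) * (x $ i * x $ i))"
        by (intro sum.cong refl) (simp add: power2_eq_square algebra_simps)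
      also have "\<dots> = (x \<bullet> x) * (\<Sum>i\<in>UNIV. (x \<bullet> x) * T i v x * T i v x) + 4 * (x \<bullet> x) * v x * (\<Sum>i\<in>UNIV. x $ i * T i v x) + 4 * (v x * v x) * (x \<bullet> x)"
        by (simp add: sum.distrib sum_distrib_left inner_vec_def)
      also have "\<dots> = (x \<bullet> x) * ((\<Sum>i\<in>UNIV. (x \<bullet> x) * T i v x * T i v x) + (4 * (v x * euler v x) + 4 * (v x * \<A> v x) + 4 * (v x * v x)))"
        unfolding sum_nth_mult_T by (simp add: algebra_simps)
      finally show ?case using elim by (simp add: power2_norm_eq_inner)
    qed
    have [measurable]: "v \<in> borel_measurable borel" "euler v \<in> borel_measurable borel" "\<A> v \<in> borel_measurable borel"
        "T i v \<in> borel_measurable borel" for i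
      using sv by (auto intro!: smooth_borel_measurable smooth_euler)
    show "(\<lambda>x. (norm (dunkl_gradient Rp k (\<lambda>x. (x \<bullet> x) * v x) x))\<^sup>2 / (norm x)\<^sup>2) \<in> borel_measurable \<mu>"
      using gradient_quotient_measurable[OF smooth_mult[OF smooth_inner_self sv]] by simp
    show "(\<lambda>x. (\<Sum>i\<in>UNIV. (x \<bullet> x) * T i v x * T i v x) + (4 * (v x * euler v x) + 4 * (v x * \<A> v x) + 4 * (v x * v x))) \<in> borel_measurable \<mu>"
      by measurable
  qed
  also have "\<dots> = (\<Sum>i\<in>UNIV. LINT x|\<mu>. (x \<bullet> x) * T i v x * T i v x) + (4 * J v (euler v) + 4 * J v (\<A> v) + 4 * J v v)"
    using sv test_sT by (simp add: J_def int smooth_euler smooth_defect integrable_test test_mult1 smooth_T)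
  also have "(\<Sum>i\<in>UNIV. LINT x|\<mu>. (x \<bullet> x) * T i v x * T i v x)
      = - (J v (\<lambda>x. (x \<bullet> x) * \<Delta> v x) + 2 * J v (euler v) + 2 * J v (\<A> v))"
  proof -
    have T_sT: "T i (\<lambda>x. (x \<bullet> x) * T i v x) x = (x \<bullet> x) * T i (T i v) x + 2 * (x $ i * T i v x)" for i x
      by (rule T_inner_self_mult) (rule smooth_T[OF sv])
    have "(LINT x|\<mu>. (x \<bullet> x) * T i v x * T i v x) = - (LINT x|\<mu>. v x * ((x \<bullet> x) * T i (T i v) x + 2 * (x $ i * T i v x)))" for i
      using integral_T_mult[OF v smooth_mult[OF smooth_inner_self smooth_T[OF sv]], of i i]
      by (simp add: T_sT mult_ac)
    then have "(\<Sum>i\<in>UNIV. LINT x|\<mu>. (x \<bullet> x) * T i v x * T i v x)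
        = - (LINT x|\<mu>. (\<Sum>i\<in>UNIV. v x * ((x \<bullet> x) * T i (T i v) x + 2 * (x $ i * T i v x))))"
      by (subst Bochner_Integration.integral_sum)
        (auto intro!: int smooth_add smooth_mult smooth_T sv simp: sum_negf)
    also have "(LINT x|\<mu>. (\<Sum>i\<in>UNIV. v x * ((x \<bullet> x) * T i (T i v) x + 2 * (x $ i * T i v x))))
        = (LINT x|\<mu>. v x * ((x \<bullet> x) * \<Delta> v x) + 2 * (v x * euler v x) + 2 * (v x * \<A> v x))"
    proof (rule Bochner_Integration.integral_cong[OF refl])
      fix x
      have "(\<Sum>i\<in>UNIV. v x * ((x \<bullet> x) * T i (T i v) x + 2 * (x $ i * T i v x)))
          = v x * ((x \<bullet> x) * (\<Sum>i\<in>UNIV. T i (T i v) x) + 2 * (\<Sum>i\<in>UNIV. x $ i * T i v x))"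
        by (simp add: sum_distrib_left[symmetric] sum.distrib)
      then show "(\<Sum>i\<in>UNIV. v x * ((x \<bullet> x) * T i (T i v) x + 2 * (x $ i * T i v x)))
          = v x * ((x \<bullet> x) * \<Delta> v x) + 2 * (v x * euler v x) + 2 * (v x * \<A> v x)"
        unfolding sum_nth_mult_T dunkl_laplacian_def by (simp add: algebra_simps)
    qed
    finally show ?thesis
      using sv by (simp add: J_def int smooth_mult smooth_Lap smooth_euler smooth_defect)
  qed
  also have "J v (\<lambda>x. (x \<bullet> x) * \<Delta> v x) = J v (euler (euler v)) + (\<N> - 2) * J v (euler v) - J v (\<L> v)"
  proof -
    have "J v (\<lambda>x. (x \<bullet> x) * \<Delta> v x) = (LINT x|\<mu>. v x * euler (euler v) x + (\<N> - 2) * (v x * euler v x) - v x * \<L> v x)"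
      unfolding J_def angular_def by (simp add: algebra_simps)
    then show ?thesis using sv by (simp add: J_def int smooth_euler smooth_angular)
  qed
  also have "J v (euler v) = - (\<N> / 2) * J v v"
  proof -
    have "J (\<F> v) v = 0"
      using integral_shifted_euler[OF v v] by (simp add: J_def mult.commute)
    moreover have "J (\<F> v) v = (LINT x|\<mu>. v x * euler v x + \<N> / 2 * (v x * v x))"
      unfolding J_def shifted_euler_def by (simp add: algebra_simps)
    ultimately show ?thesis using sv by (simp add: J_def int smooth_euler)
  qed
  also have "J v (euler (euler v)) = - J (\<F> v) (\<F> v) + (\<N> / 2)\<^sup>2 * J v v"
  proof -
    have "- J (\<F> v) (\<F> v) = J v (\<F> (\<F> v))"
      using integral_shifted_euler[OF v test_shifted_euler[OF v]] by (simp add: J_def)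
    also have "\<F> (\<F> v) = (\<lambda>x. euler (euler v) x + \<N> * euler v x + (\<N> / 2)\<^sup>2 * v x)"
      using shifted_euler_twice[OF sv] by blast
    also have "J v \<dots> = (LINT x|\<mu>. v x * euler (euler v) x + \<N> * (v x * euler v x) + (\<N> / 2)\<^sup>2 * (v x * v x))"
      unfolding J_def by (simp add: algebra_simps)
    also have "\<dots> = J v (euler (euler v)) + \<N> * J v (euler v) + (\<N> / 2)\<^sup>2 * J v v"
      using sv by (simp add: J_def int smooth_euler)
    finally show ?thesis
      unfolding \<open>J v (euler v) = - (\<N> / 2) * J v v\<close> by (simp add: power2_eq_square field_simps)
  qed
  finally show ?thesis unfolding J_def by (simp add: power2_eq_square field_simps)
qed

lemma rellich_inner_self_mult:
  assumes v: "test v" and N: "5 + 4 * \<gamma> \<le> \<N>"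
  shows "\<N>\<^sup>2 / 4 * (LINT x|\<mu>. (norm (dunkl_gradient Rp k (\<lambda>x. (x \<bullet> x) * v x) x))\<^sup>2 / (norm x)\<^sup>2)
     \<le> (LINT x|\<mu>. (\<Delta> (\<lambda>x. (x \<bullet> x) * v x) x)\<^sup>2)"
proof -
  have N2: "2 \<le> \<N>" using N total_multiplicity_nonneg by linarith
  define J where "J f g = (LINT x|\<mu>. f x * g x)" for f g :: "real^'n \<Rightarrow> real"
  have 1: "0 \<le> J (\<F> v) (\<L> (\<F> v))"
  proof -
    note w = test_shifted_euler[OF v]
    obtain K where K: "0 < K" "\<And>x. K < norm x \<Longrightarrow> \<F> v x = 0"
      using w unfolding test_def by (metis bounded_supportE)
    obtain \<rho>' where "dunkl_cutoff R Rp k (bump K) \<rho>'" by (rule cutoff_bump[OF K(1)])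
    then interpret F: dunkl_cutoff R Rp k "bump K" \<rho>' .
    show ?thesis
      using F.ip_angular_nonneg[OF test_smooth[OF w] N2] bump_constant_pos
      unfolding F.ip_def J_def by (simp add: integral_bump_mult[OF K(1)] K zero_le_mult_iff)
  qed
  have 2: "0 \<le> J (\<L> v) (\<L> v) + \<N> * (\<N> - 8) / 4 * J v (\<L> v) - \<N>\<^sup>2 / 2 * J v (\<A> v)"
  proof -
    obtain K where K: "0 < K" "\<And>x. K < norm x \<Longrightarrow> v x = 0" "\<And>x. K < norm x \<Longrightarrow> \<L> v x = 0"
      using common_support[OF v test_angular[OF v]] by blast
    obtain \<rho>' where "dunkl_cutoff R Rp k (bump K) \<rho>'" by (rule cutoff_bump[OF K(1)])
    then interpret G: dunkl_cutoff R Rp k "bump K" \<rho>' .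
    define c where "c = flat 0 (flat 0 1)"
    have "G.ip (\<L> v) (\<L> v) = c * J (\<L> v) (\<L> v)" "\<And>f. G.ip v f = c * J v f"
      unfolding G.ip_def J_def c_def by (simp_all add: integral_bump_mult[OF K(1)] K)
    then have "0 \<le> c * (J (\<L> v) (\<L> v) + \<N> * (\<N> - 8) / 4 * J v (\<L> v) - \<N>\<^sup>2 / 2 * J v (\<A> v))"
      using G.ip_angular_defect[OF test_smooth[OF v] N] by (simp add: algebra_simps)
    then show ?thesis using bump_constant_pos unfolding c_def by (simp add: zero_le_mult_iff)
  qed
  have 3: "0 \<le> J f f" for f unfolding J_def by (intro Bochner_Integration.integral_nonneg) simp
  \<comment> \<open>The terms in \<open>J v v\<close> cancel, since
    \<open>\<N>\<^sup>2 / 4 * (\<N> / 2 - 2)\<^sup>2\<close> is the square of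
    \<open>\<N> * (\<N> - 4) / 4\<close>.\<close>
  have "(LINT x|\<mu>. (\<Delta> (\<lambda>x. (x \<bullet> x) * v x) x)\<^sup>2)
      - \<N>\<^sup>2 / 4 * (LINT x|\<mu>. (norm (dunkl_gradient Rp k (\<lambda>x. (x \<bullet> x) * v x) x))\<^sup>2 / (norm x)\<^sup>2)
    = J (\<F> (\<F> v)) (\<F> (\<F> v)) + (\<N> / 2 - 2)\<^sup>2 * J (\<F> v) (\<F> v) + 2 * J (\<F> v) (\<L> (\<F> v))
      + (J (\<L> v) (\<L> v) + \<N> * (\<N> - 8) / 4 * J v (\<L> v) - \<N>\<^sup>2 / 2 * J v (\<A> v))"
    unfolding integral_gradient_inner_self_mult[OF v] integral_Lap_inner_self_mult[OF v] J_def[symmetric]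
    by (simp add: power2_eq_square field_simps)
  also have "\<dots> \<ge> 0"
    using 1 2 3[of "\<F> (\<F> v)"] mult_nonneg_nonneg[OF zero_le_power2 3, of "\<N> / 2 - 2" "\<F> v"] by linarith
  finally show ?thesis by simp
qed

end

section \<open>The inequality and its sharpness\<close>

lemma radial_pair_powr:
  assumes "0 < \<epsilon>"
  shows "radial_pair (\<lambda>x::real^'n. (x \<bullet> x + \<epsilon>) powr p) (\<lambda>x. 2 * p * (x \<bullet> x + \<epsilon>) powr (p - 1))"
proof -
  have "radial_pair (\<lambda>x::real^'n. (\<lambda>n t. (\<Prod>j<n. p - real j) * (t + \<epsilon>) powr (p - real n)) 0 (x \<bullet> x))
     (\<lambda>x. (\<lambda>n t. (\<Prod>j<n. p - real j) * (t + \<epsilon>) powr (p - real n)) 1 (x \<bullet> x) * 2)"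
    by (rule radial_pair_compose_real[OF radial_pair_inner_self])
      (auto intro!: powr_shift_has_derivative assms simp del: prod.lessThan_Suc of_nat_Suc)
  then show ?thesis by (simp add: mult_ac)
qed

lemma radial_pair_inverse_power:
  assumes "0 < \<epsilon>"
  shows "radial_pair (\<lambda>x::real^'n. 1 / (x \<bullet> x + \<epsilon>) ^ m) (\<lambda>x. - 2 * real m * (1 / (x \<bullet> x + \<epsilon>) ^ Suc m))"
proof -
  have powr: "(x \<bullet> x + \<epsilon>) powr (- real j) = 1 / (x \<bullet> x + \<epsilon>) ^ j" for x :: "real^'n" and j
    using assms by (simp add: powr_minus_divide powr_realpow add_nonneg_pos)
  have Suc: "- real m - 1 = - real (Suc m)" by simp
  have eq: "(\<lambda>x::real^'n. 2 * (- real m) * (x \<bullet> x + \<epsilon>) powr (- real m - 1)) = (\<lambda>x. - 2 * real m * (1 / (x \<bullet> x + \<epsilon>) ^ Suc m))"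
    unfolding Suc powr by simp
  have "radial_pair (\<lambda>x::real^'n. (x \<bullet> x + \<epsilon>) powr (- real m)) (\<lambda>x. 2 * (- real m) * (x \<bullet> x + \<epsilon>) powr (- real m - 1))"
    by (rule radial_pair_powr[OF assms])
  then show ?thesis unfolding eq powr .
qed

lemma euler_zero_open:
  fixes x :: "real^'n"
  assumes "open S" "x \<in> S" "\<And>y. y \<in> S \<Longrightarrow> f y = 0"
  shows "euler f x = 0"
proof -
  have "(f has_derivative (\<lambda>h. 0)) (at x)"
    by (rule has_derivative_transform_within_open[OF has_derivative_const[of 0] assms(1,2)]) (simp add: assms(3))
  then show ?thesis by (simp add: euler_def partial_derivative_eq)
qed

context dunkl
begin

text \<open>\<open>integral_euler\<close> for \<open>\<eta>\<close> times the power, where the Euler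
  operator reproduces the power up to \<epsilon> times the next lower one. It does the work of polar
  coordinates: \<open>p = -2\<close> gives the local integrability of |x|^(-4), and
  \<open>p = - \<N> / 2\<close> removes the first term.\<close>

lemma integral_powr_identity:
  assumes \<eta>: "test \<eta>" and "0 < \<epsilon>"
  shows "(\<N> + 2 * p) * (LINT x|\<mu>. \<eta> x * (x \<bullet> x + \<epsilon>) powr p) - 2 * p * \<epsilon> * (LINT x|\<mu>. \<eta> x * (x \<bullet> x + \<epsilon>) powr (p - 1))
    = - (LINT x|\<mu>. euler \<eta> x * (x \<bullet> x + \<epsilon>) powr p)"
proof -
  define q where "q p x = (x \<bullet> x + \<epsilon>) powr p" for p and x :: "real^'n"
  have pair: "radial_pair (q p) (\<lambda>x. 2 * p * q (p - 1) x)" for p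
    unfolding q_def by (rule radial_pair_powr[OF \<open>0 < \<epsilon>\<close>])
  have sq: "smooth (q p)" for p using pair by (rule radial_pairD)
  have eul: "euler (q p) x = 2 * p * (q p x - \<epsilon> * q (p - 1) x)" for x
  proof -
    have pos: "0 < x \<bullet> x + \<epsilon>" using \<open>0 < \<epsilon>\<close> by (simp add: add_nonneg_pos)
    have *: "q p x = (x \<bullet> x + \<epsilon>) * q (p - 1) x"
      unfolding q_def using pos by (simp add: powr_diff)
    show ?thesis unfolding euler_radial[OF pair] * by (simp add: algebra_simps)
  qed
  have tests: "test (\<lambda>x. \<eta> x * q p x)" "test (\<lambda>x. euler \<eta> x * q p x)" for p
    using \<eta> by (auto intro!: test_mult1 test_euler sq)
  have "(LINT x|\<mu>. euler (\<lambda>x. \<eta> x * q p x) x) = - \<N> * (LINT x|\<mu>. \<eta> x * q p x)"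
    by (rule integral_euler[OF tests(1)])
  moreover have "euler (\<lambda>x. \<eta> x * q p x) x = euler \<eta> x * q p x + 2 * p * (\<eta> x * q p x) - 2 * p * \<epsilon> * (\<eta> x * q (p - 1) x)" for x
    using \<eta> by (simp add: euler_mult sq test_smooth eul algebra_simps)
  ultimately have "(LINT x|\<mu>. euler \<eta> x * q p x) + 2 * p * (LINT x|\<mu>. \<eta> x * q p x) - 2 * p * \<epsilon> * (LINT x|\<mu>. \<eta> x * q (p - 1) x)
     = - \<N> * (LINT x|\<mu>. \<eta> x * q p x)"
    by (simp add: integrable_test tests)
  then show ?thesis unfolding q_def by (simp add: algebra_simps)
qed

text \<open>For \<open>p \<le> 0\<close> the regularized powers increase as \<epsilon> decreases to
  0, so the uniform bound feeds monotone convergence.\<close>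

lemma integrable_powr_limit:
  assumes \<eta>: "test \<eta>" "\<And>x. 0 \<le> \<eta> x" and "p \<le> 0" and
    bound: "\<And>\<epsilon>. 0 < \<epsilon> \<Longrightarrow> (LINT x|\<mu>. \<eta> x * (x \<bullet> x + \<epsilon>) powr p) \<le> C"
  shows "integrable \<mu> (\<lambda>x. \<eta> x * (x \<bullet> x) powr p)"
proof -
  define f where "f n x = \<eta> x * (x \<bullet> x + inverse (real (Suc n))) powr p" for n and x :: "real^'n"
  have sf: "smooth (\<lambda>x::real^'n. (x \<bullet> x + inverse (real (Suc n))) powr p)" for n
    by (rule radial_pairD(1)[OF radial_pair_powr]) simp
  have int: "integrable \<mu> (f n)" for n
    unfolding f_def by (intro integrable_test test_mult1 \<eta> sf)
  have le: "f m x \<le> f n x" if "m \<le> n" for m n x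
    unfolding f_def using that \<open>p \<le> 0\<close>
    by (intro mult_left_mono powr_mono2' \<eta>) (auto simp: add_nonneg_pos)
  have "incseq (\<lambda>n. integral\<^sup>L \<mu> (f n))"
    by (intro monoI integral_mono int le)
  moreover have "integral\<^sup>L \<mu> (f n) \<le> C" for n
    unfolding f_def by (rule bound) simp
  ultimately obtain L where L: "(\<lambda>n. integral\<^sup>L \<mu> (f n)) \<longlonglongrightarrow> L"
    using incseq_convergent[of "\<lambda>n. integral\<^sup>L \<mu> (f n)" C] by blast
  have [measurable]: "\<eta> \<in> borel_measurable borel" using test_smooth[OF \<eta>(1)] by auto
  show ?thesis
  proof (rule integrable_monotone_convergence[OF int _ _ L])
    show "AE x in \<mu>. mono (\<lambda>n. f n x)" using le by (simp add: mono_def)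
    show "AE x in \<mu>. (\<lambda>n. f n x) \<longlonglongrightarrow> \<eta> x * (x \<bullet> x) powr p"
      using AE_not_zero
    proof eventually_elim
      case (elim x)
      have "(\<lambda>n. f n x) \<longlonglongrightarrow> \<eta> x * (x \<bullet> x + 0) powr p"
        unfolding f_def using elim by (intro tendsto_intros LIMSEQ_inverse_real_of_nat) auto
      then show ?case by simp
    qed
    show "(\<lambda>x. \<eta> x * (x \<bullet> x) powr p) \<in> borel_measurable \<mu>" by measurable
  qed
qed

lemma euler_bump_powr_le:
  fixes x :: "real^'n"
  assumes "0 < K" "0 < \<epsilon>" "p \<le> 0"
  shows "\<bar>euler (bump K) x\<bar> * (x \<bullet> x + \<epsilon>) powr p \<le> \<bar>euler (bump K) x\<bar> * (K\<^sup>2) powr p"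
proof (cases "norm x < K")
  case True
  then show ?thesis by (simp add: euler_bump_zero[OF assms(1)])
next
  case False
  then have "K\<^sup>2 \<le> (norm x)\<^sup>2" using assms by (intro power_mono) auto
  then have "K\<^sup>2 \<le> x \<bullet> x + \<epsilon>" using assms(2) unfolding dot_square_norm by linarith
  then have "(x \<bullet> x + \<epsilon>) powr p \<le> (K\<^sup>2) powr p"
    using assms by (intro powr_mono2') auto
  then show ?thesis by (intro mult_left_mono) auto
qed

text \<open>In \<open>integral_powr_identity\<close> with \<open>p = -2\<close> the leading
  coefficient \<open>\<N> - 4\<close> is positive and the \<epsilon>-term has the favourable sign.
  What remains involves \<open>euler (bump K)\<close>, which vanishes for |x| < K, and is bounded
  uniformly in \<epsilon>.\<close>

lemma integrable_inverse_fourth_power: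
  assumes "4 < \<N>" "0 < K"
  shows "integrable \<mu> (\<lambda>x. bump K x * (x \<bullet> x) powr (-2))"
proof (rule integrable_powr_limit)
  define B where "B = (LINT x|\<mu>. \<bar>euler (bump K) x\<bar> * (K\<^sup>2) powr (-2)) / (\<N> - 4)"
  fix \<epsilon> :: real assume "0 < \<epsilon>"
  note tb = test_bump[OF assms(2)]
  have sm: "smooth (\<lambda>x::real^'n. (x \<bullet> x + \<epsilon>) powr p)" for p
    using radial_pairD(1)[OF radial_pair_powr[OF \<open>0 < \<epsilon>\<close>]] .
  have int: "integrable \<mu> (\<lambda>x. \<bar>euler (bump K) x\<bar> * (K\<^sup>2) powr (-2))"
    by (intro integrable_mult_left integrable_abs integrable_test test_euler tb)
  have nonneg: "0 \<le> (LINT x|\<mu>. bump K x * (x \<bullet> x + \<epsilon>) powr p)" for p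
    by (intro Bochner_Integration.integral_nonneg mult_nonneg_nonneg bump_nonneg) auto
  have "(\<N> - 4) * (LINT x|\<mu>. bump K x * (x \<bullet> x + \<epsilon>) powr (-2)) \<le> - (LINT x|\<mu>. euler (bump K) x * (x \<bullet> x + \<epsilon>) powr (-2))"
    using integral_powr_identity[OF tb \<open>0 < \<epsilon>\<close>, of "-2"] mult_nonneg_nonneg[OF _ nonneg[of "-3"], of "4 * \<epsilon>"] \<open>0 < \<epsilon>\<close> by simp
  also have "\<dots> = (LINT x|\<mu>. - (euler (bump K) x * (x \<bullet> x + \<epsilon>) powr (-2)))" by simp
  also have "\<dots> \<le> (LINT x|\<mu>. \<bar>euler (bump K) x\<bar> * (K\<^sup>2) powr (-2))"
  proof (rule integral_mono[OF _ int])
    show "integrable \<mu> (\<lambda>x. - (euler (bump K) x * (x \<bullet> x + \<epsilon>) powr (-2)))"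
      by (intro integrable_minus integrable_test test_mult1 test_euler tb sm)
    fix x :: "real^'n"
    have "- (euler (bump K) x * (x \<bullet> x + \<epsilon>) powr (-2)) \<le> \<bar>euler (bump K) x\<bar> * (x \<bullet> x + \<epsilon>) powr (-2)"
      using mult_right_mono[of "- euler (bump K) x" "\<bar>euler (bump K) x\<bar>" "(x \<bullet> x + \<epsilon>) powr (-2)"] by simp
    also have "\<dots> \<le> \<bar>euler (bump K) x\<bar> * (K\<^sup>2) powr (-2)"
      using assms \<open>0 < \<epsilon>\<close> by (intro euler_bump_powr_le) auto
    finally show "- (euler (bump K) x * (x \<bullet> x + \<epsilon>) powr (-2)) \<le> \<bar>euler (bump K) x\<bar> * (K\<^sup>2) powr (-2)" .
  qed
  finally show "(LINT x|\<mu>. bump K x * (x \<bullet> x + \<epsilon>) powr (-2)) \<le> B"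
    using assms(1) by (simp add: B_def pos_le_divide_eq mult.commute)
qed (use test_bump[OF assms(2)] bump_nonneg in auto)

lemma square_sum3_le: "(a + b + c)\<^sup>2 \<le> 3 * (a\<^sup>2 + b\<^sup>2 + c\<^sup>2)" for a b c :: real
proof -
  have "3 * (a\<^sup>2 + b\<^sup>2 + c\<^sup>2) - (a + b + c)\<^sup>2 = (a - b)\<^sup>2 + (b - c)\<^sup>2 + (a - c)\<^sup>2"
    by (simp add: power2_eq_square algebra_simps)
  then show ?thesis using sum_power2_ge_zero[of "a - b" "b - c"] zero_le_power2[of "a - c"] by linarith
qed

lemma minus_two_mult_le: "0 \<le> z \<Longrightarrow> - (2 * y * z) \<le> (2 * \<bar>y\<bar>) * z" for y z :: real
  using mult_right_mono[OF abs_ge_minus_self, of z y] by (simp add: algebra_simps)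

lemma square_sum2_le: "(a + b)\<^sup>2 \<le> 2 * (a\<^sup>2 + b\<^sup>2)" for a b :: real
  using sum_squares_bound[of a b] by (simp add: power2_sum)

text \<open>
  Every test function is a limit of functions \<open>x \<mapsto> (x \<bullet> x) * v x\<close>: multiply it by
  \<open>(x \<bullet> x) / (x \<bullet> x + \<epsilon>)\<close> and let \<open>\<epsilon> \<longlonglongrightarrow> 0\<close>. The error terms are dominated by \<open>|x| powr (-4)\<close>,
  which is locally integrable.
\<close>

lemma rellich_inequality:
  assumes u: "test u" and N: "5 + 4 * \<gamma> \<le> \<N>"
  shows "\<N>\<^sup>2 / 4 * (LINT x|\<mu>. (norm (dunkl_gradient Rp k u x))\<^sup>2 / (norm x)\<^sup>2) \<le> (LINT x|\<mu>. (\<Delta> u x)\<^sup>2)"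
proof -
  note su = test_smooth[OF u]
  have N4: "4 < \<N>" using N total_multiplicity_nonneg by linarith
  \<comment> \<open>One test function that majorizes the squares occurring below and supplies their
    common support radius and bound.\<close>
  define H where "H x = (\<Delta> u x)\<^sup>2 + (euler u x)\<^sup>2 + (u x)\<^sup>2 + (\<Sum>i\<in>UNIV. (T i u x)\<^sup>2)" for x
  have "test H"
    unfolding H_def[abs_def] power2_eq_square
    by (intro test_add test_sum test_mult1 test_Lap test_euler test_T u smooth_Lap smooth_euler smooth_T su)
  then obtain K where K: "0 < K" "\<And>x. K < norm x \<Longrightarrow> H x = 0"
    unfolding test_def by (metis bounded_supportE)
  obtain B where B: "\<And>x. \<bar>H x\<bar> \<le> B"
    using \<open>test H\<close> bounded_support_bound[of H] unfolding test_def by (metis smooth_continuous_on)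
  have H_ge: "(\<Delta> u x)\<^sup>2 \<le> H x" "(euler u x)\<^sup>2 \<le> H x" "(u x)\<^sup>2 \<le> H x" "(\<Sum>i\<in>UNIV. (T i u x)\<^sup>2) \<le> H x" "0 \<le> H x" for x
    unfolding H_def by (simp_all add: sum_nonneg add_nonneg_nonneg)
  define c where "c = flat 0 (flat 0 1)"
  have c: "0 < c" unfolding c_def by (rule bump_constant_pos)
  have B0: "0 \<le> B" using B[of 0] by linarith
  \<comment> \<open>Turns a bound on \<open>(x \<bullet> x)\<^sup>2 * f\<close> into the integrable
    majorant; within radius \<open>K\<close> the bump equals the constant \<open>c\<close>.\<close>
  have dominate: "f \<le> D * (B / c) * (bump K x * (x \<bullet> x) powr (-2))"
    if x: "x \<noteq> 0" and f: "norm x \<le> K \<Longrightarrow> (x \<bullet> x)\<^sup>2 * f \<le> D * H x" "K < norm x \<Longrightarrow> f \<le> 0" and D: "0 \<le> D"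
    for f D and x :: "real^'n"
  proof (cases "norm x \<le> K")
    case True
    have "(x \<bullet> x)\<^sup>2 * f \<le> D * B"
      using f(1)[OF True] mult_left_mono[OF _ D, of "H x" B] B[of x] by linarith
    then have "f \<le> D * B / (x \<bullet> x)\<^sup>2" using x by (simp add: pos_le_divide_eq mult.commute)
    also have "\<dots> = D * (B / c) * (c * (x \<bullet> x) powr (-2))"
      using c by (simp add: powr_minus_divide powr_numeral)
    finally show ?thesis using bump_constant[OF K(1) True] by (simp add: c_def)
  next
    case False
    have "0 \<le> D * (B / c) * (bump K x * (x \<bullet> x) powr (-2))"
      using D B0 c by (intro mult_nonneg_nonneg bump_nonneg) auto
    with f(2) False show ?thesis by linarith
  qed
  have int_dom: "integrable \<mu> (\<lambda>x. D * (bump K x * (x \<bullet> x) powr (-2)))" for D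
    by (intro integrable_mult_right integrable_inverse_fourth_power N4 K)
  define \<epsilon> where "\<epsilon> n = inverse (real (Suc n))" for n
  have \<epsilon>: "0 < \<epsilon> n" for n by (simp add: \<epsilon>_def)
  have \<epsilon>_lim: "\<epsilon> \<longlonglongrightarrow> 0" unfolding \<epsilon>_def by (rule LIMSEQ_inverse_real_of_nat)
  have pos: "0 < x \<bullet> x + \<epsilon> n" for x :: "real^'n" and n using \<epsilon>[of n] by (simp add: add_nonneg_pos)
  define \<tau> where "\<tau> n x = (x \<bullet> x) * (1 / (x \<bullet> x + \<epsilon> n))" for n and x :: "real^'n"
  define \<tau>' where "\<tau>' n x = 2 * \<epsilon> n * (1 / (x \<bullet> x + \<epsilon> n) ^ 2)" for n and x :: "real^'n"
  define \<tau>'' where "\<tau>'' n x = 2 * \<epsilon> n * (- 4 * (1 / (x \<bullet> x + \<epsilon> n) ^ 3))" for n and x :: "real^'n"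
  have pair: "radial_pair (\<tau> n) (\<tau>' n)" "radial_pair (\<tau>' n) (\<tau>'' n)" for n
  proof -
    have "radial_pair (\<lambda>x::real^'n. (x \<bullet> x) * (1 / (x \<bullet> x + \<epsilon> n)))
        (\<lambda>x. 2 * (1 / (x \<bullet> x + \<epsilon> n)) + (x \<bullet> x) * (- 2 * 1 * (1 / (x \<bullet> x + \<epsilon> n) ^ 2)))"
      using radial_pair_mult[OF radial_pair_inner_self radial_pair_inverse_power[OF \<epsilon>[of n], of 1]]
      by (simp add: numeral_2_eq_2)
    moreover have "2 * (1 / (x \<bullet> x + \<epsilon> n)) + (x \<bullet> x) * (- 2 * 1 * (1 / (x \<bullet> x + \<epsilon> n) ^ 2)) = \<tau>' n x" for x :: "real^'n"
    proof -
      have "2 * (1 / z) + (z - e) * (- 2 * 1 * (1 / z ^ 2)) = 2 * e * (1 / z ^ 2)" if "0 < z" for z e :: real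
        using that by (simp add: divide_simps power2_eq_square)
      from this[OF pos[of x n], of "\<epsilon> n"] show ?thesis unfolding \<tau>'_def by simp
    qed
    ultimately show "radial_pair (\<tau> n) (\<tau>' n)" unfolding \<tau>_def by simp
    show "radial_pair (\<tau>' n) (\<tau>'' n)"
      unfolding \<tau>'_def \<tau>''_def
      using radial_pair_cmult[OF radial_pair_inverse_power[OF \<epsilon>[of n], of 2], of "2 * \<epsilon> n"]
      by (simp add: numeral_3_eq_3 numeral_2_eq_2)
  qed
  \<comment> \<open>With \<open>a = s / (s + e)\<close> and \<open>b = e / (s + e)\<close>, both in
    [0, 1], these are multiples of products of \<open>a\<close> and \<open>b\<close>: each radial
    derivative costs one factor \<open>x \<bullet> x\<close>, uniformly in \<open>n\<close>.\<close>
  have \<tau>_bound: "\<bar>\<tau> n x\<bar> \<le> 1" "\<bar>(x \<bullet> x) * \<tau>' n x\<bar> \<le> 2" "\<bar>(x \<bullet> x) * ((x \<bullet> x) * \<tau>'' n x)\<bar> \<le> 8" for n x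
  proof -
    define s where "s = x \<bullet> x"
    define e where "e = \<epsilon> n"
    have se: "0 \<le> s" "0 < e" "0 < s + e" using \<epsilon>[of n] by (auto simp: s_def e_def add_nonneg_pos)
    define a b where "a = s / (s + e)" and "b = e / (s + e)"
    have ab: "0 \<le> a" "a \<le> 1" "0 \<le> b" "b \<le> 1" unfolding a_def b_def using se by (auto simp: divide_le_eq_1)
    have ab1: "a * b \<le> 1" using mult_mono[of a 1 b 1] ab by simp
    have aab1: "a * (a * b) \<le> 1" using mult_mono[of a 1 "a * b" 1] ab ab1 by simp
    have "\<tau> n x = a" "(x \<bullet> x) * \<tau>' n x = 2 * (a * b)" "(x \<bullet> x) * ((x \<bullet> x) * \<tau>'' n x) = - 8 * (a * (a * b))"
      unfolding \<tau>_def \<tau>'_def \<tau>''_def a_def b_def s_def[symmetric] e_def[symmetric] using se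
      by (simp_all add: power2_eq_square power3_eq_cube divide_simps)
    then show "\<bar>\<tau> n x\<bar> \<le> 1" "\<bar>(x \<bullet> x) * \<tau>' n x\<bar> \<le> 2" "\<bar>(x \<bullet> x) * ((x \<bullet> x) * \<tau>'' n x)\<bar> \<le> 8"
      using ab ab1 aab1 by (auto simp: abs_mult)
  qed
  have \<tau>_lim: "(\<lambda>n. \<tau> n x) \<longlonglongrightarrow> 1" "(\<lambda>n. \<tau>' n x) \<longlonglongrightarrow> 0" "(\<lambda>n. \<tau>'' n x) \<longlonglongrightarrow> 0" if "x \<noteq> 0" for x
  proof -
    have "(\<lambda>n. \<tau> n x) \<longlonglongrightarrow> (x \<bullet> x) * (1 / (x \<bullet> x + 0))" "(\<lambda>n. \<tau>' n x) \<longlonglongrightarrow> 2 * 0 * (1 / (x \<bullet> x + 0) ^ 2)"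
      "(\<lambda>n. \<tau>'' n x) \<longlonglongrightarrow> 2 * 0 * (- 4 * (1 / (x \<bullet> x + 0) ^ 3))"
      unfolding \<tau>_def \<tau>'_def \<tau>''_def by (intro tendsto_intros \<epsilon>_lim; use that in simp)+
    then show "(\<lambda>n. \<tau> n x) \<longlonglongrightarrow> 1" "(\<lambda>n. \<tau>' n x) \<longlonglongrightarrow> 0" "(\<lambda>n. \<tau>'' n x) \<longlonglongrightarrow> 0" using that by auto
  qed
  define w where "w n x = \<tau> n x * u x" for n x
  have sw: "smooth (w n)" for n unfolding w_def[abs_def] using radial_pairD(1)[OF pair(1)] su by (rule smooth_mult)
  have Lap_w: "\<Delta> (w n) x = \<tau> n x * \<Delta> u x + 2 * \<tau>' n x * euler u x + ((x \<bullet> x) * \<tau>'' n x + \<N> * \<tau>' n x) * u x" for n x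
    unfolding w_def[abs_def] Lap_radial_mult[OF pair su] euler_radial[OF pair(2)] ..
  have T_w: "T i (w n) x = \<tau> n x * T i u x + x $ i * (\<tau>' n x * u x)" for i n x
    unfolding w_def[abs_def] by (rule T_radial_mult[OF pair(1) su])
  have lim1: "(\<lambda>n. LINT x|\<mu>. (\<Delta> (w n) x)\<^sup>2) \<longlonglongrightarrow> (LINT x|\<mu>. (\<Delta> u x)\<^sup>2)"
  proof (rule integral_dominated_convergence)
    \<comment> \<open>The squares of the coefficient bounds \<open>K\<^sup>2\<close>, 4 and
      \<open>8 + 2 * \<N>\<close> found below after multiplication by \<open>x \<bullet> x\<close>;
      the 3 comes from \<open>square_sum3_le\<close>.\<close>
    define D where "D = 3 * ((K\<^sup>2)\<^sup>2 + 16 + (8 + 2 * \<N>)\<^sup>2)"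
    have D: "0 \<le> D" unfolding D_def by simp
    show "(\<lambda>x. (\<Delta> u x)\<^sup>2) \<in> borel_measurable \<mu>" "(\<lambda>x. (\<Delta> (w n) x)\<^sup>2) \<in> borel_measurable \<mu>" for n
      using smooth_borel_measurable[OF smooth_power[OF smooth_Lap[OF su]]]
        smooth_borel_measurable[OF smooth_power[OF smooth_Lap[OF sw]]] by auto
    show "integrable \<mu> (\<lambda>x. D * (B / c) * (bump K x * (x \<bullet> x) powr (-2)))" by (rule int_dom)
    show "AE x in \<mu>. (\<lambda>n. (\<Delta> (w n) x)\<^sup>2) \<longlonglongrightarrow> (\<Delta> u x)\<^sup>2"
      using AE_not_zero
    proof eventually_elim
      case (elim x)
      have "(\<lambda>n. (\<Delta> (w n) x)\<^sup>2) \<longlonglongrightarrow> (1 * \<Delta> u x + 2 * 0 * euler u x + ((x \<bullet> x) * 0 + \<N> * 0) * u x)\<^sup>2"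
        unfolding Lap_w by (intro tendsto_intros \<tau>_lim elim)
      then show ?case by simp
    qed
    show "AE x in \<mu>. norm ((\<Delta> (w n) x)\<^sup>2) \<le> D * (B / c) * (bump K x * (x \<bullet> x) powr (-2))" for n
      using AE_not_zero
    proof eventually_elim
      case (elim x)
      have "(\<Delta> (w n) x)\<^sup>2 \<le> D * (B / c) * (bump K x * (x \<bullet> x) powr (-2))"
      proof (rule dominate[OF elim _ _ D])
        assume "norm x \<le> K"
        define s where "s = x \<bullet> x"
        have "(norm x)\<^sup>2 \<le> K\<^sup>2" using \<open>norm x \<le> K\<close> by (intro power_mono) auto
        then have s: "0 \<le> s" "s \<le> K\<^sup>2" by (auto simp: s_def dot_square_norm)
        have sq: "(t * z)\<^sup>2 \<le> C\<^sup>2 * H x" if "\<bar>t\<bar> \<le> C" "z\<^sup>2 \<le> H x" for t z C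
          unfolding power_mult_distrib using that by (intro mult_mono) (auto simp: abs_le_square_iff[symmetric])
        have "s\<^sup>2 * (\<Delta> (w n) x)\<^sup>2 = (s * \<tau> n x * \<Delta> u x + 2 * (s * \<tau>' n x) * euler u x + (s * (s * \<tau>'' n x) + \<N> * (s * \<tau>' n x)) * u x)\<^sup>2"
          unfolding Lap_w s_def power_mult_distrib[symmetric] by (simp add: algebra_simps)
        also have "\<dots> \<le> 3 * ((s * \<tau> n x * \<Delta> u x)\<^sup>2 + (2 * (s * \<tau>' n x) * euler u x)\<^sup>2 + ((s * (s * \<tau>'' n x) + \<N> * (s * \<tau>' n x)) * u x)\<^sup>2)"
          by (rule square_sum3_le)
        also have "\<dots> \<le> 3 * ((K\<^sup>2)\<^sup>2 * H x + 4\<^sup>2 * H x + (8 + 2 * \<N>)\<^sup>2 * H x)"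
        proof (intro mult_left_mono add_mono sq H_ge)
          show "\<bar>s * \<tau> n x\<bar> \<le> K\<^sup>2"
            unfolding abs_mult using mult_mono[of "\<bar>s\<bar>" "K\<^sup>2" "\<bar>\<tau> n x\<bar>" 1] \<tau>_bound(1)[of n x] s by simp
          show "\<bar>2 * (s * \<tau>' n x)\<bar> \<le> 4" using \<tau>_bound(2)[of x n] by (simp add: s_def abs_mult)
          have "\<bar>\<N> * (s * \<tau>' n x)\<bar> \<le> \<N> * 2"
            unfolding abs_mult[of \<N>] using \<tau>_bound(2)[of x n] N4 by (intro mult_mono) (auto simp: s_def)
          then show "\<bar>s * (s * \<tau>'' n x) + \<N> * (s * \<tau>' n x)\<bar> \<le> 8 + 2 * \<N>"
            using \<tau>_bound(3)[of x n] unfolding s_def by linarith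
        qed simp
        also have "\<dots> = D * H x" by (simp add: D_def algebra_simps)
        finally show "(x \<bullet> x)\<^sup>2 * (\<Delta> (w n) x)\<^sup>2 \<le> D * H x" by (simp add: s_def)
      next
        assume "K < norm x"
        then have "\<Delta> u x = 0" "euler u x = 0" "u x = 0"
          using K(2)[of x] H_ge(1,2,3)[of x] by (simp_all add: power2_le_iff_abs_le)
        then show "(\<Delta> (w n) x)\<^sup>2 \<le> 0" by (simp add: Lap_w)
      qed
      then show ?case by simp
    qed
  qed
  have lim2: "(\<lambda>n. LINT x|\<mu>. (norm (dunkl_gradient Rp k (w n) x))\<^sup>2 / (norm x)\<^sup>2) \<longlonglongrightarrow> (LINT x|\<mu>. (norm (dunkl_gradient Rp k u x))\<^sup>2 / (norm x)\<^sup>2)"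
  proof (rule integral_dominated_convergence)
    define D where "D = 2 * K\<^sup>2 + 8"
    have D: "0 \<le> D" unfolding D_def by simp
    show "(\<lambda>x. (norm (dunkl_gradient Rp k u x))\<^sup>2 / (norm x)\<^sup>2) \<in> borel_measurable \<mu>"
      "(\<lambda>x. (norm (dunkl_gradient Rp k (w n) x))\<^sup>2 / (norm x)\<^sup>2) \<in> borel_measurable \<mu>" for n
      using gradient_quotient_measurable[OF su] gradient_quotient_measurable[OF sw] by auto
    show "integrable \<mu> (\<lambda>x. D * (B / c) * (bump K x * (x \<bullet> x) powr (-2)))" by (rule int_dom)
    show "AE x in \<mu>. (\<lambda>n. (norm (dunkl_gradient Rp k (w n) x))\<^sup>2 / (norm x)\<^sup>2) \<longlonglongrightarrow> (norm (dunkl_gradient Rp k u x))\<^sup>2 / (norm x)\<^sup>2"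
      using AE_not_zero
    proof eventually_elim
      case (elim x)
      have "(\<lambda>n. (\<Sum>i\<in>UNIV. (T i (w n) x)\<^sup>2) / (norm x)\<^sup>2) \<longlonglongrightarrow> (\<Sum>i\<in>UNIV. (1 * T i u x + x $ i * (0 * u x))\<^sup>2) / (norm x)\<^sup>2"
        unfolding T_w using elim by (intro tendsto_intros \<tau>_lim) auto
      then show ?case by (simp add: norm_gradient_power2)
    qed
    show "AE x in \<mu>. norm ((norm (dunkl_gradient Rp k (w n) x))\<^sup>2 / (norm x)\<^sup>2) \<le> D * (B / c) * (bump K x * (x \<bullet> x) powr (-2))" for n
      using AE_not_zero
    proof eventually_elim
      case (elim x)
      have "(norm (dunkl_gradient Rp k (w n) x))\<^sup>2 / (norm x)\<^sup>2 \<le> D * (B / c) * (bump K x * (x \<bullet> x) powr (-2))"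
      proof (rule dominate[OF elim _ _ D])
        assume "norm x \<le> K"
        define s where "s = x \<bullet> x"
        have "(norm x)\<^sup>2 \<le> K\<^sup>2" using \<open>norm x \<le> K\<close> by (intro power_mono) auto
        then have s: "0 < s" "s \<le> K\<^sup>2" using elim by (auto simp: s_def dot_square_norm)
        have "(\<Sum>i\<in>UNIV. (T i (w n) x)\<^sup>2) \<le> (\<Sum>i\<in>UNIV. 2 * ((\<tau> n x * T i u x)\<^sup>2 + (x $ i * (\<tau>' n x * u x))\<^sup>2))"
          unfolding T_w by (intro sum_mono square_sum2_le)
        also have "\<dots> = 2 * ((\<tau> n x)\<^sup>2 * (\<Sum>i\<in>UNIV. (T i u x)\<^sup>2)) + 2 * (s * (\<tau>' n x * u x)\<^sup>2)"
          by (simp add: s_def inner_vec_def sum.distrib sum_distrib_left sum_distrib_right power_mult_distrib power2_eq_square mult_ac)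
        also have "(\<tau> n x)\<^sup>2 * (\<Sum>i\<in>UNIV. (T i u x)\<^sup>2) \<le> 1 * H x"
          using \<tau>_bound(1)[of n x] H_ge(4)[of x] by (intro mult_mono sum_nonneg) (auto simp: abs_square_le_1)
        finally have "s * (\<Sum>i\<in>UNIV. (T i (w n) x)\<^sup>2) \<le> s * (2 * (1 * H x) + 2 * (s * (\<tau>' n x * u x)\<^sup>2))"
          using s(1) by (intro mult_left_mono) auto
        also have "\<dots> = 2 * (s * H x) + 2 * ((s * \<tau>' n x)\<^sup>2 * (u x)\<^sup>2)"
          by (simp add: power2_eq_square algebra_simps)
        also have "\<dots> \<le> 2 * (K\<^sup>2 * H x) + 2 * (2\<^sup>2 * H x)"
        proof (intro add_mono mult_left_mono mult_mono H_ge s)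
          show "(s * \<tau>' n x)\<^sup>2 \<le> 2\<^sup>2" using \<tau>_bound(2)[of x n] abs_le_square_iff[of "s * \<tau>' n x" 2] by (simp add: s_def)
        qed auto
        finally have "s * (\<Sum>i\<in>UNIV. (T i (w n) x)\<^sup>2) \<le> D * H x" by (simp add: D_def algebra_simps)
        then show "(x \<bullet> x)\<^sup>2 * ((norm (dunkl_gradient Rp k (w n) x))\<^sup>2 / (norm x)\<^sup>2) \<le> D * H x"
          using s(1) unfolding norm_gradient_power2
          unfolding power2_norm_eq_inner s_def[symmetric] by (simp add: power2_eq_square[of s])
      next
        assume "K < norm x"
        then have "u x = 0" "(\<Sum>i\<in>UNIV. (T i u x)\<^sup>2) \<le> 0"
          using K(2)[of x] H_ge(3,4)[of x] by (simp_all add: power2_le_iff_abs_le)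
        then have "T i u x = 0" for i
          by (metis (no_types, lifting) UNIV_I antisym finite sum_nonneg sum_nonneg_eq_0_iff zero_le_power2 power_eq_0_iff)
        with \<open>u x = 0\<close> show "(norm (dunkl_gradient Rp k (w n) x))\<^sup>2 / (norm x)\<^sup>2 \<le> 0"
          by (simp add: norm_gradient_power2 T_w)
      qed
      then show ?case by simp
    qed
  qed
  have "\<N>\<^sup>2 / 4 * (LINT x|\<mu>. (norm (dunkl_gradient Rp k (w n) x))\<^sup>2 / (norm x)\<^sup>2) \<le> (LINT x|\<mu>. (\<Delta> (w n) x)\<^sup>2)" for n
  proof -
    \<comment> \<open>\<open>w n x\<close> is \<open>x \<bullet> x\<close> times this test function,
      so the inequality for divisible functions applies.\<close>
    have "test (\<lambda>x. 1 / (x \<bullet> x + \<epsilon> n) * u x)"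
      using radial_pairD(1)[OF radial_pair_inverse_power[OF \<epsilon>[of n], of 1]] u by (intro test_mult2) auto
    from rellich_inner_self_mult[OF this N] show ?thesis
      unfolding w_def[abs_def] \<tau>_def by (simp only: mult.assoc)
  qed
  then show ?thesis
    by (intro LIMSEQ_le[OF tendsto_mult_left[OF lim2] lim1]) auto
qed

section \<open>Sharpness of the constant\<close>

lemma integral_bump_square_pos:
  assumes "0 < K" shows "0 < (LINT x|\<mu>. bump K x * bump K x)"
proof (rule ccontr)
  note tb = test_bump[OF assms]
  have int: "integrable \<mu> (\<lambda>x. bump K x * bump K x)"
    by (intro integrable_test test_mult1 tb test_smooth)
  have nonneg: "0 \<le> bump K x * bump K x" for x :: "real^'n" by simp
  have "0 \<le> (LINT x|\<mu>. bump K x * bump K x)"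
    by (intro Bochner_Integration.integral_nonneg nonneg)
  moreover assume "\<not> ?thesis"
  ultimately have "(LINT x|\<mu>. bump K x * bump K x) = 0" by linarith
  then have "AE x in \<mu>. bump K x * bump K x = 0"
    using integral_nonneg_eq_0_iff_AE[OF int] nonneg by auto
  then have "AE x in lborel. 0 < ennreal (dunkl_weight Rp k x) \<longrightarrow> bump K x * bump K x = 0"
    unfolding dunkl_measure_def by (subst (asm) AE_density) auto
  then have "AE x in lborel. x \<notin> ball (0::real^'n) K"
    using AE_not_on_hyperplanes
  proof eventually_elim
    case (elim x)
    have "0 < dunkl_weight Rp k x"
      unfolding dunkl_weight_def using elim(2) by (intro prod_pos) auto
    then have "bump K x = 0" using elim(1) by simp
    then show ?case using bump_constant[OF assms, of x] bump_constant_pos by auto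
  qed
  then have "ball (0::real^'n) K \<in> null_sets lborel"
    by (subst AE_iff_null_sets) auto
  then show False
    using content_ball_pos[OF assms, of "0::real^'n"] by (simp add: null_sets_def measure_def)
qed

lemma euler_euler_bump_zero:
  fixes x :: "real^'n"
  assumes "0 < K" "norm x < K" shows "euler (euler (bump K)) x = 0"
  by (rule euler_zero_open[of "ball 0 K"]) (use assms in \<open>auto simp: euler_bump_zero\<close>)

text \<open>
  The functions \<open>(x \<bullet> x + \<delta>) powr (- \<N> / 4)\<close>, cut off by a bump, nearly minimize: their norms are
  unbounded as \<open>\<delta> \<longlonglongrightarrow> 0\<close>, since otherwise the second term of the identity \<open>integral_powr_identity\<close> with
  exponent \<open>- \<N> / 2\<close> would tend to 0, but \<^term>\<open>\<F>\<close> maps them to a bounded set.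
\<close>

definition almost_minimizer :: "real \<Rightarrow> real^'n \<Rightarrow> real" where
  "almost_minimizer \<delta> x = bump 1 x * (x \<bullet> x + \<delta>) powr (- \<N> / 4)"

lemma bump_square_pair:
  "test (\<lambda>x::real^'n. bump 1 x * bump 1 x)" "euler (\<lambda>x::real^'n. bump 1 x * bump 1 x) x = 2 * (bump 1 x * euler (bump 1) x)"
  using test_mult1[OF test_bump test_smooth[OF test_bump], of 1 1]
    euler_mult[OF test_smooth[OF test_bump] test_smooth[OF test_bump], of 1 1 x] by simp_all

text \<open>The exponent \<open>- \<N> / 2\<close> is the critical one: the coefficient
  \<open>\<N> + 2 * p\<close> in \<open>integral_powr_identity\<close> vanishes.\<close>

lemma integral_almost_minimizer_identity:
  assumes "0 < \<delta>"
  shows "\<N> * \<delta> * (LINT x|\<mu>. bump 1 x * bump 1 x * (x \<bullet> x + \<delta>) powr (- \<N> / 2 - 1))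
     = - (LINT x|\<mu>. 2 * (bump 1 x * euler (bump 1) x) * (x \<bullet> x + \<delta>) powr (- \<N> / 2))"
  using integral_powr_identity[OF bump_square_pair(1) assms, of "- \<N> / 2"]
  by (simp add: bump_square_pair(2))

lemma bump_outside_powr_le:
  fixes x :: "real^'n" and f :: "real^'n \<Rightarrow> real"
  assumes "\<And>y. norm y < 1 \<Longrightarrow> f y = 0" "0 < \<delta>" "p \<le> 0" "0 \<le> f x"
  shows "f x * (x \<bullet> x + \<delta>) powr p \<le> f x"
proof (cases "norm x < 1")
  case False
  then have "1\<^sup>2 \<le> (norm x)\<^sup>2" by (intro power_mono) auto
  then have "1 \<le> x \<bullet> x + \<delta>" using assms(2) unfolding dot_square_norm by simp
  then have "(x \<bullet> x + \<delta>) powr p \<le> 1 powr p" using assms(3) by (intro powr_mono2') auto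
  then show ?thesis using mult_left_mono[of "(x \<bullet> x + \<delta>) powr p" 1 "f x"] assms(4) by simp
qed (simp add: assms(1))

lemma smooth_shift_powr: "0 < \<delta> \<Longrightarrow> smooth (\<lambda>x::real^'n. (x \<bullet> x + \<delta>) powr p)"
  by (rule radial_pairD(1)[OF radial_pair_powr])

text \<open>The integrand concentrates at the origin as \<delta> tends to 0, but by the preceding
  identity its mass is governed by an integral over |x| \<ge> 1, where the power is at most
  1.\<close>

lemma integral_concentrated_bound:
  "\<exists>C. \<forall>\<delta>>0. \<delta> * (LINT x|\<mu>. bump 1 x * bump 1 x * (x \<bullet> x + \<delta>) powr (- \<N> / 2 - 1)) \<le> C"
proof (intro exI allI impI)
  fix \<delta> :: real assume "0 < \<delta>"
  let ?g = "\<lambda>x::real^'n. bump 1 x * euler (bump 1) x"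
  have tg: "test ?g" by (intro test_mult1 test_bump smooth_euler test_smooth) auto
  have ti: "test (\<lambda>x::real^'n. 2 * ?g x * (x \<bullet> x + \<delta>) powr (- \<N> / 2))"
    by (intro test_mult1 test_cmult tg smooth_shift_powr \<open>0 < \<delta>\<close>)
  have "\<N> * (\<delta> * (LINT x|\<mu>. bump 1 x * bump 1 x * (x \<bullet> x + \<delta>) powr (- \<N> / 2 - 1)))
      = (LINT x|\<mu>. - (2 * ?g x * (x \<bullet> x + \<delta>) powr (- \<N> / 2)))"
    using integral_almost_minimizer_identity[OF \<open>0 < \<delta>\<close>] by (simp add: mult.assoc)
  also have "\<dots> \<le> (LINT x|\<mu>. 2 * \<bar>?g x\<bar>)"
  proof (rule integral_mono)
    show "integrable \<mu> (\<lambda>x. - (2 * ?g x * (x \<bullet> x + \<delta>) powr (- \<N> / 2)))"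
      using ti by (intro integrable_minus integrable_test)
    show "integrable \<mu> (\<lambda>x. 2 * \<bar>?g x\<bar>)" by (intro integrable_mult_right integrable_abs integrable_test tg)
    fix x :: "real^'n"
    have "- (2 * ?g x * (x \<bullet> x + \<delta>) powr (- \<N> / 2)) \<le> (2 * \<bar>?g x\<bar>) * (x \<bullet> x + \<delta>) powr (- \<N> / 2)"
      by (rule minus_two_mult_le) simp
    also have "\<dots> \<le> 2 * \<bar>?g x\<bar>"
      using hom_dim_pos \<open>0 < \<delta>\<close> by (intro bump_outside_powr_le) (auto simp: euler_bump_zero)
    finally show "- (2 * ?g x * (x \<bullet> x + \<delta>) powr (- \<N> / 2)) \<le> 2 * \<bar>?g x\<bar>" .
  qed
  finally show "\<delta> * (LINT x|\<mu>. bump 1 x * bump 1 x * (x \<bullet> x + \<delta>) powr (- \<N> / 2 - 1)) \<le> (LINT x|\<mu>. 2 * \<bar>?g x\<bar>) / \<N>"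
    using hom_dim_pos by (simp add: pos_le_divide_eq mult.commute)
qed

text \<open>The bump decreases radially, so the right side of the identity has a definite sign. On
  the support of the bump \<open>x \<bullet> x + \<delta>\<close> is at most 2^2 + 1 = 5, and
  \<open>integral_euler\<close> evaluates what is left after this estimate.\<close>

lemma integral_concentrated_lower_bound:
  "\<exists>c>0. \<forall>\<delta>>0. \<delta> \<le> 1 \<longrightarrow> c \<le> \<delta> * (LINT x|\<mu>. bump 1 x * bump 1 x * (x \<bullet> x + \<delta>) powr (- \<N> / 2 - 1))"
proof (intro exI conjI allI impI)
  let ?g = "\<lambda>x::real^'n. bump 1 x * euler (bump 1) x"
  define c where "c = 5 powr (- \<N> / 2) * (LINT x|\<mu>. bump 1 x * bump 1 x)"
  show "0 < c" unfolding c_def by (intro mult_pos_pos integral_bump_square_pos) auto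
  have tg: "test ?g" by (intro test_mult1 test_bump smooth_euler test_smooth) auto
  obtain \<phi>' where \<phi>': "radial_pair (bump 1 :: real^'n \<Rightarrow> real) \<phi>'" "\<And>x. \<phi>' x \<le> 0"
    using bump_radial_pair[of 1] by (metis zero_less_one)
  have neg: "?g x \<le> 0" for x
    unfolding euler_radial[OF \<phi>'(1)] using \<phi>'(2) by (intro mult_nonneg_nonpos bump_nonneg) auto
  fix \<delta> :: real assume \<delta>: "0 < \<delta>" "\<delta> \<le> 1"
  have ti: "test (\<lambda>x::real^'n. 2 * ?g x * (x \<bullet> x + \<delta>) powr (- \<N> / 2))"
    by (intro test_mult1 test_cmult tg smooth_shift_powr \<delta>)
  have "(LINT x|\<mu>. 2 * ?g x) = - \<N> * (LINT x|\<mu>. bump 1 x * bump 1 x)"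
    using integral_euler[OF bump_square_pair(1)] by (simp add: bump_square_pair(2))
  then have "\<N> * c = (LINT x|\<mu>. 5 powr (- \<N> / 2) * (- 2 * ?g x))"
    by (simp add: c_def)
  also have "\<dots> \<le> (LINT x|\<mu>. - (2 * ?g x * (x \<bullet> x + \<delta>) powr (- \<N> / 2)))"
  proof (rule integral_mono)
    show "integrable \<mu> (\<lambda>x. - (2 * ?g x * (x \<bullet> x + \<delta>) powr (- \<N> / 2)))"
      using ti by (intro integrable_minus integrable_test)
    show "integrable \<mu> (\<lambda>x. 5 powr (- \<N> / 2) * (- 2 * ?g x))"
      by (intro integrable_mult_right integrable_test tg)
    fix x :: "real^'n"
    show "5 powr (- \<N> / 2) * (- 2 * ?g x) \<le> - (2 * ?g x * (x \<bullet> x + \<delta>) powr (- \<N> / 2))"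
    proof (cases "norm x \<le> 2")
      case True
      then have "(norm x)\<^sup>2 \<le> 2\<^sup>2" by (intro power_mono) auto
      then have "x \<bullet> x + \<delta> \<le> 5" using \<delta> by (simp add: dot_square_norm)
      moreover have "0 < x \<bullet> x + \<delta>" using \<delta> by (simp add: add_nonneg_pos)
      ultimately have "5 powr (- \<N> / 2) \<le> (x \<bullet> x + \<delta>) powr (- \<N> / 2)"
        using hom_dim_pos by (intro powr_mono2') auto
      from mult_right_mono[OF this, of "- 2 * ?g x"] neg[of x] show ?thesis by (simp add: mult_ac)
    next
      case False
      then show ?thesis by (simp add: bump_zero)
    qed
  qed
  also have "\<dots> = \<N> * (\<delta> * (LINT x|\<mu>. bump 1 x * bump 1 x * (x \<bullet> x + \<delta>) powr (- \<N> / 2 - 1)))"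
    using integral_almost_minimizer_identity[OF \<delta>(1)] by (simp add: mult.assoc)
  finally show "c \<le> \<delta> * (LINT x|\<mu>. bump 1 x * bump 1 x * (x \<bullet> x + \<delta>) powr (- \<N> / 2 - 1))"
    using hom_dim_pos by (simp add: mult_le_cancel_left_pos)
qed

lemma test_almost_minimizer: "0 < \<delta> \<Longrightarrow> test (almost_minimizer \<delta>)"
  unfolding almost_minimizer_def[abs_def] by (intro test_mult1 test_bump smooth_shift_powr) auto

lemma almost_minimizer_square:
  "0 < \<delta> \<Longrightarrow> almost_minimizer \<delta> x * almost_minimizer \<delta> x = bump 1 x * bump 1 x * (x \<bullet> x + \<delta>) powr (- \<N> / 2)"
  unfolding almost_minimizer_def by (simp add: powr_add[symmetric] mult_ac)

lemma almost_minimizer_unbounded: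
  "\<not> (\<exists>C. \<forall>\<delta>>0. (LINT x|\<mu>. almost_minimizer \<delta> x * almost_minimizer \<delta> x) \<le> C)"
proof
  assume "\<exists>C. \<forall>\<delta>>0. (LINT x|\<mu>. almost_minimizer \<delta> x * almost_minimizer \<delta> x) \<le> C"
  then obtain C where "\<And>\<delta>. 0 < \<delta> \<Longrightarrow> (LINT x|\<mu>. bump 1 x * bump 1 x * (x \<bullet> x + \<delta>) powr (- \<N> / 2)) \<le> C"
    by (auto simp: almost_minimizer_square)
  then have int: "integrable \<mu> (\<lambda>x. bump 1 x * bump 1 x * (x \<bullet> x) powr (- \<N> / 2))"
    using hom_dim_pos by (intro integrable_powr_limit bump_square_pair) auto
  define \<delta> where "\<delta> n = inverse (real (Suc n))" for n
  have \<delta>: "0 < \<delta> n" "\<delta> n \<le> 1" for n by (auto simp: \<delta>_def divide_simps)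
  have lim: "\<delta> \<longlonglongrightarrow> 0" unfolding \<delta>_def by (rule LIMSEQ_inverse_real_of_nat)
  define s where "s n x = \<delta> n * (bump 1 x * bump 1 x * (x \<bullet> x + \<delta> n) powr (- \<N> / 2 - 1))" for n and x :: "real^'n"
  \<comment> \<open>Bounded norms would make |x|^(- \<N>), cut off by the squared bump, integrable.
    It majorizes the concentrated densities \<open>s n\<close>, which tend to 0 pointwise, so their
    integrals would tend to 0 against the lower bound.\<close>
  have "(\<lambda>n. LINT x|\<mu>. s n x) \<longlonglongrightarrow> (LINT x|\<mu>. 0)"
  proof (rule integral_dominated_convergence[OF _ _ int])
    have "test (s n)" for n
      unfolding s_def[abs_def] by (intro test_cmult test_mult1 bump_square_pair smooth_shift_powr \<delta>)
    then show "s n \<in> borel_measurable \<mu>" for n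
      using test_smooth smooth_borel_measurable by (metis measurable_cong_sets sets_weighted)
    show "AE x in \<mu>. (\<lambda>n. s n x) \<longlonglongrightarrow> 0"
      using AE_not_zero
    proof eventually_elim
      case (elim x)
      have "(\<lambda>n. s n x) \<longlonglongrightarrow> 0 * (bump 1 x * bump 1 x * (x \<bullet> x + 0) powr (- \<N> / 2 - 1))"
        unfolding s_def using elim by (intro tendsto_intros lim) auto
      then show ?case by simp
    qed
    show "AE x in \<mu>. norm (s n x) \<le> bump 1 x * bump 1 x * (x \<bullet> x) powr (- \<N> / 2)" for n
      using AE_not_zero
    proof eventually_elim
      case (elim x)
      then have pos: "0 < x \<bullet> x" "0 < x \<bullet> x + \<delta> n" using \<delta>[of n] by (auto simp: add_nonneg_pos)
      have "\<delta> n * (x \<bullet> x + \<delta> n) powr (- \<N> / 2 - 1) = (\<delta> n / (x \<bullet> x + \<delta> n)) * (x \<bullet> x + \<delta> n) powr (- \<N> / 2)"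
        using pos by (simp add: powr_diff)
      also have "\<dots> \<le> 1 * (x \<bullet> x) powr (- \<N> / 2)"
        using pos \<delta>[of n] hom_dim_pos by (intro mult_mono powr_mono2') auto
      finally have "bump 1 x * bump 1 x * (\<delta> n * (x \<bullet> x + \<delta> n) powr (- \<N> / 2 - 1)) \<le> bump 1 x * bump 1 x * (x \<bullet> x) powr (- \<N> / 2)"
        by (intro mult_left_mono) auto
      moreover have "0 \<le> s n x" unfolding s_def using \<delta>[of n] by (intro mult_nonneg_nonneg) (auto simp: bump_nonneg)
      ultimately show ?case by (simp add: s_def mult_ac)
    qed
  qed simp
  then have "(\<lambda>n. LINT x|\<mu>. s n x) \<longlonglongrightarrow> 0" by simp
  moreover obtain c where "0 < c" "\<And>n. c \<le> (LINT x|\<mu>. s n x)"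
    using integral_concentrated_lower_bound \<delta> unfolding s_def by auto
  ultimately show False using LIMSEQ_le_const[of "\<lambda>n. LINT x|\<mu>. s n x" 0 c] by force
qed

text \<open>With \<open>\<kappa> = \<delta> / (x \<bullet> x + \<delta>)\<close> the power
  \<open>q\<close> without cutoff satisfies \<open>\<F> q = \<N> / 2 * \<kappa> * q\<close>, so up
  to derivatives of the bump \<open>\<F>\<close> leaves a factor \<open>\<kappa>\<close>. Since
  \<open>\<kappa>\<^sup>2 \<le> \<kappa>\<close> and \<open>\<kappa> * v\<^sup>2\<close> is exactly
  the concentrated density, whose integral is bounded, this part is under control. Terms with
  derivatives of the bump live off the unit ball and go into \<open>G\<close>.\<close>

lemma almost_minimizer_pointwise_bound:
  "\<exists>D G. 0 \<le> D \<and> test G \<and> (\<forall>x. 0 \<le> G x) \<and> (\<forall>x. norm x < 1 \<longrightarrow> G x = 0) \<and>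
     (\<forall>\<delta>>0. \<forall>x. \<forall>w\<in>{\<F> (almost_minimizer \<delta>), \<F> (\<F> (almost_minimizer \<delta>))}.
        (w x)\<^sup>2 \<le> D * (\<delta> * (bump 1 x * bump 1 x * (x \<bullet> x + \<delta>) powr (- \<N> / 2 - 1))) + G x * (x \<bullet> x + \<delta>) powr (- \<N> / 2))"
proof (intro exI conjI allI impI)
  define e1 :: "real^'n \<Rightarrow> real" where "e1 = euler (bump 1)"
  define e2 where "e2 = euler e1"
  \<comment> \<open>Bounds \<open>- \<N> * (1 - \<kappa> x) + \<N>\<^sup>2 / 4 * \<kappa> x\<close>,
    the coefficient of \<open>\<kappa> x * v x\<close> in \<open>\<F> (\<F> v) x\<close>, for
    \<open>\<kappa> x\<close> in [0, 1].\<close>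
  define A where "A = \<N> + \<N>\<^sup>2 / 4"
  define D where "D = 2 * (\<N> / 2)\<^sup>2 + 2 * A\<^sup>2"
  define G where "G x = 4 * (\<N>\<^sup>2 * (e1 x * e1 x) + e2 x * e2 x) + 2 * (e1 x * e1 x)" for x
  have e: "test e1" "test e2" unfolding e1_def e2_def by (intro test_euler test_bump; simp)+
  show "0 \<le> D" unfolding D_def by simp
  show "test G" unfolding G_def[abs_def] by (intro test_add test_cmult test_mult1 e test_smooth)
  show "0 \<le> G x" for x unfolding G_def by simp
  show "norm x < 1 \<Longrightarrow> G x = 0" for x unfolding G_def e1_def e2_def by (simp add: euler_bump_zero euler_euler_bump_zero)
  fix \<delta> :: real assume \<delta>: "0 < \<delta>"
  show "\<forall>w\<in>{\<F> (almost_minimizer \<delta>), \<F> (\<F> (almost_minimizer \<delta>))}.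
        (w x)\<^sup>2 \<le> D * (\<delta> * (bump 1 x * bump 1 x * (x \<bullet> x + \<delta>) powr (- \<N> / 2 - 1))) + G x * (x \<bullet> x + \<delta>) powr (- \<N> / 2)" for x
  proof -
    define v where "v = almost_minimizer \<delta>"
    define q where "q x = (x \<bullet> x + \<delta>) powr (- \<N> / 4)" for x :: "real^'n"
    define \<kappa> where "\<kappa> x = \<delta> * (1 / (x \<bullet> x + \<delta>) ^ 1)" for x :: "real^'n"
    have pos: "0 < x \<bullet> x + \<delta>" for x :: "real^'n" using \<delta> by (simp add: add_nonneg_pos)
    have \<kappa>: "0 \<le> \<kappa> x" "\<kappa> x \<le> 1" for x
      unfolding \<kappa>_def using pos[of x] \<delta> by (auto simp: divide_le_eq_1)
    have \<kappa>_alt: "(x \<bullet> x) / (x \<bullet> x + \<delta>) = 1 - \<kappa> x" for x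
      unfolding \<kappa>_def using pos[of x] by (simp add: field_simps)
    have q_pair: "radial_pair q (\<lambda>x. 2 * (- \<N> / 4) * (x \<bullet> x + \<delta>) powr (- \<N> / 4 - 1))"
      unfolding q_def by (rule radial_pair_powr[OF \<delta>])
    have eul_q: "euler q x = - (\<N> / 2) * (1 - \<kappa> x) * q x" for x
      unfolding euler_radial[OF q_pair] \<kappa>_alt[symmetric] q_def using pos[of x] by (simp add: powr_diff)
    have \<kappa>_pair: "radial_pair \<kappa> (\<lambda>x. \<delta> * (- 2 * real 1 * (1 / (x \<bullet> x + \<delta>) ^ Suc 1)))"
      unfolding \<kappa>_def by (intro radial_pair_cmult radial_pair_inverse_power \<delta>)
    have eul_\<kappa>: "euler \<kappa> x = - 2 * \<kappa> x * (1 - \<kappa> x)" for x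
    proof -
      have "euler \<kappa> x = - 2 * \<kappa> x * ((x \<bullet> x) / (x \<bullet> x + \<delta>))"
        unfolding euler_radial[OF \<kappa>_pair] \<kappa>_def using pos[of x] by simp
      then show ?thesis unfolding \<kappa>_alt .
    qed
    have v_eq: "v = (\<lambda>x. bump 1 x * q x)" by (auto simp: v_def almost_minimizer_def q_def)
    have sm: "smooth v" "smooth q" "smooth \<kappa>" "smooth (bump 1 :: real^'n \<Rightarrow> real)" "smooth e1"
      using radial_pairD(1)[OF q_pair] radial_pairD(1)[OF \<kappa>_pair] test_smooth[OF test_bump[of 1]]
        test_smooth[OF e(1)] test_smooth[OF test_almost_minimizer[OF \<delta>]] by (auto simp: v_def)
    have Fv: "\<F> v x = \<N> / 2 * (\<kappa> x * v x) + q x * e1 x" for x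
      unfolding shifted_euler_def unfolding v_eq euler_mult[OF sm(4,2)] eul_q e1_def by (simp add: field_simps)
    have Fv_fun: "\<F> v = (\<lambda>x. \<N> / 2 * (\<kappa> x * v x) + q x * e1 x)" using Fv by blast
    have eul_v: "euler v x = \<N> / 2 * (\<kappa> x * v x) + q x * e1 x - \<N> / 2 * v x" for x
      using Fv[of x] unfolding shifted_euler_def by linarith
    have sm': "smooth (\<lambda>x. \<kappa> x * v x)" "smooth (\<lambda>x. \<N> / 2 * (\<kappa> x * v x))" "smooth (\<lambda>x. q x * e1 x)"
      by (intro smooth_cmult smooth_mult sm)+
    have "euler (\<F> v) x = \<N> / 2 * (euler \<kappa> x * v x + \<kappa> x * euler v x) + (euler q x * e1 x + q x * e2 x)" for x
      unfolding Fv_fun euler_add[OF sm'(2,3)] euler_cmult[OF sm'(1)] euler_mult[OF sm(3,1)] euler_mult[OF sm(2,5)] e2_def ..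
    then have FFv: "\<F> (\<F> v) x = \<kappa> x * v x * (- \<N> * (1 - \<kappa> x) + \<N>\<^sup>2 / 4 * \<kappa> x) + q x * (\<N> * \<kappa> x * e1 x + e2 x)" for x
      unfolding shifted_euler_def[of "\<F> v"] eul_q eul_\<kappa> eul_v Fv by (simp add: power2_eq_square field_simps)
    have qq: "(q x)\<^sup>2 = (x \<bullet> x + \<delta>) powr (- \<N> / 2)"
      unfolding q_def power2_eq_square by (simp add: powr_add[symmetric])
    have \<kappa>vv: "\<kappa> x * (v x)\<^sup>2 = \<delta> * (bump 1 x * bump 1 x * (x \<bullet> x + \<delta>) powr (- \<N> / 2 - 1))" (is "_ = ?E")
      unfolding power2_eq_square v_def almost_minimizer_square[OF \<delta>] \<kappa>_def using pos[of x] by (simp add: powr_diff)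
    have \<kappa>\<kappa>: "(\<kappa> x * v x)\<^sup>2 \<le> ?E"
      unfolding \<kappa>vv[symmetric] power_mult_distrib power2_eq_square[of "\<kappa> x"]
      using \<kappa>[of x] mult_left_mono[of "\<kappa> x" 1 "\<kappa> x"] by (intro mult_right_mono) auto
    have E0: "0 \<le> ?E" using \<delta> by simp
    have N: "0 < \<N>" by (rule hom_dim_pos)
    have "(\<F> v x)\<^sup>2 \<le> 2 * ((\<N> / 2 * (\<kappa> x * v x))\<^sup>2 + (q x * e1 x)\<^sup>2)"
      unfolding Fv by (rule square_sum2_le)
    also have "\<dots> = 2 * (\<N> / 2)\<^sup>2 * (\<kappa> x * v x)\<^sup>2 + (2 * (e1 x * e1 x)) * (q x)\<^sup>2"
      by (simp add: power_mult_distrib power2_eq_square)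
    also have "\<dots> \<le> D * ?E + G x * (q x)\<^sup>2"
      using \<kappa>\<kappa> E0 by (intro add_mono mult_mono mult_right_mono) (auto simp: D_def G_def)
    finally have 1: "(\<F> v x)\<^sup>2 \<le> D * ?E + G x * (q x)\<^sup>2" .
    have "\<bar>- \<N> * (1 - \<kappa> x) + \<N>\<^sup>2 / 4 * \<kappa> x\<bar> \<le> A"
    proof -
      have "\<bar>- \<N> * (1 - \<kappa> x)\<bar> \<le> \<N> * 1" unfolding abs_mult using \<kappa>[of x] N by (intro mult_mono) auto
      moreover have "\<bar>\<N>\<^sup>2 / 4 * \<kappa> x\<bar> \<le> \<N>\<^sup>2 / 4 * 1" unfolding abs_mult using \<kappa>[of x] by (intro mult_mono) auto
      ultimately show ?thesis unfolding A_def by linarith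
    qed
    then have A2: "(- \<N> * (1 - \<kappa> x) + \<N>\<^sup>2 / 4 * \<kappa> x)\<^sup>2 \<le> A\<^sup>2"
      by (metis abs_ge_zero power2_abs power_mono)
    have "(\<F> (\<F> v) x)\<^sup>2 \<le> 2 * ((\<kappa> x * v x * (- \<N> * (1 - \<kappa> x) + \<N>\<^sup>2 / 4 * \<kappa> x))\<^sup>2 + (q x * (\<N> * \<kappa> x * e1 x + e2 x))\<^sup>2)"
      unfolding FFv by (rule square_sum2_le)
    also have "\<dots> = 2 * (- \<N> * (1 - \<kappa> x) + \<N>\<^sup>2 / 4 * \<kappa> x)\<^sup>2 * (\<kappa> x * v x)\<^sup>2 + 2 * (\<N> * \<kappa> x * e1 x + e2 x)\<^sup>2 * (q x)\<^sup>2"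
      by (simp only: power_mult_distrib) (simp only: distrib_left mult_ac)
    also have "\<dots> \<le> D * ?E + G x * (q x)\<^sup>2"
    proof (intro add_mono mult_mono \<kappa>\<kappa>)
      show "2 * (- \<N> * (1 - \<kappa> x) + \<N>\<^sup>2 / 4 * \<kappa> x)\<^sup>2 \<le> D"
        using A2 unfolding D_def by (smt (verit) zero_le_power2)
      have "(\<N> * \<kappa> x * e1 x + e2 x)\<^sup>2 \<le> 2 * ((\<N> * \<kappa> x * e1 x)\<^sup>2 + (e2 x)\<^sup>2)" by (rule square_sum2_le)
      moreover have "(\<N> * \<kappa> x * e1 x)\<^sup>2 \<le> \<N>\<^sup>2 * (e1 x * e1 x)"
      proof -
        have "(\<kappa> x)\<^sup>2 \<le> 1" using \<kappa>[of x] by (simp add: abs_square_le_1)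
        then have "\<N>\<^sup>2 * (e1 x)\<^sup>2 * (\<kappa> x)\<^sup>2 \<le> \<N>\<^sup>2 * (e1 x)\<^sup>2 * 1" by (intro mult_left_mono) auto
        then show ?thesis by (simp add: power_mult_distrib power2_eq_square mult_ac)
      qed
      moreover have "(e2 x)\<^sup>2 = e2 x * e2 x" by (rule power2_eq_square)
      moreover have "2 * a \<le> 4 * (p' + r') + 2 * s" if "a \<le> 2 * (p + r)" "p \<le> p'" "r = r'" "0 \<le> s" for a p r p' r' s :: real
        using that by simp
      ultimately show "2 * (\<N> * \<kappa> x * e1 x + e2 x)\<^sup>2 \<le> G x"
        unfolding G_def using zero_le_square[of "e1 x"] by blast
    qed (use \<open>0 \<le> D\<close> in \<open>auto simp: G_def\<close>)
    finally have 2: "(\<F> (\<F> v) x)\<^sup>2 \<le> D * ?E + G x * (q x)\<^sup>2" .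
    from 1 2 show ?thesis unfolding qq v_def by simp
  qed
qed

lemma almost_minimizer_bounded:
  "\<exists>C. \<forall>\<delta>>0. (LINT x|\<mu>. \<F> (almost_minimizer \<delta>) x * \<F> (almost_minimizer \<delta>) x) \<le> C \<and>
    (LINT x|\<mu>. \<F> (\<F> (almost_minimizer \<delta>)) x * \<F> (\<F> (almost_minimizer \<delta>)) x) \<le> C"
proof -
  obtain D G where D: "0 \<le> D" and G: "test G" "\<And>x. 0 \<le> G x" "\<And>x. norm x < 1 \<Longrightarrow> G x = 0"
    and bound: "\<And>\<delta> x w. 0 < \<delta> \<Longrightarrow> w \<in> {\<F> (almost_minimizer \<delta>), \<F> (\<F> (almost_minimizer \<delta>))} \<Longrightarrow>
        (w x)\<^sup>2 \<le> D * (\<delta> * (bump 1 x * bump 1 x * (x \<bullet> x + \<delta>) powr (- \<N> / 2 - 1))) + G x * (x \<bullet> x + \<delta>) powr (- \<N> / 2)"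
    using almost_minimizer_pointwise_bound by blast
  obtain C where C: "\<And>\<delta>. 0 < \<delta> \<Longrightarrow> \<delta> * (LINT x|\<mu>. bump 1 x * bump 1 x * (x \<bullet> x + \<delta>) powr (- \<N> / 2 - 1)) \<le> C"
    using integral_concentrated_bound by blast
  have "(LINT x|\<mu>. w x * w x) \<le> D * C + (LINT x|\<mu>. G x)"
    if \<delta>: "0 < \<delta>" and w: "w \<in> {\<F> (almost_minimizer \<delta>), \<F> (\<F> (almost_minimizer \<delta>))}" for \<delta> w
  proof -
    have tw: "test w" using w test_almost_minimizer[OF \<delta>] test_shifted_euler by auto
    have tE: "test (\<lambda>x::real^'n. D * (\<delta> * (bump 1 x * bump 1 x * (x \<bullet> x + \<delta>) powr (- \<N> / 2 - 1))))"
      by (rule test_cmult)+ (rule test_mult1[OF bump_square_pair(1) smooth_shift_powr[OF \<delta>]])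
    have "(LINT x|\<mu>. w x * w x) \<le> (LINT x|\<mu>. D * (\<delta> * (bump 1 x * bump 1 x * (x \<bullet> x + \<delta>) powr (- \<N> / 2 - 1))) + G x)"
    proof (rule integral_mono)
      show "integrable \<mu> (\<lambda>x. w x * w x)" by (intro integrable_test test_mult1 tw test_smooth)
      show "integrable \<mu> (\<lambda>x. D * (\<delta> * (bump 1 x * bump 1 x * (x \<bullet> x + \<delta>) powr (- \<N> / 2 - 1))) + G x)"
        by (intro integrable_test test_add tE G)
      fix x
      have "G x * (x \<bullet> x + \<delta>) powr (- \<N> / 2) \<le> G x"
        using hom_dim_pos by (intro bump_outside_powr_le G \<delta>) auto
      then show "w x * w x \<le> D * (\<delta> * (bump 1 x * bump 1 x * (x \<bullet> x + \<delta>) powr (- \<N> / 2 - 1))) + G x"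
        using bound[OF \<delta> w, of x] by (simp add: power2_eq_square)
    qed
    also have "\<dots> = D * (\<delta> * (LINT x|\<mu>. bump 1 x * bump 1 x * (x \<bullet> x + \<delta>) powr (- \<N> / 2 - 1))) + (LINT x|\<mu>. G x)"
      using integrable_test[OF tE] integrable_test[OF G(1)] by simp
    also have "\<dots> \<le> D * C + (LINT x|\<mu>. G x)"
      using C[OF \<delta>] D by (intro add_right_mono mult_left_mono)
    finally show ?thesis .
  qed
  then show ?thesis by blast
qed

text \<open>The supposed inequality is tested on \<open>(x \<bullet> x) * v x\<close> with the
  radial near-minimizer \<open>v\<close>. There \<open>\<L>\<close> and \<open>\<A>\<close> vanish,
  and what remains bounds \<open>(C - \<N>\<^sup>2 / 4) * b\<^sup>2\<close> times the squared norm
  of \<open>v\<close> by the squared norms of \<open>\<F> v\<close> and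
  \<open>\<F> (\<F> v)\<close>. These stay bounded as \<delta> varies, unlike that of
  \<open>v\<close>.\<close>

lemma rellich_sharp:
  assumes N: "4 < \<N>" and "\<N>\<^sup>2 / 4 < C"
    and ineq: "\<And>u. test u \<Longrightarrow> C * (LINT x|\<mu>. (norm (dunkl_gradient Rp k u x))\<^sup>2 / (norm x)\<^sup>2) \<le> (LINT x|\<mu>. (\<Delta> u x)\<^sup>2)"
  shows False
proof -
  define b where "b = \<N> / 2 - 2"
  have b: "0 < b" using N by (simp add: b_def)
  define d where "d = (C - \<N>\<^sup>2 / 4) * b\<^sup>2"
  have d: "0 < d" using assms b by (simp add: d_def)
  obtain B where B: "\<And>\<delta>. 0 < \<delta> \<Longrightarrow> (LINT x|\<mu>. \<F> (almost_minimizer \<delta>) x * \<F> (almost_minimizer \<delta>) x) \<le> B"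
     "\<And>\<delta>. 0 < \<delta> \<Longrightarrow> (LINT x|\<mu>. \<F> (\<F> (almost_minimizer \<delta>)) x * \<F> (\<F> (almost_minimizer \<delta>)) x) \<le> B"
    using almost_minimizer_bounded by blast
  have "(LINT x|\<mu>. almost_minimizer \<delta> x * almost_minimizer \<delta> x) \<le> (B + (4 + \<N> * b) * B) / d" if \<delta>: "0 < \<delta>" for \<delta>
  proof -
    define v where "v = almost_minimizer \<delta>"
    have v: "test v" unfolding v_def by (rule test_almost_minimizer[OF \<delta>])
    obtain \<phi>' \<phi>'' where bump: "radial_pair (bump 1 :: real^'n \<Rightarrow> real) \<phi>'" "radial_pair \<phi>' \<phi>''"
      using bump_radial_pair[of 1] by (metis zero_less_one)
    have v_pair: "\<exists>v' v''. radial_pair v v' \<and> radial_pair v' v''"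
    proof -
      note rp = radial_pair_powr[OF \<delta>, where 'n = 'n]
      have 1: "radial_pair v (\<lambda>x. \<phi>' x * (x \<bullet> x + \<delta>) powr (- \<N> / 4) + bump 1 x * (2 * (- \<N> / 4) * (x \<bullet> x + \<delta>) powr (- \<N> / 4 - 1)))"
        unfolding v_def almost_minimizer_def[abs_def] by (intro radial_pair_mult bump rp)
      obtain w' where 2: "radial_pair (\<lambda>x. \<phi>' x * (x \<bullet> x + \<delta>) powr (- \<N> / 4)) w'"
        using radial_pair_mult[OF bump(2) rp] by blast
      \<comment> \<open>The factor -1 turns the sum in \<open>1\<close> into a difference, to which
        \<open>radial_pair_diff\<close> applies.\<close>
      have "\<exists>w''. radial_pair (\<lambda>x::real^'n. - 1 * (bump 1 x * (2 * (- \<N> / 4) * (x \<bullet> x + \<delta>) powr (- \<N> / 4 - 1)))) w''"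
        by (rule exI) (rule radial_pair_cmult[OF radial_pair_mult[OF bump(1) radial_pair_cmult[OF rp]]])
      then obtain w'' where 3: "radial_pair (\<lambda>x::real^'n. - 1 * (bump 1 x * (2 * (- \<N> / 4) * (x \<bullet> x + \<delta>) powr (- \<N> / 4 - 1)))) w''"
        by blast
      from 1 radial_pair_diff[OF 2 3] show ?thesis by auto
    qed
    then have Lv: "\<L> v = (\<lambda>x. 0)" and Av: "\<A> v = (\<lambda>x. 0)"
      using angular_radial defect_radial by blast+
    have "\<L> (\<F> v) x = 0" for x
      unfolding angular_shifted_euler[OF test_smooth[OF v]] Lv by (simp add: shifted_euler_def)
    then have LFv: "\<L> (\<F> v) = (\<lambda>x. 0)" by blast
    define X Y Z where "X = (LINT x|\<mu>. \<F> (\<F> v) x * \<F> (\<F> v) x)" and "Y = (LINT x|\<mu>. \<F> v x * \<F> v x)"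
      and "Z = (LINT x|\<mu>. v x * v x)"
    have XYB: "X \<le> B" "Y \<le> B" "0 \<le> Y"
      unfolding X_def Y_def v_def using B[OF \<delta>] by (auto intro: Bochner_Integration.integral_nonneg)
    have tu: "test (\<lambda>x. (x \<bullet> x) * v x)" using v by (intro test_mult2) auto
    \<comment> \<open>In terms of \<open>b\<close> the recurring constant
      \<open>\<N> * (\<N> - 4) / 4\<close> is \<open>\<N> * b / 2\<close>.\<close>
    have "C * (Y + b\<^sup>2 * Z) \<le> X + (4 + \<N> * b) * Y + \<N>\<^sup>2 / 4 * b\<^sup>2 * Z"
      using ineq[OF tu] unfolding integral_gradient_inner_self_mult[OF v] integral_Lap_inner_self_mult[OF v] Lv Av LFv
      unfolding X_def Y_def Z_def b_def by (simp add: power2_eq_square field_simps)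
    moreover have "0 \<le> C * Y" using XYB assms(2) by (intro mult_nonneg_nonneg) (auto intro: order.trans[of _ "\<N>\<^sup>2 / 4"])
    ultimately have "d * Z \<le> X + (4 + \<N> * b) * Y" by (simp add: d_def algebra_simps)
    also have "\<dots> \<le> B + (4 + \<N> * b) * B"
      using XYB b N by (intro add_mono mult_left_mono) auto
    finally show ?thesis using d unfolding Z_def v_def by (simp add: pos_le_divide_eq mult.commute)
  qed
  then show False using almost_minimizer_unbounded by blast
qed

end

theorem theorem4p2:
  fixes R Rp :: "(real^'n) set" and k :: "real^'n \<Rightarrow> real" and \<gamma> Nbar :: real
  assumes "normalized_root_system R"
    and "positive_subsystem Rp R"
    and "multiplicity_function R k"
    and "\<gamma> = (\<Sum>\<alpha>\<in>Rp. k \<alpha>)"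
    and "Nbar = real CARD('n) + 2 * \<gamma>"
    and "real CARD('n) \<ge> 5 + 2 * \<gamma>"
  shows "(\<forall>u\<in>test_functions.
            (LINT x|dunkl_measure Rp k. \<bar>dunkl_laplacian Rp k u x\<bar>\<^sup>2)
              \<ge> Nbar\<^sup>2 / 4 *
                 (LINT x|dunkl_measure Rp k. (norm (dunkl_gradient Rp k u x))\<^sup>2 / (norm x)\<^sup>2)) \<and>
         \<not> (\<exists>C > Nbar\<^sup>2 / 4. \<forall>u\<in>test_functions.
            (LINT x|dunkl_measure Rp k. \<bar>dunkl_laplacian Rp k u x\<bar>\<^sup>2)
              \<ge> C * (LINT x|dunkl_measure Rp k. (norm (dunkl_gradient Rp k u x))\<^sup>2 / (norm x)\<^sup>2))"
proof -
  interpret dunkl R Rp k using assms(1-3) by unfold_locales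
  have Nbar: "hom_dim = Nbar" by (simp add: hom_dim_def total_multiplicity_def assms(4,5))
  \<comment> \<open>The dimension hypothesis with \<open>2 * \<gamma>\<close> added to both
    sides.\<close>
  have N: "5 + 4 * total_multiplicity \<le> hom_dim"
    using assms(6)[unfolded assms(4)] unfolding hom_dim_def total_multiplicity_def by linarith
  then have N4: "4 < hom_dim" using total_multiplicity_nonneg by linarith
  have test: "u \<in> test_functions \<longleftrightarrow> test u" for u :: "real^'n \<Rightarrow> real"
    by (simp add: test_functions_iff test_def)
  show ?thesis
  proof (intro conjI ballI notI)
    fix u :: "real^'n \<Rightarrow> real" assume "u \<in> test_functions"
    then have "test u" by (simp only: test)
    from rellich_inequality[OF this N]
    show "(LINT x|dunkl_measure Rp k. \<bar>dunkl_laplacian Rp k u x\<bar>\<^sup>2)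
              \<ge> Nbar\<^sup>2 / 4 * (LINT x|dunkl_measure Rp k. (norm (dunkl_gradient Rp k u x))\<^sup>2 / (norm x)\<^sup>2)"
      by (simp only: Nbar power2_abs)
  next
    assume "\<exists>C > Nbar\<^sup>2 / 4. \<forall>u\<in>test_functions. (LINT x|dunkl_measure Rp k. \<bar>dunkl_laplacian Rp k u x\<bar>\<^sup>2)
              \<ge> C * (LINT x|dunkl_measure Rp k. (norm (dunkl_gradient Rp k u x))\<^sup>2 / (norm x)\<^sup>2)"
    then obtain C where C: "hom_dim\<^sup>2 / 4 < C" "\<And>u. test u \<Longrightarrow> (LINT x|dunkl_measure Rp k. (dunkl_laplacian Rp k u x)\<^sup>2)
              \<ge> C * (LINT x|dunkl_measure Rp k. (norm (dunkl_gradient Rp k u x))\<^sup>2 / (norm x)\<^sup>2)"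
      by (auto simp only: Nbar test power2_abs)
    show False by (rule rellich_sharp[OF N4 C])
  qed
qed

end
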